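(* Let $\mathcal{A}$ be a semi-abelian category with enough (regular) projectives and $\mathcal{B}$ a Birkhoff subcategory of $\mathcal{A}$ containing $\mathrm{Ab}(\mathcal{A})$. Suppose that for every $\mathcal{B}$-central extension $u\colon U\to A$ the following five conditions are equivalent: (1) $U$ is $\mathcal{B}$-perfect and every $\mathcal{B}$-central extension of $U$ splits; (2) $U$ is $\mathcal{B}$-perfect and projective with respect to all $\mathcal{B}$-central extensions; (3) for every $\mathcal{B}$-central extension $f\colon D\to E$ (with $E$ arbitrary), the map $\mathrm{Hom}(U,f)=f\circ(-)\colon\mathrm{Hom}(U,D)\to\mathrm{Hom}(U,E)$ is a bijection; (4) $U$ is $\mathcal{B}$-perfect and $u$ is a weakly universal $\mathcal{B}$-central extension; (5) $u$ is a universal $\mathcal{B}$-central extension. Then the following holds: if $B$ is a $\mathcal{B}$-perfect object, and $f\colon B\to A$ and $g\colon C\to B$ are $\mathcal{B}$-central extensions, then the extension $f\circ g$ is $\mathcal{B}$-central. In particular, if the five conditions are equivalent (for every such $u$) when $\mathcal{B}=\mathrm{Ab}(\mathcal{A})$, then for every $\mathrm{Ab}(\mathcal{A})$-perfect object $B$ and all $\mathrm{Ab}(\mathcal{A})$-central extensions $f\colon B\to A$ and $g\colon C\to B$, the extension $f\circ g$ is $\mathrm{Ab}(\mathcal{A})$-central.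
   Context: A category is semi-abelian when it is pointed, Barr exact and Bourn protomodular with binary coproducts. A Birkhoff subcategory $\mathcal{B}$ of a semi-abelian category $\mathcal{A}$ is a full reflective subcategory closed under subobjects and regular quotients; $I\colon\mathcal{A}\to\mathcal{B}$ is the left adjoint of the inclusion, with unit $\eta_A\colon A\to I(A)$. $\mathrm{Ab}(\mathcal{A})$ is the Birkhoff subcategory of $\mathcal{A}$ of all objects admitting an internal abelian group structure. An object $P$ is $\mathcal{B}$-perfect when $I(P)=0$. Enough projectives: every object $A$ admits a regular epimorphism $P\to A$ with $P$ (regular) projective. An extension is a regular epimorphism. An extension $f\colon B\to A$ is $\mathcal{B}$-trivial when the naturality square $\eta_A\circ f=I(f)\circ\eta_B$ is a pullback, and $\mathcal{B}$-central when there is an extension $g\colon C\to A$ such that the pullback $g^*(f)$ of $f$ along $g$ is $\mathcal{B}$-trivial. An extension splits when it is a split epimorphism. An object $U$ is projective with respect to all $\mathcal{B}$-central extensions when for every $\mathcal{B}$-central extension $f\colon D\to E$ and every morphism $g\colon U\to E$ there is $h\colon U\to D$ with $f\circ h=g$. A (weakly) universal $\mathcal{B}$-central extension of $A$ is a (weakly) initial object of the full subcategory of the slice category $(\mathcal{A}\downarrow A)$ determined by the $\mathcal{B}$-central extensions of $A$. *)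

theory Defs
  imports Main
begin

section \<open>Categories\<close>

text \<open>Values of \<open>Comp\<close> on non-composable arguments are irrelevant.\<close>

record ('o, 'm) category =
  Obj :: "'o set"
  Arr :: "'m set"
  Dom :: "'m \<Rightarrow> 'o"
  Cod :: "'m \<Rightarrow> 'o"
  Id :: "'o \<Rightarrow> 'm"
  Comp :: "'m \<Rightarrow> 'm \<Rightarrow> 'm"  (infixr "\<cdot>\<index>" 70)

definition hom :: "('o, 'm) category \<Rightarrow> 'o \<Rightarrow> 'o \<Rightarrow> 'm set" where
  "hom C X Y = {f \<in> Arr C. Dom C f = X \<and> Cod C f = Y}"

locale category =
  fixes C :: "('o, 'm) category" (structure)
  assumes Dom_Obj: "f \<in> Arr C \<Longrightarrow> Dom C f \<in> Obj C"
    and Cod_Obj: "f \<in> Arr C \<Longrightarrow> Cod C f \<in> Obj C"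
    and Id_hom: "X \<in> Obj C \<Longrightarrow> Id C X \<in> hom C X X"
    and Comp_hom: "\<lbrakk>f \<in> hom C X Y; g \<in> hom C Y Z\<rbrakk> \<Longrightarrow> g \<cdot> f \<in> hom C X Z"
    and Comp_Id: "f \<in> hom C X Y \<Longrightarrow> f \<cdot> Id C X = f"
    and Id_Comp: "f \<in> hom C X Y \<Longrightarrow> Id C Y \<cdot> f = f"
    and Comp_assoc: "\<lbrakk>f \<in> hom C W X; g \<in> hom C X Y; h \<in> hom C Y Z\<rbrakk>
      \<Longrightarrow> (h \<cdot> g) \<cdot> f = h \<cdot> (g \<cdot> f)"

definition full_subcategory :: "('o, 'm) category \<Rightarrow> 'o set \<Rightarrow> ('o, 'm) category" where
  "full_subcategory C S = \<lparr>Obj = S, Arr = {f \<in> Arr C. Dom C f \<in> S \<and> Cod C f \<in> S},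
     Dom = Dom C, Cod = Cod C, Id = Id C, Comp = Comp C\<rparr>"

text \<open>An arrow of the slice over \<open>A\<close> from \<open>f\<close> to \<open>g\<close> is a triple \<open>(f, h, g)\<close> with
  \<open>g \<cdot> h = f\<close>; recording \<open>f\<close> and \<open>g\<close> makes domain and codomain functions of the arrow.\<close>

definition slice :: "('o, 'm) category \<Rightarrow> 'o \<Rightarrow> ('m, 'm \<times> 'm \<times> 'm) category" where
  "slice C A = \<lparr>Obj = {f \<in> Arr C. Cod C f = A},
     Arr = {(f, h, g). f \<in> Arr C \<and> Cod C f = A \<and> g \<in> Arr C \<and> Cod C g = A \<and>
              h \<in> hom C (Dom C f) (Dom C g) \<and> g \<cdot>\<^bsub>C\<^esub> h = f},
     Dom = (\<lambda>(f, h, g). f), Cod = (\<lambda>(f, h, g). g),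
     Id = (\<lambda>f. (f, Id C (Dom C f), f)),
     Comp = (\<lambda>(f', k, g) (f, h, g'). (f, k \<cdot>\<^bsub>C\<^esub> h, g))\<rparr>"

lemma hom_full_subcategory:
  "f \<in> hom (full_subcategory C S) X Y \<longleftrightarrow> f \<in> hom C X Y \<and> X \<in> S \<and> Y \<in> S"
  by (auto simp: full_subcategory_def hom_def)

lemma hom_slice:
  "f \<in> hom (slice C A) X Y \<longleftrightarrow>
     (\<exists>h. f = (X, h, Y) \<and> X \<in> Arr C \<and> Cod C X = A \<and> Y \<in> Arr C \<and> Cod C Y = A \<and>
        h \<in> hom C (Dom C X) (Dom C Y) \<and> Y \<cdot>\<^bsub>C\<^esub> h = X)"
  by (auto simp: slice_def hom_def)

lemma category_full_subcategory:
  assumes "category C" "S \<subseteq> Obj C"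
  shows "category (full_subcategory C S)"
proof -
  interpret category C by fact
  have [simp]: "Obj (full_subcategory C S) = S" "Id (full_subcategory C S) = Id C"
    "Comp (full_subcategory C S) = Comp C"
    by (simp_all add: full_subcategory_def)
  show ?thesis
  proof
    fix X assume "X \<in> Obj (full_subcategory C S)"
    then show "Id (full_subcategory C S) X \<in> hom (full_subcategory C S) X X"
      using Id_hom assms(2) by (auto simp: hom_full_subcategory)
  qed (simp add: full_subcategory_def, simp add: full_subcategory_def,
      auto simp: hom_full_subcategory intro: Comp_hom Comp_Id Id_Comp Comp_assoc)
qed

lemma category_slice:
  assumes "category C"
  shows "category (slice C A)"
proof -
  interpret category C by fact
  have arr: "f \<in> hom C (Dom C f) (Cod C f)" if "f \<in> Arr C" for f
    using that by (simp add: hom_def)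
  have [simp]: "Id (slice C A) X = (X, Id C (Dom C X), X)"
    "(Y', k, Z) \<cdot>\<^bsub>slice C A\<^esub> (X, h, Y) = (X, k \<cdot>\<^bsub>C\<^esub> h, Z)" for X Y Y' Z h k
    by (simp_all add: slice_def)
  show ?thesis
  proof
    fix f X Y g Z assume "f \<in> hom (slice C A) X Y" "g \<in> hom (slice C A) Y Z"
    then obtain h k where *: "f = (X, h, Y)" "X \<in> Arr C" "Cod C X = A" "g = (Y, k, Z)"
        "Z \<in> Arr C" "Cod C Z = A" "h \<in> hom C (Dom C X) (Dom C Y)"
        "k \<in> hom C (Dom C Y) (Dom C Z)" "Y \<cdot>\<^bsub>C\<^esub> h = X" "Z \<cdot>\<^bsub>C\<^esub> k = Y"
      unfolding hom_slice by blast
    then have "Z \<cdot>\<^bsub>C\<^esub> (k \<cdot>\<^bsub>C\<^esub> h) = X"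
      using Comp_assoc[OF *(7) *(8) arr[OF *(5)]] by simp
    then show "g \<cdot>\<^bsub>slice C A\<^esub> f \<in> hom (slice C A) X Z"
      using * Comp_hom[OF *(7) *(8)] by (simp add: hom_slice)
  next
    fix f W X g Y h Z
    assume "f \<in> hom (slice C A) W X" "g \<in> hom (slice C A) X Y" "h \<in> hom (slice C A) Y Z"
    then obtain h1 h2 h3 where *: "f = (W, h1, X)" "g = (X, h2, Y)" "h = (Y, h3, Z)"
        "h1 \<in> hom C (Dom C W) (Dom C X)" "h2 \<in> hom C (Dom C X) (Dom C Y)"
        "h3 \<in> hom C (Dom C Y) (Dom C Z)"
      unfolding hom_slice by blast
    show "(h \<cdot>\<^bsub>slice C A\<^esub> g) \<cdot>\<^bsub>slice C A\<^esub> f = h \<cdot>\<^bsub>slice C A\<^esub> (g \<cdot>\<^bsub>slice C A\<^esub> f)"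
      using Comp_assoc[OF *(4-6)] by (simp add: *(1-3))
  next
    fix X assume "X \<in> Obj (slice C A)"
    then have "X \<in> Arr C" "Cod C X = A"
      by (simp_all add: slice_def)
    then show "Id (slice C A) X \<in> hom (slice C A) X X"
      using Id_hom[OF Dom_Obj] Comp_Id[OF arr] by (simp add: hom_slice)
  next
    fix f assume "f \<in> Arr (slice C A)"
    then show "Dom (slice C A) f \<in> Obj (slice C A)" "Cod (slice C A) f \<in> Obj (slice C A)"
      by (auto simp: slice_def)
  next
    fix f X Y assume "f \<in> hom (slice C A) X Y"
    then obtain h where *: "f = (X, h, Y)" "h \<in> hom C (Dom C X) (Dom C Y)"
      unfolding hom_slice by blast
    show "f \<cdot>\<^bsub>slice C A\<^esub> Id (slice C A) X = f" "Id (slice C A) Y \<cdot>\<^bsub>slice C A\<^esub> f = f"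
      using Comp_Id[OF *(2)] Id_Comp[OF *(2)] by (simp_all add: *(1))
  qed
qed

record ('o, 'm) endo_map =
  obj_map :: "'o \<Rightarrow> 'o"
  arr_map :: "'m \<Rightarrow> 'm"

text \<open>Both categories share their carrier types, which is all that is needed for a functor into
  a subcategory.\<close>

definition is_functor ::
    "('o, 'm) category \<Rightarrow> ('o, 'm) category \<Rightarrow> ('o, 'm) endo_map \<Rightarrow> bool" where
  "is_functor C D F \<longleftrightarrow>
     (\<forall>X\<in>Obj C. obj_map F X \<in> Obj D) \<and>
     (\<forall>f\<in>Arr C. arr_map F f \<in> hom D (obj_map F (Dom C f)) (obj_map F (Cod C f))) \<and>
     (\<forall>X\<in>Obj C. arr_map F (Id C X) = Id D (obj_map F X)) \<and>
     (\<forall>f\<in>Arr C. \<forall>g\<in>Arr C. Dom C g = Cod C f \<longrightarrow>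
        arr_map F (g \<cdot>\<^bsub>C\<^esub> f) = arr_map F g \<cdot>\<^bsub>D\<^esub> arr_map F f)"


section \<open>Limits, colimits and classes of arrows\<close>

definition weakly_initial :: "('o, 'm) category \<Rightarrow> 'o \<Rightarrow> bool" where
  "weakly_initial C X \<longleftrightarrow> X \<in> Obj C \<and> (\<forall>Y\<in>Obj C. \<exists>f. f \<in> hom C X Y)"

definition initial :: "('o, 'm) category \<Rightarrow> 'o \<Rightarrow> bool" where
  "initial C X \<longleftrightarrow> X \<in> Obj C \<and> (\<forall>Y\<in>Obj C. \<exists>!f. f \<in> hom C X Y)"

definition terminal :: "('o, 'm) category \<Rightarrow> 'o \<Rightarrow> bool" where
  "terminal C X \<longleftrightarrow> X \<in> Obj C \<and> (\<forall>Y\<in>Obj C. \<exists>!f. f \<in> hom C Y X)"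

definition zero_object :: "('o, 'm) category \<Rightarrow> 'o \<Rightarrow> bool" where
  "zero_object C X \<longleftrightarrow> initial C X \<and> terminal C X"

definition iso :: "('o, 'm) category \<Rightarrow> 'm \<Rightarrow> bool" where
  "iso C f \<longleftrightarrow> f \<in> Arr C \<and> (\<exists>g\<in>hom C (Cod C f) (Dom C f).
     g \<cdot>\<^bsub>C\<^esub> f = Id C (Dom C f) \<and> f \<cdot>\<^bsub>C\<^esub> g = Id C (Cod C f))"

definition mono :: "('o, 'm) category \<Rightarrow> 'm \<Rightarrow> bool" where
  "mono C f \<longleftrightarrow> f \<in> Arr C \<and> (\<forall>X. \<forall>g\<in>hom C X (Dom C f). \<forall>h\<in>hom C X (Dom C f).
     f \<cdot>\<^bsub>C\<^esub> g = f \<cdot>\<^bsub>C\<^esub> h \<longrightarrow> g = h)"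

definition split_epi :: "('o, 'm) category \<Rightarrow> 'm \<Rightarrow> bool" where
  "split_epi C f \<longleftrightarrow> f \<in> Arr C \<and>
     (\<exists>s\<in>hom C (Cod C f) (Dom C f). f \<cdot>\<^bsub>C\<^esub> s = Id C (Cod C f))"

text \<open>\<open>is_product C X Y P p q\<close>: the span \<open>p : P \<rightarrow> X\<close>, \<open>q : P \<rightarrow> Y\<close> is a product of \<open>X\<close> and \<open>Y\<close>.\<close>

definition is_product ::
    "('o, 'm) category \<Rightarrow> 'o \<Rightarrow> 'o \<Rightarrow> 'o \<Rightarrow> 'm \<Rightarrow> 'm \<Rightarrow> bool" where
  "is_product C X Y P p q \<longleftrightarrow> p \<in> hom C P X \<and> q \<in> hom C P Y \<and>
     (\<forall>Z. \<forall>x\<in>hom C Z X. \<forall>y\<in>hom C Z Y. \<exists>!h. h \<in> hom C Z P \<and> p \<cdot>\<^bsub>C\<^esub> h = x \<and> q \<cdot>\<^bsub>C\<^esub> h = y)"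

definition is_coproduct ::
    "('o, 'm) category \<Rightarrow> 'o \<Rightarrow> 'o \<Rightarrow> 'o \<Rightarrow> 'm \<Rightarrow> 'm \<Rightarrow> bool" where
  "is_coproduct C X Y S i j \<longleftrightarrow> i \<in> hom C X S \<and> j \<in> hom C Y S \<and>
     (\<forall>Z. \<forall>x\<in>hom C X Z. \<forall>y\<in>hom C Y Z. \<exists>!h. h \<in> hom C S Z \<and> h \<cdot>\<^bsub>C\<^esub> i = x \<and> h \<cdot>\<^bsub>C\<^esub> j = y)"

text \<open>The square \<open>f \<cdot> p = g \<cdot> q\<close> is a pullback; \<open>q\<close> is then the pullback of \<open>f\<close> along \<open>g\<close>.\<close>

definition is_pullback ::
    "('o, 'm) category \<Rightarrow> 'm \<Rightarrow> 'm \<Rightarrow> 'm \<Rightarrow> 'm \<Rightarrow> bool" where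
  "is_pullback C f g p q \<longleftrightarrow>
     f \<in> Arr C \<and> g \<in> Arr C \<and> p \<in> Arr C \<and> q \<in> Arr C \<and>
     Cod C f = Cod C g \<and> Dom C p = Dom C q \<and> Cod C p = Dom C f \<and> Cod C q = Dom C g \<and>
     f \<cdot>\<^bsub>C\<^esub> p = g \<cdot>\<^bsub>C\<^esub> q \<and>
     (\<forall>Z. \<forall>x\<in>hom C Z (Dom C f). \<forall>y\<in>hom C Z (Dom C g). f \<cdot>\<^bsub>C\<^esub> x = g \<cdot>\<^bsub>C\<^esub> y \<longrightarrow>
        (\<exists>!h. h \<in> hom C Z (Dom C p) \<and> p \<cdot>\<^bsub>C\<^esub> h = x \<and> q \<cdot>\<^bsub>C\<^esub> h = y))"

definition is_coequalizer :: "('o, 'm) category \<Rightarrow> 'm \<Rightarrow> 'm \<Rightarrow> 'm \<Rightarrow> bool" where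
  "is_coequalizer C f g e \<longleftrightarrow>
     f \<in> Arr C \<and> g \<in> Arr C \<and> e \<in> Arr C \<and>
     Dom C f = Dom C g \<and> Cod C f = Cod C g \<and> Dom C e = Cod C f \<and>
     e \<cdot>\<^bsub>C\<^esub> f = e \<cdot>\<^bsub>C\<^esub> g \<and>
     (\<forall>Z. \<forall>h\<in>hom C (Cod C f) Z. h \<cdot>\<^bsub>C\<^esub> f = h \<cdot>\<^bsub>C\<^esub> g \<longrightarrow>
        (\<exists>!k. k \<in> hom C (Cod C e) Z \<and> k \<cdot>\<^bsub>C\<^esub> e = h))"

definition regular_epi :: "('o, 'm) category \<Rightarrow> 'm \<Rightarrow> bool" where
  "regular_epi C e \<longleftrightarrow> (\<exists>f g. is_coequalizer C f g e)"


section \<open>Semi-abelian categories\<close>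

definition pointed :: "('o, 'm) category \<Rightarrow> bool" where
  "pointed C \<longleftrightarrow> (\<exists>X. zero_object C X)"

definition finitely_complete :: "('o, 'm) category \<Rightarrow> bool" where
  "finitely_complete C \<longleftrightarrow> (\<exists>X. terminal C X) \<and>
     (\<forall>f\<in>Arr C. \<forall>g\<in>Arr C. Cod C f = Cod C g \<longrightarrow> (\<exists>p q. is_pullback C f g p q))"

definition regular_category :: "('o, 'm) category \<Rightarrow> bool" where
  "regular_category C \<longleftrightarrow> finitely_complete C \<and>
     (\<forall>f p q. is_pullback C f f p q \<longrightarrow> (\<exists>e. is_coequalizer C p q e)) \<and>
     (\<forall>f g p q. is_pullback C f g p q \<longrightarrow> regular_epi C f \<longrightarrow> regular_epi C q)"

definition internal_equivalence_relation ::
    "('o, 'm) category \<Rightarrow> 'o \<Rightarrow> 'o \<Rightarrow> 'm \<Rightarrow> 'm \<Rightarrow> bool" where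
  "internal_equivalence_relation C X R r\<^sub>1 r\<^sub>2 \<longleftrightarrow>
     r\<^sub>1 \<in> hom C R X \<and> r\<^sub>2 \<in> hom C R X \<and>
     \<comment> \<open>jointly monic\<close>
     (\<forall>Z. \<forall>x\<in>hom C Z R. \<forall>y\<in>hom C Z R. r\<^sub>1 \<cdot>\<^bsub>C\<^esub> x = r\<^sub>1 \<cdot>\<^bsub>C\<^esub> y \<and> r\<^sub>2 \<cdot>\<^bsub>C\<^esub> x = r\<^sub>2 \<cdot>\<^bsub>C\<^esub> y \<longrightarrow> x = y) \<and>
     \<comment> \<open>reflexive\<close>
     (\<exists>d\<in>hom C X R. r\<^sub>1 \<cdot>\<^bsub>C\<^esub> d = Id C X \<and> r\<^sub>2 \<cdot>\<^bsub>C\<^esub> d = Id C X) \<and>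
     \<comment> \<open>symmetric\<close>
     (\<exists>s\<in>hom C R R. r\<^sub>1 \<cdot>\<^bsub>C\<^esub> s = r\<^sub>2 \<and> r\<^sub>2 \<cdot>\<^bsub>C\<^esub> s = r\<^sub>1) \<and>
     \<comment> \<open>transitive\<close>
     (\<forall>p q. is_pullback C r\<^sub>2 r\<^sub>1 p q \<longrightarrow>
        (\<exists>t\<in>hom C (Dom C p) R. r\<^sub>1 \<cdot>\<^bsub>C\<^esub> t = r\<^sub>1 \<cdot>\<^bsub>C\<^esub> p \<and> r\<^sub>2 \<cdot>\<^bsub>C\<^esub> t = r\<^sub>2 \<cdot>\<^bsub>C\<^esub> q))"

definition Barr_exact :: "('o, 'm) category \<Rightarrow> bool" where
  "Barr_exact C \<longleftrightarrow> regular_category C \<and>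
     (\<forall>X R r\<^sub>1 r\<^sub>2. internal_equivalence_relation C X R r\<^sub>1 r\<^sub>2 \<longrightarrow> (\<exists>f. is_pullback C f f r\<^sub>1 r\<^sub>2))"

text \<open>A point over \<open>Y\<close> is a split epimorphism into \<open>Y\<close> with a chosen splitting.  Protomodularity
  says that for every \<open>v : X \<rightarrow> Y\<close> the functor \<open>v\<^sup>*\<close> from points over \<open>Y\<close> to points over \<open>X\<close>
  reflects isomorphisms.  Here \<open>h\<close> is a morphism of points over \<open>Y\<close> and \<open>k = v\<^sup>*(h)\<close>; a morphism
  of points is invertible iff its underlying arrow is.\<close>

definition is_point :: "('o, 'm) category \<Rightarrow> 'o \<Rightarrow> 'm \<Rightarrow> 'm \<Rightarrow> bool" where
  "is_point C Y p s \<longleftrightarrow> p \<in> Arr C \<and> Cod C p = Y \<and> s \<in> hom C Y (Dom C p) \<and> p \<cdot>\<^bsub>C\<^esub> s = Id C Y"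

definition protomodular :: "('o, 'm) category \<Rightarrow> bool" where
  "protomodular C \<longleftrightarrow>
     (\<forall>v\<in>Arr C. \<forall>p s p' s' h a b a' b' k.
        is_point C (Cod C v) p s \<and> is_point C (Cod C v) p' s' \<and>
        h \<in> hom C (Dom C p) (Dom C p') \<and> p' \<cdot>\<^bsub>C\<^esub> h = p \<and> h \<cdot>\<^bsub>C\<^esub> s = s' \<and>
        is_pullback C p v a b \<and> is_pullback C p' v a' b' \<and>
        k \<in> hom C (Dom C a) (Dom C a') \<and> a' \<cdot>\<^bsub>C\<^esub> k = h \<cdot>\<^bsub>C\<^esub> a \<and> b' \<cdot>\<^bsub>C\<^esub> k = b \<and>
        iso C k \<longrightarrow> iso C h)"

definition has_binary_coproducts :: "('o, 'm) category \<Rightarrow> bool" where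
  "has_binary_coproducts C \<longleftrightarrow> (\<forall>X\<in>Obj C. \<forall>Y\<in>Obj C. \<exists>S i j. is_coproduct C X Y S i j)"

definition semi_abelian :: "('o, 'm) category \<Rightarrow> bool" where
  "semi_abelian C \<longleftrightarrow> category C \<and> pointed C \<and> Barr_exact C \<and> protomodular C \<and>
     has_binary_coproducts C"

definition projective :: "('o, 'm) category \<Rightarrow> 'o \<Rightarrow> bool" where
  "projective C P \<longleftrightarrow> P \<in> Obj C \<and>
     (\<forall>f. regular_epi C f \<longrightarrow>
        (\<forall>g\<in>hom C P (Cod C f). \<exists>h\<in>hom C P (Dom C f). f \<cdot>\<^bsub>C\<^esub> h = g))"

definition enough_projectives :: "('o, 'm) category \<Rightarrow> bool" where
  "enough_projectives C \<longleftrightarrow>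
     (\<forall>A\<in>Obj C. \<exists>e. regular_epi C e \<and> Cod C e = A \<and> projective C (Dom C e))"


section \<open>Internal abelian groups\<close>

text \<open>The arrow \<open>\<langle>x, y\<rangle>\<close> into the product with projections \<open>p\<close>, \<open>q\<close>.\<close>

definition pairing :: "('o, 'm) category \<Rightarrow> 'm \<Rightarrow> 'm \<Rightarrow> 'm \<Rightarrow> 'm \<Rightarrow> 'm" where
  "pairing C p q x y = (THE h. h \<in> hom C (Dom C x) (Dom C p) \<and> p \<cdot>\<^bsub>C\<^esub> h = x \<and> q \<cdot>\<^bsub>C\<^esub> h = y)"

text \<open>Here \<open>(P, p, q)\<close> is \<open>A \<times> A\<close>, \<open>(Q, r, w)\<close> is \<open>(A \<times> A) \<times> A\<close>, \<open>t : A \<rightarrow> T\<close> is the arrow to a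
  terminal object, and \<open>m\<close>, \<open>e\<close>, \<open>i\<close> are multiplication, unit and inversion.\<close>

definition internal_abelian_group :: "('o, 'm) category \<Rightarrow> 'o \<Rightarrow> 'm \<Rightarrow> 'm \<Rightarrow> 'm \<Rightarrow> bool" where
  "internal_abelian_group C A m e i \<longleftrightarrow>
     (\<exists>P p q Q r w T t. is_product C A A P p q \<and> is_product C P A Q r w \<and>
        terminal C T \<and> t \<in> hom C A T \<and>
        m \<in> hom C P A \<and> e \<in> hom C T A \<and> i \<in> hom C A A \<and>
        m \<cdot>\<^bsub>C\<^esub> pairing C p q (m \<cdot>\<^bsub>C\<^esub> r) w =
          m \<cdot>\<^bsub>C\<^esub> pairing C p q (p \<cdot>\<^bsub>C\<^esub> r) (m \<cdot>\<^bsub>C\<^esub> pairing C p q (q \<cdot>\<^bsub>C\<^esub> r) w) \<and>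
        m \<cdot>\<^bsub>C\<^esub> pairing C p q (e \<cdot>\<^bsub>C\<^esub> t) (Id C A) = Id C A \<and>
        m \<cdot>\<^bsub>C\<^esub> pairing C p q (Id C A) (e \<cdot>\<^bsub>C\<^esub> t) = Id C A \<and>
        m \<cdot>\<^bsub>C\<^esub> pairing C p q i (Id C A) = e \<cdot>\<^bsub>C\<^esub> t \<and>
        m \<cdot>\<^bsub>C\<^esub> pairing C p q (Id C A) i = e \<cdot>\<^bsub>C\<^esub> t \<and>
        m \<cdot>\<^bsub>C\<^esub> pairing C p q q p = m)"

definition Ab :: "('o, 'm) category \<Rightarrow> 'o set" where
  "Ab C = {A \<in> Obj C. \<exists>m e i. internal_abelian_group C A m e i}"


section \<open>Birkhoff subcategories and central extensions\<close>

text \<open>Full subcategories are given by their sets of objects.  \<open>is_reflector C B I \<eta>\<close>: the functor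
  \<open>I\<close> is left adjoint to the inclusion of the full subcategory on \<open>B\<close>, with unit \<open>\<eta>\<close>.\<close>

definition is_reflector ::
    "('o, 'm) category \<Rightarrow> 'o set \<Rightarrow> ('o, 'm) endo_map \<Rightarrow> ('o \<Rightarrow> 'm) \<Rightarrow> bool" where
  "is_reflector C B I \<eta> \<longleftrightarrow>
     B \<subseteq> Obj C \<and> is_functor C (full_subcategory C B) I \<and>
     (\<forall>X\<in>Obj C. \<eta> X \<in> hom C X (obj_map I X)) \<and>
     (\<forall>f\<in>Arr C. \<eta> (Cod C f) \<cdot>\<^bsub>C\<^esub> f = arr_map I f \<cdot>\<^bsub>C\<^esub> \<eta> (Dom C f)) \<and>
     (\<forall>X\<in>Obj C. \<forall>Y\<in>B. \<forall>f\<in>hom C X Y. \<exists>!h. h \<in> hom C (obj_map I X) Y \<and> h \<cdot>\<^bsub>C\<^esub> \<eta> X = f)"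

definition Birkhoff_subcategory ::
    "('o, 'm) category \<Rightarrow> 'o set \<Rightarrow> ('o, 'm) endo_map \<Rightarrow> ('o \<Rightarrow> 'm) \<Rightarrow> bool" where
  "Birkhoff_subcategory C B I \<eta> \<longleftrightarrow> is_reflector C B I \<eta> \<and>
     (\<forall>f. mono C f \<and> Cod C f \<in> B \<longrightarrow> Dom C f \<in> B) \<and>
     (\<forall>f. regular_epi C f \<and> Dom C f \<in> B \<longrightarrow> Cod C f \<in> B)"

definition perfect :: "('o, 'm) category \<Rightarrow> ('o, 'm) endo_map \<Rightarrow> 'o \<Rightarrow> bool" where
  "perfect C I P \<longleftrightarrow> P \<in> Obj C \<and> zero_object C (obj_map I P)"

abbreviation extension :: "('o, 'm) category \<Rightarrow> 'm \<Rightarrow> bool" where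
  "extension \<equiv> regular_epi"

definition trivial_extension ::
    "('o, 'm) category \<Rightarrow> ('o, 'm) endo_map \<Rightarrow> ('o \<Rightarrow> 'm) \<Rightarrow> 'm \<Rightarrow> bool" where
  "trivial_extension C I \<eta> f \<longleftrightarrow> extension C f \<and>
     is_pullback C (\<eta> (Cod C f)) (arr_map I f) f (\<eta> (Dom C f))"

definition central_extension ::
    "('o, 'm) category \<Rightarrow> ('o, 'm) endo_map \<Rightarrow> ('o \<Rightarrow> 'm) \<Rightarrow> 'm \<Rightarrow> bool" where
  "central_extension C I \<eta> f \<longleftrightarrow> extension C f \<and>
     (\<exists>g p q. extension C g \<and> is_pullback C f g p q \<and> trivial_extension C I \<eta> q)"

definition projective_wrt_central ::
    "('o, 'm) category \<Rightarrow> ('o, 'm) endo_map \<Rightarrow> ('o \<Rightarrow> 'm) \<Rightarrow> 'o \<Rightarrow> bool" where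
  "projective_wrt_central C I \<eta> U \<longleftrightarrow> U \<in> Obj C \<and>
     (\<forall>f. central_extension C I \<eta> f \<longrightarrow>
        (\<forall>g\<in>hom C U (Cod C f). \<exists>h\<in>hom C U (Dom C f). f \<cdot>\<^bsub>C\<^esub> h = g))"

definition central_extensions_of ::
    "('o, 'm) category \<Rightarrow> ('o, 'm) endo_map \<Rightarrow> ('o \<Rightarrow> 'm) \<Rightarrow> 'o \<Rightarrow> ('m, 'm \<times> 'm \<times> 'm) category" where
  "central_extensions_of C I \<eta> A =
     full_subcategory (slice C A) {f. central_extension C I \<eta> f \<and> Cod C f = A}"

definition universal_central_extension ::
    "('o, 'm) category \<Rightarrow> ('o, 'm) endo_map \<Rightarrow> ('o \<Rightarrow> 'm) \<Rightarrow> 'm \<Rightarrow> bool" where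
  "universal_central_extension C I \<eta> u \<longleftrightarrow> initial (central_extensions_of C I \<eta> (Cod C u)) u"

definition weakly_universal_central_extension ::
    "('o, 'm) category \<Rightarrow> ('o, 'm) endo_map \<Rightarrow> ('o \<Rightarrow> 'm) \<Rightarrow> 'm \<Rightarrow> bool" where
  "weakly_universal_central_extension C I \<eta> u \<longleftrightarrow>
     weakly_initial (central_extensions_of C I \<eta> (Cod C u)) u"

definition five_conditions_equivalent ::
    "('o, 'm) category \<Rightarrow> ('o, 'm) endo_map \<Rightarrow> ('o \<Rightarrow> 'm) \<Rightarrow> bool" where
  "five_conditions_equivalent C I \<eta> \<longleftrightarrow>
     (\<forall>u U. central_extension C I \<eta> u \<and> Dom C u = U \<longrightarrow>
        (let
           c1 = perfect C I U \<and>
                (\<forall>f. central_extension C I \<eta> f \<and> Cod C f = U \<longrightarrow> split_epi C f);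
           c2 = perfect C I U \<and> projective_wrt_central C I \<eta> U;
           c3 = (\<forall>f. central_extension C I \<eta> f \<longrightarrow>
                   bij_betw (\<lambda>h. f \<cdot>\<^bsub>C\<^esub> h) (hom C U (Dom C f)) (hom C U (Cod C f)));
           c4 = perfect C I U \<and> weakly_universal_central_extension C I \<eta> u;
           c5 = universal_central_extension C I \<eta> u
         in (c1 \<longleftrightarrow> c2) \<and> (c2 \<longleftrightarrow> c3) \<and> (c3 \<longleftrightarrow> c4) \<and> (c4 \<longleftrightarrow> c5)))"

end

theory Submission
  imports Defs
begin

text \<open>
  Why the theorem holds.  Write \<open>f : B \<rightarrow> A\<close> and \<open>g : D \<rightarrow> B\<close> for the two central extensions, with
  \<open>B\<close> perfect.  In groups, \<open>f g\<close> is central because of the three subgroups lemma, which has no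
  counterpart in a general semi-abelian category.  What replaces it is a lifting: if
  \<open>b : U \<rightarrow> B\<close> is a regular epimorphism, \<open>f b\<close> is central and \<open>b\<close> lifts along \<open>g\<close> to some
  \<open>c : U \<rightarrow> D\<close>, then \<open>f g\<close> is central.

  The argument for this is short once centrality is described without commutators.  Call a
  generalized element \<open>x : Z \<rightarrow> X\<close> null if the unit \<open>\<eta>\<^sub>X\<close> annihilates it (for groups and abelianization: if
  it lies in \<open>[X, X]\<close>).  An extension \<open>f\<close> is central iff any two arrows that agree
  after composition with \<open>f\<close> already agree on null elements (lemma \<open>central_iff\<close>; for groups: iff
  \<open>[R, R]\<close> lies in the diagonal, where \<open>R\<close> is the kernel pair of \<open>f\<close>).  Now let \<open>x, y : W \<rightarrow> D\<close> agree over \<open>A\<close>, and let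
  \<open>w\<close> be null.  After a cover, \<open>g x = b x'\<close> and \<open>g y = b y'\<close>.  Then \<open>x' w = y' w\<close> since
  \<open>f b\<close> is central, while \<open>x w = c x' w\<close> and \<open>y w = c y' w\<close> since \<open>g\<close> is central
  (lemma \<open>identifies_null_comp\<close>).

  To produce \<open>b\<close> and \<open>c\<close>, every perfect object is given a weakly universal central extension with
  perfect domain (lemma \<open>perfect_weakly_universal_exists\<close>): a projective cover \<open>P \<rightarrow> A\<close> is divided
  by the congruence that makes it central, and the kernel of the unit is taken in the quotient.
  The equivalence of conditions (4) and (2) says that the domain \<open>U\<close> of such an extension \<open>u\<close> is projective with
  respect to all central extensions.  So \<open>u : U \<rightarrow> A\<close> lifts along \<open>f\<close> to \<open>b\<close>, and \<open>b\<close> lifts along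
  \<open>g\<close> to \<open>c\<close>.  That \<open>b\<close> is a regular epimorphism follows by comparison with such an extension
  \<open>w : W \<rightarrow> B\<close>: a lifting \<open>l : W \<rightarrow> U\<close> of \<open>f w\<close> along \<open>u\<close> satisfies \<open>b l = w\<close>, because liftings
  along \<open>f\<close> out of the perfect object \<open>W\<close> are unique.

  The tool behind both the description of centrality and the construction is that null elements
  lift, up to a cover, along regular epimorphisms (lemma \<open>null_lift\<close>).  It rests on exactness and on
  protomodularity, the latter through the principle that the kernel and the section of a
  split epimorphism generate its domain (lemma \<open>kernel_and_section_generate\<close>).

  For the second assertion, \<open>Ab(C)\<close> is shown to be closed under subobjects and regular quotients
  (lemma \<open>Ab_Birkhoff\<close>): an abelian group structure amounts to a unital multiplication, which
  restricts and descends.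

  Arguments about elements are carried out with generalized elements; an existence statement in
  regular logic becomes the existence of a regular epimorphism \<open>z : Z' \<rightarrow> Z\<close> (a cover) and of
  an element defined over \<open>Z'\<close>.
\<close>

locale semi_abelian_category =
  fixes C :: "('o, 'm) category" (structure)
  assumes semi_abelian: "semi_abelian C"

sublocale semi_abelian_category \<subseteq> category C
  using semi_abelian unfolding semi_abelian_def by blast

context semi_abelian_category
begin

section \<open>Composition\<close>

lemma Arr_comp: "\<lbrakk>f \<in> Arr C; g \<in> Arr C; Dom C g = Cod C f\<rbrakk> \<Longrightarrow> g \<cdot> f \<in> Arr C"
  and Dom_comp: "\<lbrakk>f \<in> Arr C; g \<in> Arr C; Dom C g = Cod C f\<rbrakk> \<Longrightarrow> Dom C (g \<cdot> f) = Dom C f"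
  and Cod_comp: "\<lbrakk>f \<in> Arr C; g \<in> Arr C; Dom C g = Cod C f\<rbrakk> \<Longrightarrow> Cod C (g \<cdot> f) = Cod C g"
  using Comp_hom[of f "Dom C f" "Cod C f" g "Cod C g"] by (auto simp: hom_def)

lemma comp_assoc: "\<lbrakk>f \<in> Arr C; g \<in> Arr C; h \<in> Arr C; Dom C g = Cod C f; Dom C h = Cod C g\<rbrakk>
    \<Longrightarrow> (h \<cdot> g) \<cdot> f = h \<cdot> (g \<cdot> f)"
  using Comp_assoc[of f "Dom C f" "Cod C f" g "Cod C g" h "Cod C h"] by (auto simp: hom_def)

lemma comp_Id: "\<lbrakk>f \<in> Arr C; Dom C f = X\<rbrakk> \<Longrightarrow> f \<cdot> Id C X = f"
  and Id_comp: "\<lbrakk>f \<in> Arr C; Cod C f = X\<rbrakk> \<Longrightarrow> Id C X \<cdot> f = f"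
  using Comp_Id[of f X "Cod C f"] Id_Comp[of f "Dom C f" X] by (auto simp: hom_def)

lemma Arr_Id: "X \<in> Obj C \<Longrightarrow> Id C X \<in> Arr C"
  and Dom_Id: "X \<in> Obj C \<Longrightarrow> Dom C (Id C X) = X"
  and Cod_Id: "X \<in> Obj C \<Longrightarrow> Cod C (Id C X) = X"
  using Id_hom[of X] by (auto simp: hom_def)

lemma hom_Dom_Obj: "f \<in> hom C X Y \<Longrightarrow> X \<in> Obj C"
  and hom_Cod_Obj: "f \<in> hom C X Y \<Longrightarrow> Y \<in> Obj C"
  using Dom_Obj Cod_Obj by (auto simp: hom_def)

lemmas cat = hom_def Arr_comp Dom_comp Cod_comp comp_assoc comp_Id Id_comp Arr_Id Dom_Id Cod_Id

lemma comp_eq: "\<lbrakk>f \<cdot> x = h; f \<in> hom C X Y; x \<in> hom C W X; w \<in> hom C Z W\<rbrakk> \<Longrightarrow> f \<cdot> (x \<cdot> w) = h \<cdot> w"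
  by (simp add: hom_def comp_assoc[symmetric])

lemma comp_Id_eq:
  "\<lbrakk>g \<cdot> f = Id C X; g \<in> hom C Y X; f \<in> hom C X Y; w \<in> hom C Z X\<rbrakk> \<Longrightarrow> g \<cdot> (f \<cdot> w) = w"
  by (metis comp_eq Id_Comp)

lemma mono_eq: "\<lbrakk>mono C m; m \<in> hom C X Y; a \<in> hom C Z X; b \<in> hom C Z X; m \<cdot> a = m \<cdot> b\<rbrakk> \<Longrightarrow> a = b"
  unfolding mono_def by (metis (mono_tags, lifting) hom_def mem_Collect_eq)

lemma mono_intro:
  assumes "m \<in> hom C X Y"
    and "\<And>Z a b. \<lbrakk>a \<in> hom C Z X; b \<in> hom C Z X; m \<cdot> a = m \<cdot> b\<rbrakk> \<Longrightarrow> a = b"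
  shows "mono C m"
  using assms unfolding mono_def by (simp add: hom_def)

lemma iso_intro:
  assumes "f \<in> hom C X Y" "g \<in> hom C Y X" "g \<cdot> f = Id C X" "f \<cdot> g = Id C Y"
  shows "iso C f"
  using assms unfolding iso_def by (auto simp: hom_def)

lemma iso_inverse:
  assumes "iso C f" "f \<in> hom C X Y"
  obtains g where "g \<in> hom C Y X" "g \<cdot> f = Id C X" "f \<cdot> g = Id C Y"
  using assms unfolding iso_def by (auto simp: hom_def)

section \<open>Zero arrows\<close>

lemma zero_object_exists: "\<exists>T. zero_object C T"
  using semi_abelian unfolding semi_abelian_def pointed_def by blast

text \<open>Any two factorizations through zero objects have the same composite, so the description below
  determines an arrow for every pair of objects.\<close>
definition zero :: "'o \<Rightarrow> 'o \<Rightarrow> 'm" where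
  "zero X Y = (THE h. \<exists>T a b. zero_object C T \<and> a \<in> hom C X T \<and> b \<in> hom C T Y \<and> h = b \<cdot> a)"

lemma through_zero_object_unique:
  assumes "zero_object C T" "a \<in> hom C X T" "b \<in> hom C T Y"
    and "zero_object C T'" "a' \<in> hom C X T'" "b' \<in> hom C T' Y"
  shows "b \<cdot> a = b' \<cdot> a'"
proof -
  have T: "T \<in> Obj C" "T' \<in> Obj C" "X \<in> Obj C" "Y \<in> Obj C"
    using assms hom_Dom_Obj hom_Cod_Obj by blast+
  obtain i where i: "i \<in> hom C T T'"
    using assms(1) T unfolding zero_object_def initial_def by blast
  have "i \<cdot> a = a'"
    using assms(4,5,2) T i unfolding zero_object_def terminal_def
    by (metis Comp_hom)
  moreover have "b' \<cdot> i = b"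
    using assms(1,3,6) T i unfolding zero_object_def initial_def
    by (metis Comp_hom)
  ultimately show ?thesis using Comp_assoc[OF assms(2) i assms(6)] by simp
qed

lemma zero_eq:
  assumes "zero_object C T" "a \<in> hom C X T" "b \<in> hom C T Y"
  shows "b \<cdot> a = zero X Y"
  unfolding zero_def
  by (rule the_equality[symmetric]) (use assms through_zero_object_unique in blast)+

lemma zero_factors:
  assumes "X \<in> Obj C" "Y \<in> Obj C"
  obtains T a b where "zero_object C T" "a \<in> hom C X T" "b \<in> hom C T Y" "zero X Y = b \<cdot> a"
proof -
  obtain T where T: "zero_object C T" using zero_object_exists by blast
  then obtain a b where "a \<in> hom C X T" "b \<in> hom C T Y"
    using assms unfolding zero_object_def initial_def terminal_def by blast
  with T that zero_eq show thesis by metis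
qed

lemma zero_hom: "\<lbrakk>X \<in> Obj C; Y \<in> Obj C\<rbrakk> \<Longrightarrow> zero X Y \<in> hom C X Y"
  by (metis zero_factors Comp_hom)

lemma comp_zero:
  assumes "f \<in> hom C Y Z" "X \<in> Obj C"
  shows "f \<cdot> zero X Y = zero X Z"
proof -
  obtain T a b where *: "zero_object C T" "a \<in> hom C X T" "b \<in> hom C T Y" "zero X Y = b \<cdot> a"
    using zero_factors assms hom_Dom_Obj by blast
  then show ?thesis using zero_eq[OF *(1,2) Comp_hom[OF *(3) assms(1)]] assms by (auto simp: cat)
qed

lemma zero_comp:
  assumes "f \<in> hom C X Y" "Z \<in> Obj C"
  shows "zero Y Z \<cdot> f = zero X Z"
proof -
  obtain T a b where *: "zero_object C T" "a \<in> hom C Y T" "b \<in> hom C T Z" "zero Y Z = b \<cdot> a"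
    using zero_factors assms hom_Cod_Obj by blast
  then show ?thesis using zero_eq[OF *(1) Comp_hom[OF assms(1) *(2)] *(3)] assms by (auto simp: cat)
qed

lemma into_zero_object:
  assumes "zero_object C T" "f \<in> hom C X T"
  shows "f = zero X T"
proof -
  have "X \<in> Obj C" "T \<in> Obj C" using assms hom_Dom_Obj hom_Cod_Obj by blast+
  then show ?thesis using assms zero_hom unfolding zero_object_def terminal_def by blast
qed

lemma zero_object_intro:
  assumes "X \<in> Obj C" "Id C X = zero X X"
  shows "zero_object C X"
  unfolding zero_object_def initial_def terminal_def
proof (intro conjI ballI)
  fix Y assume Y: "Y \<in> Obj C"
  show "\<exists>!f. f \<in> hom C X Y"
    by (rule ex1I[of _ "zero X Y"]) (use zero_hom Y assms comp_zero Comp_Id in metis)+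
  show "\<exists>!f. f \<in> hom C Y X"
    by (rule ex1I[of _ "zero Y X"]) (use zero_hom Y assms zero_comp Id_Comp in metis)+
qed (use assms in auto)

section \<open>Finite limits\<close>

lemma pullback_homs:
  assumes "is_pullback C f g p q"
  shows "f \<in> hom C (Dom C f) (Cod C g)" "g \<in> hom C (Dom C g) (Cod C g)"
    "p \<in> hom C (Dom C p) (Dom C f)" "q \<in> hom C (Dom C p) (Dom C g)" "f \<cdot> p = g \<cdot> q"
  using assms unfolding is_pullback_def by (auto simp: hom_def)

lemma pullback_lift:
  assumes "is_pullback C f g p q" "p \<in> hom C P X" "q \<in> hom C P Y"
    and "x \<in> hom C Z X" "y \<in> hom C Z Y" "f \<cdot> x = g \<cdot> y"
  obtains h where "h \<in> hom C Z P" "p \<cdot> h = x" "q \<cdot> h = y"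
proof -
  have "Dom C p = P" "Dom C f = X" "Dom C g = Y"
    using assms(1-3) by (simp_all add: is_pullback_def hom_def)
  with assms that show thesis unfolding is_pullback_def by blast
qed

lemma pullback_eq:
  assumes "is_pullback C f g p q" "p \<in> hom C P X"
    and "h \<in> hom C Z P" "k \<in> hom C Z P" "p \<cdot> h = p \<cdot> k" "q \<cdot> h = q \<cdot> k"
  shows "h = k"
proof -
  note pb = pullback_homs[OF assms(1)]
  have P: "Dom C p = P" using assms(2) by (simp add: hom_def)
  note assms = assms(1) assms(3-)[folded P]
  have "f \<cdot> (p \<cdot> h) = g \<cdot> (q \<cdot> h)"
    using comp_eq[OF pb(5,1,3) assms(2)] pb assms(2) by (auto simp: cat)
  moreover have "p \<cdot> h \<in> hom C Z (Dom C f)" "q \<cdot> h \<in> hom C Z (Dom C g)"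
    using pb assms(2) Comp_hom by blast+
  ultimately show ?thesis using assms unfolding is_pullback_def by metis
qed

lemma is_pullback_iff:
  assumes "f \<in> hom C X W" "g \<in> hom C Y W" "p \<in> hom C P X" "q \<in> hom C P Y"
  shows "is_pullback C f g p q \<longleftrightarrow> f \<cdot> p = g \<cdot> q \<and>
     (\<forall>Z. \<forall>x\<in>hom C Z X. \<forall>y\<in>hom C Z Y. f \<cdot> x = g \<cdot> y \<longrightarrow>
        (\<exists>!h. h \<in> hom C Z P \<and> p \<cdot> h = x \<and> q \<cdot> h = y))"
proof -
  have "f \<in> Arr C" "g \<in> Arr C" "p \<in> Arr C" "q \<in> Arr C" "Cod C f = W" "Cod C g = W"
    "Dom C p = P" "Dom C q = P" "Dom C f = X" "Dom C g = Y" "Cod C p = X" "Cod C q = Y"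
    using assms by (simp_all add: hom_def)
  then show ?thesis unfolding is_pullback_def by simp
qed

lemma is_coequalizer_iff:
  assumes "f \<in> hom C R X" "g \<in> hom C R X" "e \<in> hom C X Y"
  shows "is_coequalizer C f g e \<longleftrightarrow> e \<cdot> f = e \<cdot> g \<and>
     (\<forall>Z. \<forall>h\<in>hom C X Z. h \<cdot> f = h \<cdot> g \<longrightarrow> (\<exists>!k. k \<in> hom C Y Z \<and> k \<cdot> e = h))"
proof -
  have "f \<in> Arr C" "g \<in> Arr C" "e \<in> Arr C" "Cod C f = X" "Cod C g = X"
    "Dom C e = X" "Dom C f = R" "Dom C g = R" "Cod C e = Y"
    using assms by (simp_all add: hom_def)
  then show ?thesis unfolding is_coequalizer_def by simp
qed

lemma regular_epi_coequalizer:
  assumes "regular_epi C e" "e \<in> hom C X Y"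
  obtains R f g where "f \<in> hom C R X" "g \<in> hom C R X" "is_coequalizer C f g e"
proof -
  obtain f g where "is_coequalizer C f g e" using assms(1) unfolding regular_epi_def by blast
  moreover from this have "f \<in> hom C (Dom C f) X" "g \<in> hom C (Dom C f) X"
    using assms(2) unfolding is_coequalizer_def hom_def by simp_all
  ultimately show thesis using that by blast
qed

lemma finitely_complete: "finitely_complete C"
  using semi_abelian unfolding semi_abelian_def Barr_exact_def regular_category_def by blast

lemma pullback_exists:
  assumes "f \<in> hom C X W" "g \<in> hom C Y W"
  obtains P p q where "is_pullback C f g p q" "p \<in> hom C P X" "q \<in> hom C P Y" "f \<cdot> p = g \<cdot> q"
proof -
  have "f \<in> Arr C" "g \<in> Arr C" "Cod C f = Cod C g" using assms by (auto simp: hom_def)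
  then obtain p q where "is_pullback C f g p q"
    using finitely_complete unfolding finitely_complete_def by blast
  with that[OF this] pullback_homs[OF this] assms show thesis by (auto simp: hom_def)
qed

lemma product_exists:
  assumes "X \<in> Obj C" "Y \<in> Obj C"
  obtains P p q where "is_product C X Y P p q"
proof -
  obtain T where T: "zero_object C T" using zero_object_exists by blast
  then have "T \<in> Obj C" unfolding zero_object_def initial_def by blast
  then have z: "zero X T \<in> hom C X T" "zero Y T \<in> hom C Y T" using assms zero_hom by auto
  obtain P p q where pb: "is_pullback C (zero X T) (zero Y T) p q" "p \<in> hom C P X" "q \<in> hom C P Y"
    by (rule pullback_exists[OF z]) 
  have "is_product C X Y P p q"
    unfolding is_product_def
  proof (intro conjI allI ballI)
    fix Z x y assume xy: "x \<in> hom C Z X" "y \<in> hom C Z Y"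
    have "zero X T \<cdot> x = zero Y T \<cdot> y"
      using xy into_zero_object[OF T] z Comp_hom by metis
    then show "\<exists>!h. h \<in> hom C Z P \<and> p \<cdot> h = x \<and> q \<cdot> h = y"
      using pb(1) xy unfolding is_pullback_iff[OF z pb(2,3)] by blast
  qed fact+
  with that show thesis by blast
qed

lemma product_lift:
  assumes "is_product C X Y P p q" "x \<in> hom C Z X" "y \<in> hom C Z Y"
  obtains h where "h \<in> hom C Z P" "p \<cdot> h = x" "q \<cdot> h = y"
  using assms unfolding is_product_def by blast

lemma product_homs:
  assumes "is_product C X Y P p q"
  shows "p \<in> hom C P X" "q \<in> hom C P Y"
  using assms unfolding is_product_def by auto

lemma product_eq:
  assumes "is_product C X Y P p q" "h \<in> hom C Z P" "k \<in> hom C Z P"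
    and "p \<cdot> h = p \<cdot> k" "q \<cdot> h = q \<cdot> k"
  shows "h = k"
proof -
  have "p \<cdot> h \<in> hom C Z X" "q \<cdot> h \<in> hom C Z Y"
    using product_homs[OF assms(1)] assms(2) Comp_hom by blast+
  then show ?thesis using assms unfolding is_product_def by metis
qed

text \<open>The equalizer of \<open>a\<close> and \<open>b\<close> is the pullback of the graphs \<open>\<langle>1, a\<rangle>\<close> and \<open>\<langle>1, b\<rangle>\<close>.\<close>
lemma equalizer_exists:
  assumes "a \<in> hom C X W" "b \<in> hom C X W"
  obtains E m where "m \<in> hom C E X" "mono C m" "a \<cdot> m = b \<cdot> m"
    "\<And>Z x. \<lbrakk>x \<in> hom C Z X; a \<cdot> x = b \<cdot> x\<rbrakk> \<Longrightarrow> \<exists>y\<in>hom C Z E. m \<cdot> y = x"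
proof -
  have T: "X \<in> Obj C" "W \<in> Obj C" using assms hom_Dom_Obj hom_Cod_Obj by blast+
  obtain P p q where P: "is_product C X W P p q" using product_exists[OF T] .
  note pq = product_homs[OF P]
  obtain ga where ga: "ga \<in> hom C X P" "p \<cdot> ga = Id C X" "q \<cdot> ga = a"
    using product_lift[OF P Id_hom[OF T(1)] assms(1)] .
  obtain gb where gb: "gb \<in> hom C X P" "p \<cdot> gb = Id C X" "q \<cdot> gb = b"
    using product_lift[OF P Id_hom[OF T(1)] assms(2)] .
  obtain E m n where pb: "is_pullback C ga gb m n" "m \<in> hom C E X" "n \<in> hom C E X" "ga \<cdot> m = gb \<cdot> n"
    using pullback_exists[OF ga(1) gb(1)] .
  have mn: "m = n"
    using comp_Id_eq[OF ga(2) pq(1) ga(1) pb(2)] comp_Id_eq[OF gb(2) pq(1) gb(1) pb(3)]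
    unfolding pb(4) by (rule HOL.trans[OF sym])
  have amn: "a \<cdot> m = b \<cdot> m"
    using comp_eq[OF ga(3) pq(2) ga(1) pb(2)] comp_eq[OF gb(3) pq(2) gb(1) pb(3)]
    unfolding pb(4) unfolding mn by simp
  have "mono C m"
    by (rule mono_intro[OF pb(2)]) (use pullback_eq[OF pb(1,2)] mn in blast)
  moreover have "\<exists>y\<in>hom C Z E. m \<cdot> y = x" if x: "x \<in> hom C Z X" "a \<cdot> x = b \<cdot> x" for Z x
  proof -
    have "ga \<cdot> x = gb \<cdot> x"
      by (rule product_eq[OF P Comp_hom[OF x(1) ga(1)] Comp_hom[OF x(1) gb(1)]])
        (use comp_eq[OF ga(2) pq(1) ga(1) x(1)] comp_eq[OF gb(2) pq(1) gb(1) x(1)]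
           comp_eq[OF ga(3) pq(2) ga(1) x(1)] comp_eq[OF gb(3) pq(2) gb(1) x(1)] x in simp_all)
    then show ?thesis using pullback_lift[OF pb(1-3) x(1) x(1)] by blast
  qed
  ultimately show thesis using that pb(2) amn by blast
qed

section \<open>Regular epimorphisms\<close>

lemma regular_category: "regular_category C"
  using semi_abelian unfolding semi_abelian_def Barr_exact_def by blast

lemma regular_epi_hom: "regular_epi C e \<Longrightarrow> e \<in> hom C (Dom C e) (Cod C e)"
  unfolding regular_epi_def is_coequalizer_def by (auto simp: hom_def)

lemma regular_epi_factor:
  assumes "regular_epi C e" "e \<in> hom C X Y" "h \<in> hom C X Z"
    and "\<And>W s t. \<lbrakk>s \<in> hom C W X; t \<in> hom C W X; e \<cdot> s = e \<cdot> t\<rbrakk> \<Longrightarrow> h \<cdot> s = h \<cdot> t"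
  obtains k where "k \<in> hom C Y Z" "k \<cdot> e = h"
proof -
  obtain R f g where fg: "f \<in> hom C R X" "g \<in> hom C R X" "is_coequalizer C f g e"
    using regular_epi_coequalizer[OF assms(1,2)] .
  note coeq = fg(3)[unfolded is_coequalizer_iff[OF fg(1,2) assms(2)]]
  then have "h \<cdot> f = h \<cdot> g" using assms(4) fg(1,2) by blast
  with coeq assms(3) that show thesis by blast
qed

lemma regular_epi_epi:
  assumes "regular_epi C e" "e \<in> hom C X Y" "a \<in> hom C Y Z" "b \<in> hom C Y Z" "a \<cdot> e = b \<cdot> e"
  shows "a = b"
proof -
  obtain R f g where f: "f \<in> hom C R X" "g \<in> hom C R X" "is_coequalizer C f g e"
    using regular_epi_coequalizer[OF assms(1,2)] .
  note coeq = f(3)[unfolded is_coequalizer_iff[OF f(1,2) assms(2)]]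
  then have "(a \<cdot> e) \<cdot> f = (a \<cdot> e) \<cdot> g" using f assms(2,3) by (simp add: cat)
  moreover have "a \<cdot> e \<in> hom C X Z" using assms Comp_hom by blast
  ultimately have "\<exists>!k. k \<in> hom C Y Z \<and> k \<cdot> e = a \<cdot> e"
    using coeq by blast
  then show ?thesis using assms by metis
qed

lemma kernel_pair_coequalizer: "is_pullback C f f p q \<Longrightarrow> \<exists>e. is_coequalizer C p q e"
  and pullback_regular_epi: "\<lbrakk>is_pullback C f g p q; regular_epi C f\<rbrakk> \<Longrightarrow> regular_epi C q"
  using regular_category unfolding regular_category_def by (metis (no_types))+

text \<open>The form in which stability of regular epimorphisms is used: \<open>e\<close> is surjective on generalized
  elements up to a cover.\<close>
lemma cover_lift:
  assumes "regular_epi C e" "e \<in> hom C X Y" "y \<in> hom C Z Y"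
  obtains Z' z x where "regular_epi C z" "z \<in> hom C Z' Z" "x \<in> hom C Z' X" "e \<cdot> x = y \<cdot> z"
  using pullback_exists[OF assms(2,3)] pullback_regular_epi[OF _ assms(1)] by metis

text \<open>The first factor is the coequalizer of the kernel pair of \<open>h\<close>.  The second is monic because two
  elements of the image with equal values in \<open>Y\<close> lift, over a cover, to a pair in that kernel pair.\<close>
lemma image_factorization:
  assumes h: "h \<in> hom C X Y"
  obtains J e m where "regular_epi C e" "e \<in> hom C X J" "m \<in> hom C J Y" "mono C m" "m \<cdot> e = h"
proof -
  obtain R p q where pb: "is_pullback C h h p q" "p \<in> hom C R X" "q \<in> hom C R X" "h \<cdot> p = h \<cdot> q"
    using pullback_exists[OF h h] .
  then obtain e where coeq: "is_coequalizer C p q e"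
    using kernel_pair_coequalizer[OF pb(1)] by blast
  have "regular_epi C e" using coeq unfolding regular_epi_def by blast
  moreover have "Dom C e = X"
    using coeq pb(2) unfolding is_coequalizer_def hom_def by simp
  ultimately have e: "regular_epi C e" "e \<in> hom C X (Cod C e)"
    using regular_epi_hom by blast+
  have e': "e \<cdot> p = e \<cdot> q" using coeq unfolding is_coequalizer_def by blast
  obtain m where m: "m \<in> hom C (Cod C e) Y" "m \<cdot> e = h"
    using coeq pb(4) h unfolding is_coequalizer_iff[OF pb(2,3) e(2)] by blast
  have "mono C m"
  proof (rule mono_intro[OF m(1)])
    fix Z a b assume ab: "a \<in> hom C Z (Cod C e)" "b \<in> hom C Z (Cod C e)" "m \<cdot> a = m \<cdot> b"
    obtain Z1 z1 x where 1: "regular_epi C z1" "z1 \<in> hom C Z1 Z" "x \<in> hom C Z1 X" "e \<cdot> x = a \<cdot> z1"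
      using cover_lift[OF e(1,2) ab(1)] .
    obtain Z2 z2 y where 2: "regular_epi C z2" "z2 \<in> hom C Z2 Z1" "y \<in> hom C Z2 X" "e \<cdot> y = (b \<cdot> z1) \<cdot> z2"
      using cover_lift[OF e(1,2) Comp_hom[OF 1(2) ab(2)]] .
    have "h \<cdot> (x \<cdot> z2) = m \<cdot> (e \<cdot> (x \<cdot> z2))"
      using comp_eq[OF m(2,1) e(2) Comp_hom[OF 2(2) 1(3)]] by simp
    also have "e \<cdot> (x \<cdot> z2) = (a \<cdot> z1) \<cdot> z2"
      by (rule comp_eq[OF 1(4) e(2) 1(3) 2(2)])
    also have "m \<cdot> ((a \<cdot> z1) \<cdot> z2) = (m \<cdot> a) \<cdot> (z1 \<cdot> z2)"
      using m ab(1) 1(2) 2(2) by (simp add: cat)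
    also have "\<dots> = m \<cdot> (e \<cdot> y)" unfolding 2(4) ab(3) using m ab(2) 1(2) 2(2) by (simp add: cat)
    also have "\<dots> = h \<cdot> y" by (rule comp_eq[OF m(2,1) e(2) 2(3)])
    finally have "h \<cdot> (x \<cdot> z2) = h \<cdot> y" .
    then obtain n where n: "n \<in> hom C Z2 R" "p \<cdot> n = x \<cdot> z2" "q \<cdot> n = y"
      using pullback_lift[OF pb(1-3) Comp_hom[OF 2(2) 1(3)] 2(3)] by metis
    have "e \<cdot> (x \<cdot> z2) = (e \<cdot> q) \<cdot> n"
      using comp_eq[OF e' e(2) pb(2) n(1)] n(2) by simp
    also have "\<dots> = e \<cdot> y" using n e(2) pb(3) by (simp add: cat)
    finally have "e \<cdot> (x \<cdot> z2) = e \<cdot> y" .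
    then have "(a \<cdot> z1) \<cdot> z2 = (b \<cdot> z1) \<cdot> z2"
      using comp_eq[OF 1(4) e(2) 1(3) 2(2)] 2(4) by simp
    then have "a \<cdot> z1 = b \<cdot> z1"
      using regular_epi_epi[OF 2(1,2)] ab 1(2) Comp_hom by metis
    then show "a = b" using regular_epi_epi[OF 1(1,2)] ab by metis
  qed
  with that e m show thesis by blast
qed

lemma regular_epi_strong:
  assumes "regular_epi C e" "e \<in> hom C X Y" "k \<in> hom C X J" "m \<in> hom C J Y" "mono C m" "m \<cdot> k = e"
  shows "iso C m"
proof -
  obtain d where d: "d \<in> hom C Y J" "d \<cdot> e = k"
  proof (rule regular_epi_factor[OF assms(1-3)])
    fix W s t assume st: "s \<in> hom C W X" "t \<in> hom C W X" "e \<cdot> s = e \<cdot> t"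
    then have "m \<cdot> (k \<cdot> s) = m \<cdot> (k \<cdot> t)"
      using comp_eq[OF assms(6,4,3)] by simp
    then show "k \<cdot> s = k \<cdot> t" using mono_eq[OF assms(5,4)] Comp_hom st assms(3) by metis
  qed
  have T: "X \<in> Obj C" "Y \<in> Obj C" "J \<in> Obj C" using assms hom_Dom_Obj hom_Cod_Obj by metis+
  have md: "m \<cdot> d = Id C Y"
    by (rule regular_epi_epi[OF assms(1,2)]) (use assms d T in \<open>auto simp: cat\<close>)
  have "d \<cdot> m = Id C J"
    by (rule mono_eq[OF assms(5,4)]) (use assms d T comp_eq[OF md assms(4) d(1) assms(4)] in \<open>auto simp: cat\<close>)
  then show ?thesis using iso_intro assms(4) d(1) md by blast
qed

lemma regular_epi_iso_comp:
  assumes "regular_epi C e" "e \<in> hom C X Y" "i \<in> hom C Y Z" "iso C i"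
  shows "regular_epi C (i \<cdot> e)"
proof -
  obtain j where j: "j \<in> hom C Z Y" "j \<cdot> i = Id C Y" "i \<cdot> j = Id C Z"
    using iso_inverse assms(3,4) by blast
  obtain R f g where f: "f \<in> hom C R X" "g \<in> hom C R X" "is_coequalizer C f g e"
    using regular_epi_coequalizer[OF assms(1,2)] .
  note coeq = f(3)[unfolded is_coequalizer_iff[OF f(1,2) assms(2)]]
  have "is_coequalizer C f g (i \<cdot> e)"
    unfolding is_coequalizer_iff[OF f(1,2) Comp_hom[OF assms(2,3)]]
  proof (intro conjI allI ballI impI)
    show "(i \<cdot> e) \<cdot> f = (i \<cdot> e) \<cdot> g" using coeq f assms(2,3) by (simp add: cat)
    fix V h assume h: "h \<in> hom C X V" "h \<cdot> f = h \<cdot> g"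
    then obtain k where k: "k \<in> hom C Y V" "k \<cdot> e = h"
      using coeq by blast
    show "\<exists>!k. k \<in> hom C Z V \<and> k \<cdot> (i \<cdot> e) = h"
    proof (rule ex1I[of _ "k \<cdot> j"])
      show "k \<cdot> j \<in> hom C Z V \<and> (k \<cdot> j) \<cdot> (i \<cdot> e) = h"
        using k j comp_eq[OF j(2,1) assms(3,2)] assms by (simp add: cat)
      fix l assume l: "l \<in> hom C Z V \<and> l \<cdot> (i \<cdot> e) = h"
      have "l \<cdot> i = k"
        by (rule regular_epi_epi[OF assms(1,2)]) (use l k assms in \<open>auto simp: cat\<close>)
      then show "l = k \<cdot> j" using l j assms(3) by (auto simp: cat)
    qed
  qed
  then show ?thesis unfolding regular_epi_def by blast
qed

lemma regular_epi_comp: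
  assumes "regular_epi C f" "f \<in> hom C X Y" "regular_epi C g" "g \<in> hom C Y Z"
  shows "regular_epi C (g \<cdot> f)"
proof -
  obtain J e m where J: "regular_epi C e" "e \<in> hom C X J" "m \<in> hom C J Z" "mono C m" "m \<cdot> e = g \<cdot> f"
    using image_factorization[OF Comp_hom[OF assms(2,4)]] .
  obtain d where d: "d \<in> hom C Y J" "d \<cdot> f = e"
  proof (rule regular_epi_factor[OF assms(1,2) J(2)])
    fix W s t assume st: "s \<in> hom C W X" "t \<in> hom C W X" "f \<cdot> s = f \<cdot> t"
    then have "m \<cdot> (e \<cdot> s) = m \<cdot> (e \<cdot> t)"
      using comp_eq[OF J(5,3,2)] assms by (simp add: cat)
    then show "e \<cdot> s = e \<cdot> t" using mono_eq[OF J(4,3)] Comp_hom st J(2) by metis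
  qed
  have "m \<cdot> d = g"
    by (rule regular_epi_epi[OF assms(1,2) Comp_hom[OF d(1) J(3)] assms(4)])
      (use Comp_assoc[OF assms(2) d(1) J(3)] d(2) J(5) in simp)
  then have "iso C m" using regular_epi_strong[OF assms(3,4) d(1) J(3,4)] by blast
  from regular_epi_iso_comp[OF J(1-3) this] show ?thesis unfolding J(5) .
qed

lemma cover_lift_pair:
  assumes e: "regular_epi C e" "e \<in> hom C X Y" and a: "a \<in> hom C Z Y" and b: "b \<in> hom C Z Y"
  obtains Z' z x y where "regular_epi C z" "z \<in> hom C Z' Z" "x \<in> hom C Z' X" "y \<in> hom C Z' X"
    "e \<cdot> x = a \<cdot> z" "e \<cdot> y = b \<cdot> z"
proof -
  obtain Z1 z1 x where 1: "regular_epi C z1" "z1 \<in> hom C Z1 Z" "x \<in> hom C Z1 X" "e \<cdot> x = a \<cdot> z1"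
    using cover_lift[OF e a] .
  obtain Z2 z2 y where 2: "regular_epi C z2" "z2 \<in> hom C Z2 Z1" "y \<in> hom C Z2 X" "e \<cdot> y = (b \<cdot> z1) \<cdot> z2"
    using cover_lift[OF e Comp_hom[OF 1(2) b]] .
  show thesis
  proof (rule that[OF regular_epi_comp[OF 2(1,2) 1(1,2)] Comp_hom[OF 2(2) 1(2)] Comp_hom[OF 2(2) 1(3)] 2(3)])
    show "e \<cdot> (x \<cdot> z2) = a \<cdot> (z1 \<cdot> z2)"
      using comp_eq[OF 1(4) e(2) 1(3) 2(2)] Comp_assoc[OF 2(2) 1(2) a] by simp
    show "e \<cdot> y = b \<cdot> (z1 \<cdot> z2)" using 2(4) Comp_assoc[OF 2(2) 1(2) b] by simp
  qed
qed

lemma regular_epi_cancel: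
  assumes "regular_epi C (h \<cdot> k)" "k \<in> hom C X Y" "h \<in> hom C Y Z"
  shows "regular_epi C h"
proof -
  obtain J e m where J: "regular_epi C e" "e \<in> hom C Y J" "m \<in> hom C J Z" "mono C m" "m \<cdot> e = h"
    using image_factorization[OF assms(3)] .
  have "iso C m"
    by (rule regular_epi_strong[OF assms(1) Comp_hom[OF assms(2,3)] Comp_hom[OF assms(2) J(2)] J(3,4)])
      (use comp_eq[OF J(5,3,2) assms(2)] in simp)
  from regular_epi_iso_comp[OF J(1-3) this] show ?thesis unfolding J(5) .
qed

lemma regular_epi_split:
  assumes "f \<in> hom C X Y" "s \<in> hom C Y X" "f \<cdot> s = Id C Y"
  shows "regular_epi C f"
proof -
  have Y: "Y \<in> Obj C" using assms hom_Cod_Obj by blast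
  note I = Id_hom[OF Y]
  have "is_coequalizer C (Id C Y) (Id C Y) (Id C Y)"
    unfolding is_coequalizer_iff[OF I I I] using Comp_Id I by (metis (no_types))
  then have "regular_epi C (f \<cdot> s)" unfolding assms(3) regular_epi_def by blast
  then show ?thesis using regular_epi_cancel assms by blast
qed

section \<open>Consequences of protomodularity\<close>

text \<open>Protomodularity for the change of base along \<open>0 \<rightarrow> Y\<close>, in terms of elements: a morphism of points
  that is bijective on elements of the kernels is invertible.\<close>
lemma split_short_five:
  assumes p: "p \<in> hom C X Y" "s \<in> hom C Y X" "p \<cdot> s = Id C Y"
    and p': "p' \<in> hom C X' Y" "s' \<in> hom C Y X'" "p' \<cdot> s' = Id C Y"
    and h: "h \<in> hom C X X'" "p' \<cdot> h = p" "h \<cdot> s = s'"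
    and kernels: "\<And>Z x'. \<lbrakk>x' \<in> hom C Z X'; p' \<cdot> x' = zero Z Y\<rbrakk>
      \<Longrightarrow> \<exists>!x. x \<in> hom C Z X \<and> p \<cdot> x = zero Z Y \<and> h \<cdot> x = x'"
  shows "iso C h"
proof -
  obtain T where T: "zero_object C T" using zero_object_exists by blast
  then have "T \<in> Obj C" unfolding zero_object_def initial_def by blast
  then have v: "zero T Y \<in> hom C T Y" using zero_hom p hom_Cod_Obj by blast
  have Y: "Y \<in> Obj C" using p hom_Cod_Obj by blast
  obtain K a b where K: "is_pullback C p (zero T Y) a b" "a \<in> hom C K X" "b \<in> hom C K T"
    "p \<cdot> a = zero T Y \<cdot> b"
    using pullback_exists[OF p(1) v] .
  obtain K' a' b' where K': "is_pullback C p' (zero T Y) a' b'" "a' \<in> hom C K' X'" "b' \<in> hom C K' T"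
    "p' \<cdot> a' = zero T Y \<cdot> b'"
    using pullback_exists[OF p'(1) v] .
  have pa: "p \<cdot> a = zero K Y" using K(4) zero_comp[OF K(3) Y] by simp
  have pa': "p' \<cdot> a' = zero K' Y" using K'(4) zero_comp[OF K'(3) Y] by simp
  have "p' \<cdot> (h \<cdot> a) = zero T Y \<cdot> b" using comp_eq[OF h(2) p'(1) h(1) K(2)] K(4) by simp
  then obtain k where k: "k \<in> hom C K K'" "a' \<cdot> k = h \<cdot> a" "b' \<cdot> k = b"
    using pullback_lift[OF K'(1-3) Comp_hom[OF K(2) h(1)] K(3)] by blast
  obtain x where x: "x \<in> hom C K' X" "p \<cdot> x = zero K' Y" "h \<cdot> x = a'"
    using kernels[OF K'(2) pa'] by blast
  have "p \<cdot> x = zero T Y \<cdot> b'" using x(2) zero_comp[OF K'(3) Y] by simp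
  then obtain l where l: "l \<in> hom C K' K" "a \<cdot> l = x" "b \<cdot> l = b'"
    using pullback_lift[OF K(1-3) x(1) K'(3)] by blast
  have KO: "K \<in> Obj C" "K' \<in> Obj C" using k hom_Dom_Obj hom_Cod_Obj by blast+
  note I = Id_hom[OF KO(1)] Id_hom[OF KO(2)]
  have "k \<cdot> l = Id C K'"
  proof (rule pullback_eq[OF K'(1,2) Comp_hom[OF l(1) k(1)] I(2)])
    have "a' \<cdot> (k \<cdot> l) = h \<cdot> (a \<cdot> l)"
      using comp_eq[OF k(2) K'(2) k(1) l(1)] Comp_assoc[OF l(1) K(2) h(1)] by simp
    then show "a' \<cdot> (k \<cdot> l) = a' \<cdot> Id C K'" using l(2) x(3) Comp_Id[OF K'(2)] by simp
    show "b' \<cdot> (k \<cdot> l) = b' \<cdot> Id C K'"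
      using comp_eq[OF k(3) K'(3) k(1) l(1)] l(3) Comp_Id[OF K'(3)] by simp
  qed
  moreover have "l \<cdot> k = Id C K"
  proof (rule pullback_eq[OF K(1,2) Comp_hom[OF k(1) l(1)] I(1)])
    have xk: "x \<cdot> k \<in> hom C K X" using Comp_hom[OF k(1) x(1)] .
    have "p \<cdot> (x \<cdot> k) = zero K Y" using comp_eq[OF x(2) p(1) x(1) k(1)] zero_comp[OF k(1) Y] by simp
    moreover have "h \<cdot> (x \<cdot> k) = h \<cdot> a" using comp_eq[OF x(3) h(1) x(1) k(1)] k(2) by simp
    moreover have "\<exists>!y. y \<in> hom C K X \<and> p \<cdot> y = zero K Y \<and> h \<cdot> y = h \<cdot> a"
      by (rule kernels[OF Comp_hom[OF K(2) h(1)]])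
        (use comp_eq[OF h(2) p'(1) h(1) K(2)] pa in simp)
    ultimately have "x \<cdot> k = a" using xk K(2) pa by blast
    then show "a \<cdot> (l \<cdot> k) = a \<cdot> Id C K"
      using comp_eq[OF l(2) K(2) l(1) k(1)] Comp_Id[OF K(2)] by simp
    show "b \<cdot> (l \<cdot> k) = b \<cdot> Id C K"
      using comp_eq[OF l(3) K(3) l(1) k(1)] k(3) Comp_Id[OF K(3)] by simp
  qed
  ultimately have "iso C k" using iso_intro[OF k(1) l(1)] by blast
  moreover have "zero T Y \<in> Arr C" "Cod C (zero T Y) = Y" using v by (simp_all add: hom_def)
  moreover have "is_point C Y p s" "is_point C Y p' s'"
    using p p' by (simp_all add: is_point_def hom_def)
  moreover have "h \<in> hom C (Dom C p) (Dom C p')" "k \<in> hom C (Dom C a) (Dom C a')"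
    using h(1) p(1) p'(1) K(2) K'(2) k(1) by (simp_all add: hom_def)
  moreover have pm: "protomodular C" using semi_abelian unfolding semi_abelian_def by blast
  ultimately show ?thesis
    using pm[unfolded protomodular_def, rule_format, of "zero T Y" p s p' s' h a b a' b' k]
      h(2,3) K(1) K'(1) k(2,3) by simp
qed

text \<open>For groups: \<open>X\<close> is generated by the kernel of \<open>p\<close> and the image of \<open>s\<close>, since
  \<open>x = (x - s p x) + s p x\<close>.  This replaces element-wise subtraction below: a property
  defining a subobject holds on all of \<open>X\<close> as soon as it holds on the kernel and on the section.\<close>
lemma kernel_and_section_generate:
  assumes p: "p \<in> hom C X Y" "s \<in> hom C Y X" "p \<cdot> s = Id C Y"
    and m: "m \<in> hom C E X" "mono C m"
    and s: "t \<in> hom C Y E" "m \<cdot> t = s"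
    and kernel: "\<And>Z x. \<lbrakk>x \<in> hom C Z X; p \<cdot> x = zero Z Y\<rbrakk> \<Longrightarrow> \<exists>y\<in>hom C Z E. m \<cdot> y = x"
  shows "iso C m"
proof (rule split_short_five[OF Comp_hom[OF m(1) p(1)] s(1) _ p m(1) refl s(2)])
  show "(p \<cdot> m) \<cdot> t = Id C Y" using Comp_assoc[OF s(1) m(1) p(1)] s(2) p(3) by simp
  fix Z x assume x: "x \<in> hom C Z X" "p \<cdot> x = zero Z Y"
  then obtain y where y: "y \<in> hom C Z E" "m \<cdot> y = x" using kernel by blast
  show "\<exists>!y. y \<in> hom C Z E \<and> (p \<cdot> m) \<cdot> y = zero Z Y \<and> m \<cdot> y = x"
  proof (rule ex1I[of _ y])
    show "y \<in> hom C Z E \<and> (p \<cdot> m) \<cdot> y = zero Z Y \<and> m \<cdot> y = x"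
      using y Comp_assoc[OF y(1) m(1) p(1)] x by simp
    show "y' = y" if "y' \<in> hom C Z E \<and> (p \<cdot> m) \<cdot> y' = zero Z Y \<and> m \<cdot> y' = x" for y'
      using that y mono_eq[OF m(2,1)] by metis
  qed
qed

lemma iso_surjective:
  assumes "iso C m" "m \<in> hom C E X" "x \<in> hom C Z X"
  obtains y where "y \<in> hom C Z E" "m \<cdot> y = x"
proof -
  obtain g where g: "g \<in> hom C X E" "m \<cdot> g = Id C X" using iso_inverse[OF assms(1,2)] by metis
  show thesis using that[OF Comp_hom[OF assms(3) g(1)]] comp_Id_eq[OF g(2) assms(2) g(1) assms(3)] .
qed

text \<open>The equalizer of \<open>a\<close> and \<open>b\<close> contains the kernel and the section, hence is everything.\<close>
lemma kernel_and_section_jointly_epic: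
  assumes p: "p \<in> hom C X Y" "s \<in> hom C Y X" "p \<cdot> s = Id C Y"
    and ab: "a \<in> hom C X W" "b \<in> hom C X W" "a \<cdot> s = b \<cdot> s"
    and kernel: "\<And>Z x. \<lbrakk>x \<in> hom C Z X; p \<cdot> x = zero Z Y\<rbrakk> \<Longrightarrow> a \<cdot> x = b \<cdot> x"
  shows "a = b"
proof -
  obtain E m where E: "m \<in> hom C E X" "mono C m" "a \<cdot> m = b \<cdot> m"
    "\<And>Z x. \<lbrakk>x \<in> hom C Z X; a \<cdot> x = b \<cdot> x\<rbrakk> \<Longrightarrow> \<exists>y\<in>hom C Z E. m \<cdot> y = x"
    using equalizer_exists[OF ab(1,2)] by (metis (no_types))
  obtain t where t: "t \<in> hom C Y E" "m \<cdot> t = s" using E(4)[OF p(2) ab(3)] by blast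
  have "iso C m"
    by (rule kernel_and_section_generate[OF p E(1,2) t]) (use E(4) kernel in blast)
  moreover have X: "X \<in> Obj C" using p hom_Dom_Obj by blast
  ultimately obtain y where y: "y \<in> hom C X E" "m \<cdot> y = Id C X"
    using iso_surjective[OF _ E(1) Id_hom[OF X]] by blast
  have "a \<cdot> (m \<cdot> y) = b \<cdot> (m \<cdot> y)"
    using comp_eq[OF E(3) ab(1) E(1) y(1)] Comp_assoc[OF y(1) E(1) ab(2)] by simp
  then show ?thesis using y(2) Comp_Id ab by simp
qed

text \<open>In place of the computation \<open>a (x - y) = 0\<close>: the two projections of the kernel pair of \<open>h\<close>,
  which is a point over \<open>X\<close> split by the diagonal, are compared on the diagonal and on the kernel, whose
  elements are the pairs \<open>(0, n)\<close> with \<open>h n = 0\<close>.\<close>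
lemma kernel_le_imp_kernel_pair_le:
  assumes h: "h \<in> hom C X V" and a: "a \<in> hom C X W" and W: "W \<in> Obj C"
    and kernel: "\<And>Z x. \<lbrakk>x \<in> hom C Z X; h \<cdot> x = zero Z V\<rbrakk> \<Longrightarrow> a \<cdot> x = zero Z W"
    and xy: "x \<in> hom C Z X" "y \<in> hom C Z X" "h \<cdot> x = h \<cdot> y"
  shows "a \<cdot> x = a \<cdot> y"
proof -
  obtain N p q where N: "is_pullback C h h p q" "p \<in> hom C N X" "q \<in> hom C N X" "h \<cdot> p = h \<cdot> q"
    using pullback_exists[OF h h] .
  have X: "X \<in> Obj C" "V \<in> Obj C" using h hom_Dom_Obj hom_Cod_Obj by blast+
  obtain d where d: "d \<in> hom C X N" "p \<cdot> d = Id C X" "q \<cdot> d = Id C X"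
    using pullback_lift[OF N(1-3) Id_hom[OF X(1)] Id_hom[OF X(1)] refl] .
  have "a \<cdot> p = a \<cdot> q"
  proof (rule kernel_and_section_jointly_epic[OF N(2) d(1,2) Comp_hom[OF N(2) a] Comp_hom[OF N(3) a]])
    show "(a \<cdot> p) \<cdot> d = (a \<cdot> q) \<cdot> d"
      using Comp_assoc[OF d(1) N(2) a] Comp_assoc[OF d(1) N(3) a] d by simp
    fix Z n assume n: "n \<in> hom C Z N" "p \<cdot> n = zero Z X"
    have Z: "Z \<in> Obj C" using n hom_Dom_Obj by blast
    have "h \<cdot> (q \<cdot> n) = h \<cdot> (p \<cdot> n)"
      using comp_eq[OF N(4) h N(2) n(1)] Comp_assoc[OF n(1) N(3) h] by simp
    also have "\<dots> = zero Z V" using n(2) comp_zero[OF h Z] by simp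
    finally have "a \<cdot> (q \<cdot> n) = zero Z W" using kernel[OF Comp_hom[OF n(1) N(3)]] by blast
    moreover have "a \<cdot> (p \<cdot> n) = zero Z W" using n(2) comp_zero[OF a Z] by simp
    ultimately show "(a \<cdot> p) \<cdot> n = (a \<cdot> q) \<cdot> n"
      using Comp_assoc[OF n(1) N(2) a] Comp_assoc[OF n(1) N(3) a] by simp
  qed
  moreover obtain n where n: "n \<in> hom C Z N" "p \<cdot> n = x" "q \<cdot> n = y"
    using pullback_lift[OF N(1-3) xy] .
  ultimately show ?thesis
    using comp_eq[OF \<open>a \<cdot> p = a \<cdot> q\<close> a N(2) n(1)] Comp_assoc[OF n(1) N(3) a] by simp
qed

text \<open>Protomodular categories are Mal'tsev: for a relation \<open>V\<close>, the memberships \<open>(a, x), (b, x), (b, y) \<in> V\<close>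
  imply \<open>(a, y) \<in> V\<close>.  The conclusion defines a subobject of the object of
  all such triples of memberships.  Regard that object as a point over the object of the
  first two, split by repeating the second.  On the section the conclusion is the first
  membership, and on the kernel it is the third.\<close>
lemma mono_relation_difunctional:
  assumes P: "is_product C Y W P y w" and m: "m \<in> hom C V P" "mono C m"
    and v: "v1 = y \<cdot> m" "v2 = w \<cdot> m"
    and abc: "a \<in> hom C Z V" "b \<in> hom C Z V" "c \<in> hom C Z V" "v2 \<cdot> a = v2 \<cdot> b" "v1 \<cdot> b = v1 \<cdot> c"
  obtains e where "e \<in> hom C Z V" "v1 \<cdot> e = v1 \<cdot> a" "v2 \<cdot> e = v2 \<cdot> c"
proof -
  note Pyw = product_homs[OF P]
  have v12: "v1 \<in> hom C V Y" "v2 \<in> hom C V W"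
    using v Comp_hom[OF m(1) Pyw(1)] Comp_hom[OF m(1) Pyw(2)] by auto
  have vm: "v1 \<cdot> x = y \<cdot> (m \<cdot> x)" "v2 \<cdot> x = w \<cdot> (m \<cdot> x)" if "x \<in> hom C Z V" for x Z
    using v Comp_assoc[OF that m(1) Pyw(1)] Comp_assoc[OF that m(1) Pyw(2)] by auto
  obtain S s t where S: "is_pullback C v2 v2 s t" "s \<in> hom C S V" "t \<in> hom C S V" "v2 \<cdot> s = v2 \<cdot> t"
    using pullback_exists[OF v12(2,2)] .
  have v1t: "v1 \<cdot> t \<in> hom C S Y" using Comp_hom[OF S(3) v12(1)] .
  obtain T u r where T: "is_pullback C (v1 \<cdot> t) v1 u r" "u \<in> hom C T S" "r \<in> hom C T V"
    "(v1 \<cdot> t) \<cdot> u = v1 \<cdot> r"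
    using pullback_exists[OF v1t v12(1)] .
  have SO: "S \<in> Obj C" "Y \<in> Obj C" "W \<in> Obj C" "T \<in> Obj C"
    using S(2) T(2) v12 hom_Dom_Obj hom_Cod_Obj by blast+
  \<comment> \<open>Triples \<open>(a, b, c)\<close> are a point over pairs \<open>(a, b)\<close>, split by \<open>c = b\<close>.\<close>
  obtain d where d: "d \<in> hom C S T" "u \<cdot> d = Id C S" "r \<cdot> d = t"
    using pullback_lift[OF T(1-3) Id_hom[OF SO(1)] S(3)] Comp_Id[OF v1t] by metis
  have us: "s \<cdot> u \<in> hom C T V" using Comp_hom[OF T(2) S(2)] .
  obtain g where g: "g \<in> hom C T P" "y \<cdot> g = v1 \<cdot> (s \<cdot> u)" "w \<cdot> g = v2 \<cdot> r"
    using product_lift[OF P Comp_hom[OF us v12(1)] Comp_hom[OF T(3) v12(2)]] .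
  obtain E n f where E: "is_pullback C g m n f" "n \<in> hom C E T" "f \<in> hom C E V" "g \<cdot> n = m \<cdot> f"
    using pullback_exists[OF g(1) m(1)] .
  have n: "mono C n"
  proof (rule mono_intro[OF E(2)])
    fix Q i j assume ij: "i \<in> hom C Q E" "j \<in> hom C Q E" "n \<cdot> i = n \<cdot> j"
    have "m \<cdot> (f \<cdot> i) = m \<cdot> (f \<cdot> j)"
      using comp_eq[OF E(4) g(1) E(2) ij(1)] comp_eq[OF E(4) g(1) E(2) ij(2)] ij(3)
        Comp_assoc[OF ij(1) E(3) m(1)] Comp_assoc[OF ij(2) E(3) m(1)] by simp
    then have "f \<cdot> i = f \<cdot> j"
      using mono_eq[OF m(2,1) Comp_hom[OF ij(1) E(3)] Comp_hom[OF ij(2) E(3)]] by blast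
    with pullback_eq[OF E(1,2) ij] show "i = j" by blast
  qed
  \<comment> \<open>\<open>E\<close> is the subobject of those triples whose conclusion is witnessed by an element of \<open>V\<close>.\<close>
  have into: "\<exists>e\<in>hom C Q E. n \<cdot> e = x"
    if x: "x \<in> hom C Q T" and z: "z \<in> hom C Q V"
      and eqs: "v1 \<cdot> z = v1 \<cdot> ((s \<cdot> u) \<cdot> x)" "v2 \<cdot> z = v2 \<cdot> (r \<cdot> x)" for Q x z
  proof -
    have "g \<cdot> x = m \<cdot> z"
    proof (rule product_eq[OF P Comp_hom[OF x g(1)] Comp_hom[OF z m(1)]])
      show "y \<cdot> (g \<cdot> x) = y \<cdot> (m \<cdot> z)"
        using comp_eq[OF g(2) Pyw(1) g(1) x] Comp_assoc[OF x us v12(1)] eqs(1) vm(1)[OF z] by simp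
      show "w \<cdot> (g \<cdot> x) = w \<cdot> (m \<cdot> z)"
        using comp_eq[OF g(3) Pyw(2) g(1) x] Comp_assoc[OF x T(3) v12(2)] eqs(2) vm(2)[OF z] by simp
    qed
    from pullback_lift[OF E(1-3) x z this] show ?thesis by blast
  qed
  have usd: "(s \<cdot> u) \<cdot> d = s"
    using Comp_assoc[OF d(1) T(2) S(2)] d(2) Comp_Id[OF S(2)] by simp
  obtain d' where d': "d' \<in> hom C S E" "n \<cdot> d' = d"
    using into[OF d(1) S(2)] usd d(3) S(4) by auto
  have "iso C n"
  proof (rule kernel_and_section_generate[OF T(2) d(1,2) E(2) n d'])
    fix Q x assume x: "x \<in> hom C Q T" "u \<cdot> x = zero Q S"
    have Q: "Q \<in> Obj C" using x hom_Dom_Obj by blast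
    have 1: "v1 \<cdot> ((s \<cdot> u) \<cdot> x) = zero Q Y"
      using Comp_assoc[OF x(1) T(2) S(2)] x(2) comp_zero[OF S(2) Q] comp_zero[OF v12(1) Q] by simp
    have "v1 \<cdot> (r \<cdot> x) = (v1 \<cdot> t) \<cdot> (u \<cdot> x)"
      using Comp_assoc[OF x(1) T(3) v12(1)] Comp_assoc[OF x(1) T(2) v1t] T(4) by simp
    also have "\<dots> = zero Q Y" using x(2) comp_zero[OF v1t Q] by simp
    finally show "\<exists>e\<in>hom C Q E. n \<cdot> e = x"
      using into[OF x(1) Comp_hom[OF x(1) T(3)]] 1 by simp
  qed
  obtain i where i: "i \<in> hom C Z S" "s \<cdot> i = a" "t \<cdot> i = b"
    using pullback_lift[OF S(1-3) abc(1,2,4)] .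
  have "(v1 \<cdot> t) \<cdot> i = v1 \<cdot> c" using Comp_assoc[OF i(1) S(3) v12(1)] i(3) abc(5) by simp
  then obtain j where j: "j \<in> hom C Z T" "u \<cdot> j = i" "r \<cdot> j = c"
    using pullback_lift[OF T(1-3) i(1) abc(3)] by blast
  obtain k where k: "k \<in> hom C Z E" "n \<cdot> k = j" using iso_surjective[OF \<open>iso C n\<close> E(2) j(1)] .
  have fk: "f \<cdot> k \<in> hom C Z V" using Comp_hom[OF k(1) E(3)] .
  have mfk: "m \<cdot> (f \<cdot> k) = g \<cdot> j"
    using comp_eq[OF E(4) g(1) E(2) k(1)] Comp_assoc[OF k(1) E(3) m(1)] k(2) by simp
  show thesis
  proof (rule that[OF fk])
    show "v1 \<cdot> (f \<cdot> k) = v1 \<cdot> a"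
      using vm(1)[OF fk] mfk comp_eq[OF g(2) Pyw(1) g(1) j(1)] Comp_assoc[OF j(1) us v12(1)]
        Comp_assoc[OF j(1) T(2) S(2)] j(2) i(2) by simp
    show "v2 \<cdot> (f \<cdot> k) = v2 \<cdot> c"
      using vm(2)[OF fk] mfk comp_eq[OF g(3) Pyw(2) g(1) j(1)] Comp_assoc[OF j(1) T(3) v12(2)]
        j(3) by simp
  qed
qed

lemma jointly_monic_pairing_mono:
  assumes P: "is_product C Y W P y w" and v: "v1 \<in> hom C V Y" "v2 \<in> hom C V W"
    and jm: "\<And>Z a b. \<lbrakk>a \<in> hom C Z V; b \<in> hom C Z V; v1 \<cdot> a = v1 \<cdot> b; v2 \<cdot> a = v2 \<cdot> b\<rbrakk> \<Longrightarrow> a = b"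
  obtains m where "m \<in> hom C V P" "mono C m" "y \<cdot> m = v1" "w \<cdot> m = v2"
proof -
  note Pyw = product_homs[OF P]
  obtain m where m: "m \<in> hom C V P" "y \<cdot> m = v1" "w \<cdot> m = v2" using product_lift[OF P v] .
  have "mono C m"
  proof (rule mono_intro[OF m(1)])
    fix Z a b assume ab: "a \<in> hom C Z V" "b \<in> hom C Z V" "m \<cdot> a = m \<cdot> b"
    then show "a = b"
      using jm[OF ab(1,2)] comp_eq[OF m(2) Pyw(1) m(1) ab(1)] comp_eq[OF m(2) Pyw(1) m(1) ab(2)]
        comp_eq[OF m(3) Pyw(2) m(1) ab(1)] comp_eq[OF m(3) Pyw(2) m(1) ab(2)] by simp
  qed
  with that m show thesis by blast
qed

text \<open>The version for an arbitrary span, whose image is a relation in the previous sense; the witness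
  then exists over a cover.\<close>
lemma span_difunctional:
  assumes a: "a \<in> hom C X Y" and b: "b \<in> hom C X W"
    and x: "x1 \<in> hom C Z X" "x2 \<in> hom C Z X" "x3 \<in> hom C Z X" "b \<cdot> x1 = b \<cdot> x2" "a \<cdot> x2 = a \<cdot> x3"
  obtains Z' z x where "regular_epi C z" "z \<in> hom C Z' Z" "x \<in> hom C Z' X"
    "a \<cdot> x = a \<cdot> (x1 \<cdot> z)" "b \<cdot> x = b \<cdot> (x3 \<cdot> z)"
proof -
  have O: "Y \<in> Obj C" "W \<in> Obj C" using a b hom_Cod_Obj by blast+
  obtain P y w where P: "is_product C Y W P y w" using product_exists[OF O] .
  note Pyw = product_homs[OF P]
  obtain h where h: "h \<in> hom C X P" "y \<cdot> h = a" "w \<cdot> h = b" using product_lift[OF P a b] .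
  obtain V e m where V: "regular_epi C e" "e \<in> hom C X V" "m \<in> hom C V P" "mono C m" "m \<cdot> e = h"
    using image_factorization[OF h(1)] .
  define v1 v2 where v: "v1 = y \<cdot> m" "v2 = w \<cdot> m"
  have v12: "v1 \<in> hom C V Y" "v2 \<in> hom C V W"
    using v Comp_hom[OF V(3) Pyw(1)] Comp_hom[OF V(3) Pyw(2)] by auto
  have va: "v1 \<cdot> e = a" "v2 \<cdot> e = b"
    using v Comp_assoc[OF V(2,3) Pyw(1)] Comp_assoc[OF V(2,3) Pyw(2)] V(5) h by auto
  note vax = comp_eq[OF va(1) v12(1) V(2)] comp_eq[OF va(2) v12(2) V(2)]
  obtain i where i: "i \<in> hom C Z V" "v1 \<cdot> i = v1 \<cdot> (e \<cdot> x1)" "v2 \<cdot> i = v2 \<cdot> (e \<cdot> x3)"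
  proof (rule mono_relation_difunctional[OF P V(3,4) v])
    show "e \<cdot> x1 \<in> hom C Z V" "e \<cdot> x2 \<in> hom C Z V" "e \<cdot> x3 \<in> hom C Z V"
      using x Comp_hom[OF _ V(2)] by blast+
    show "v2 \<cdot> (e \<cdot> x1) = v2 \<cdot> (e \<cdot> x2)" "v1 \<cdot> (e \<cdot> x2) = v1 \<cdot> (e \<cdot> x3)"
      using x by (simp_all add: vax)
  qed
  obtain Z' z k where z: "regular_epi C z" "z \<in> hom C Z' Z" "k \<in> hom C Z' X" "e \<cdot> k = i \<cdot> z"
    using cover_lift[OF V(1,2) i(1)] .
  show thesis
  proof (rule that[OF z(1-3)])
    have "a \<cdot> k = v1 \<cdot> (i \<cdot> z)" using vax(1)[OF z(3)] z(4) by simp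
    also have "\<dots> = (a \<cdot> x1) \<cdot> z"
      using comp_eq[OF i(2) v12(1) i(1) z(2)] vax(1)[OF x(1)] by simp
    finally show "a \<cdot> k = a \<cdot> (x1 \<cdot> z)" using Comp_assoc[OF z(2) x(1) a] by simp
    have "b \<cdot> k = v2 \<cdot> (i \<cdot> z)" using vax(2)[OF z(3)] z(4) by simp
    also have "\<dots> = (b \<cdot> x3) \<cdot> z"
      using comp_eq[OF i(3) v12(2) i(1) z(2)] vax(2)[OF x(3)] by simp
    finally show "b \<cdot> k = b \<cdot> (x3 \<cdot> z)" using Comp_assoc[OF z(2) x(3) b] by simp
  qed
qed

section \<open>Quotients by reflexive relations\<close>

lemma equivalence_relation_effective:
  assumes "internal_equivalence_relation C X R r1 r2"
  shows "\<exists>f. is_pullback C f f r1 r2"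
proof -
  have "Barr_exact C" using semi_abelian by (simp only: semi_abelian_def)
  then show ?thesis unfolding Barr_exact_def using assms by (elim conjE allE[of _ X] allE[of _ R]) blast
qed

text \<open>By difunctionality a reflexive relation is an equivalence relation: symmetry comes from
  \<open>(y, y), (x, y), (x, x)\<close> and transitivity from \<open>(x, y), (y, y), (y, z)\<close>.  Exactness then makes it
  the kernel pair of its coequalizer.\<close>
lemma reflexive_relation_quotient:
  assumes r: "r1 \<in> hom C R X" "r2 \<in> hom C R X"
    and jm: "\<And>Z a b. \<lbrakk>a \<in> hom C Z R; b \<in> hom C Z R; r1 \<cdot> a = r1 \<cdot> b; r2 \<cdot> a = r2 \<cdot> b\<rbrakk> \<Longrightarrow> a = b"
    and d: "d \<in> hom C X R" "r1 \<cdot> d = Id C X" "r2 \<cdot> d = Id C X"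
  obtains Q e where "regular_epi C e" "e \<in> hom C X Q" "e \<cdot> r1 = e \<cdot> r2"
    "\<And>Z x y. \<lbrakk>x \<in> hom C Z X; y \<in> hom C Z X; e \<cdot> x = e \<cdot> y\<rbrakk> \<Longrightarrow> \<exists>t\<in>hom C Z R. r1 \<cdot> t = x \<and> r2 \<cdot> t = y"
proof -
  have X: "X \<in> Obj C" using d hom_Dom_Obj by blast
  obtain P p q where P: "is_product C X X P p q" using product_exists[OF X X] .
  obtain m where m: "m \<in> hom C R P" "mono C m" "p \<cdot> m = r1" "q \<cdot> m = r2"
  proof (rule jointly_monic_pairing_mono[OF P r])
    show "a = b" if "a \<in> hom C Z R" "b \<in> hom C Z R" "r1 \<cdot> a = r1 \<cdot> b" "r2 \<cdot> a = r2 \<cdot> b" for Z a b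
      using jm[OF that] .
  qed
  note difunctional = mono_relation_difunctional[OF P m(1,2) m(3,4)[symmetric]]
  have dx: "r1 \<cdot> (d \<cdot> x) = x" "r2 \<cdot> (d \<cdot> x) = x" if "x \<in> hom C Z X" for x Z
    using comp_Id_eq[OF d(2) r(1) d(1) that] comp_Id_eq[OF d(3) r(2) d(1) that] by auto
  have RO: "R \<in> Obj C" using r hom_Dom_Obj by blast
  have "internal_equivalence_relation C X R r1 r2"
    unfolding internal_equivalence_relation_def
  proof (intro conjI allI impI)
    show "\<exists>d\<in>hom C X R. r1 \<cdot> d = Id C X \<and> r2 \<cdot> d = Id C X" using d by blast
    obtain s where s: "s \<in> hom C R R" "r1 \<cdot> s = r1 \<cdot> (d \<cdot> r2)" "r2 \<cdot> s = r2 \<cdot> (d \<cdot> r1)"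
      by (rule difunctional[OF Comp_hom[OF r(2) d(1)] Id_hom[OF RO] Comp_hom[OF r(1) d(1)]])
        (simp_all add: dx[OF r(1)] dx[OF r(2)] Comp_Id[OF r(1)] Comp_Id[OF r(2)])
    then show "\<exists>s\<in>hom C R R. r1 \<cdot> s = r2 \<and> r2 \<cdot> s = r1"
      using dx[OF r(1)] dx[OF r(2)] by auto
  next
    fix a b assume "is_pullback C r2 r1 a b"
    note pb = pullback_homs[OF this]
    have D: "Dom C r1 = R" "Dom C r2 = R" using r by (simp_all add: hom_def)
    have ab: "a \<in> hom C (Dom C a) R" "b \<in> hom C (Dom C a) R" using pb(3,4) D by simp_all
    have r2a: "r2 \<cdot> a \<in> hom C (Dom C a) X" using Comp_hom[OF ab(1) r(2)] .
    obtain t where t: "t \<in> hom C (Dom C a) R" "r1 \<cdot> t = r1 \<cdot> a" "r2 \<cdot> t = r2 \<cdot> b"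
    proof (rule difunctional[OF ab(1) Comp_hom[OF r2a d(1)] ab(2)])
      show "r2 \<cdot> a = r2 \<cdot> (d \<cdot> (r2 \<cdot> a))" "r1 \<cdot> (d \<cdot> (r2 \<cdot> a)) = r1 \<cdot> b"
        unfolding dx[OF r2a] by (rule refl, rule pb(5))
    qed
    then show "\<exists>t\<in>hom C (Dom C a) R. r1 \<cdot> t = r1 \<cdot> a \<and> r2 \<cdot> t = r2 \<cdot> b" by blast
  qed (use r jm in blast)+
  then obtain f where f: "is_pullback C f f r1 r2"
    using equivalence_relation_effective by blast
  obtain e where e: "is_coequalizer C r1 r2 e" using kernel_pair_coequalizer[OF f] by blast
  have re: "regular_epi C e" using e unfolding regular_epi_def by blast
  have "Dom C e = X" "e \<cdot> r1 = e \<cdot> r2" using e r unfolding is_coequalizer_def hom_def by simp_all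
  then have e2: "e \<in> hom C X (Cod C e)" using regular_epi_hom[OF re] by simp
  have "Dom C f = X" using f r(1) unfolding is_pullback_def hom_def by simp
  then have f1: "f \<in> hom C X (Cod C f)" using pullback_homs(1)[OF f] by simp
  obtain k where k: "k \<in> hom C (Cod C e) (Cod C f)" "k \<cdot> e = f"
    using e[unfolded is_coequalizer_iff[OF r e2], THEN conjunct2, rule_format, OF f1 pullback_homs(5)[OF f]]
    by blast
  show thesis
  proof (rule that[OF re e2 \<open>e \<cdot> r1 = e \<cdot> r2\<close>])
    fix Z x y assume xy: "x \<in> hom C Z X" "y \<in> hom C Z X" "e \<cdot> x = e \<cdot> y"
    then have "f \<cdot> x = f \<cdot> y"
      using comp_eq[OF k(2,1) e2 xy(1)] comp_eq[OF k(2,1) e2 xy(2)] by simp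
    from pullback_lift[OF f r xy(1,2) this] show "\<exists>t\<in>hom C Z R. r1 \<cdot> t = x \<and> r2 \<cdot> t = y" by blast
  qed
qed

text \<open>For a span that is not jointly monic the previous lemma is applied to its image.  Reflexivity is
  required over a cover \<open>z\<close> of \<open>X\<close>; since the image is a relation, it descends to \<open>X\<close>.\<close>
lemma reflexive_span_quotient:
  assumes r: "r1 \<in> hom C R X" "r2 \<in> hom C R X"
    and z: "regular_epi C z" "z \<in> hom C Z X" "d \<in> hom C Z R" "r1 \<cdot> d = z" "r2 \<cdot> d = z"
  obtains Q e where "regular_epi C e" "e \<in> hom C X Q" "e \<cdot> r1 = e \<cdot> r2"
    "\<And>Z x y. \<lbrakk>x \<in> hom C Z X; y \<in> hom C Z X; e \<cdot> x = e \<cdot> y\<rbrakk>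
      \<Longrightarrow> \<exists>Z' z t. regular_epi C z \<and> z \<in> hom C Z' Z \<and> t \<in> hom C Z' R \<and> r1 \<cdot> t = x \<cdot> z \<and> r2 \<cdot> t = y \<cdot> z"
proof -
  have X: "X \<in> Obj C" using z hom_Cod_Obj by blast
  obtain P p q where P: "is_product C X X P p q" using product_exists[OF X X] .
  note Ppq = product_homs[OF P]
  obtain h where h: "h \<in> hom C R P" "p \<cdot> h = r1" "q \<cdot> h = r2" using product_lift[OF P r] .
  obtain J c m where J: "regular_epi C c" "c \<in> hom C R J" "m \<in> hom C J P" "mono C m" "m \<cdot> c = h"
    using image_factorization[OF h(1)] .
  define s1 s2 where s: "s1 = p \<cdot> m" "s2 = q \<cdot> m"
  have s12: "s1 \<in> hom C J X" "s2 \<in> hom C J X"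
    using s Comp_hom[OF J(3) Ppq(1)] Comp_hom[OF J(3) Ppq(2)] by auto
  have sc: "s1 \<cdot> c = r1" "s2 \<cdot> c = r2"
    using s Comp_assoc[OF J(2,3) Ppq(1)] Comp_assoc[OF J(2,3) Ppq(2)] J(5) h by auto
  note scx = comp_eq[OF sc(1) s12(1) J(2)] comp_eq[OF sc(2) s12(2) J(2)]
  have jm: "a = b" if ab: "a \<in> hom C Z J" "b \<in> hom C Z J" "s1 \<cdot> a = s1 \<cdot> b" "s2 \<cdot> a = s2 \<cdot> b" for Z a b
  proof (rule mono_eq[OF J(4,3) ab(1,2)])
    show "m \<cdot> a = m \<cdot> b"
    proof (rule product_eq[OF P Comp_hom[OF ab(1) J(3)] Comp_hom[OF ab(2) J(3)]])
      show "p \<cdot> (m \<cdot> a) = p \<cdot> (m \<cdot> b)"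
        using ab(3) unfolding s Comp_assoc[OF ab(1) J(3) Ppq(1)] Comp_assoc[OF ab(2) J(3) Ppq(1)] .
      show "q \<cdot> (m \<cdot> a) = q \<cdot> (m \<cdot> b)"
        using ab(4) unfolding s Comp_assoc[OF ab(1) J(3) Ppq(2)] Comp_assoc[OF ab(2) J(3) Ppq(2)] .
    qed
  qed
  have cd: "c \<cdot> d \<in> hom C Z J" "s1 \<cdot> (c \<cdot> d) = z" "s2 \<cdot> (c \<cdot> d) = z"
    using Comp_hom[OF z(3) J(2)] scx[OF z(3)] z by auto
  obtain d' where d': "d' \<in> hom C X J" "d' \<cdot> z = c \<cdot> d"
  proof (rule regular_epi_factor[OF z(1,2) cd(1)])
    fix W u v assume uv: "u \<in> hom C W Z" "v \<in> hom C W Z" "z \<cdot> u = z \<cdot> v"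
    show "(c \<cdot> d) \<cdot> u = (c \<cdot> d) \<cdot> v"
      by (rule jm[OF Comp_hom[OF uv(1) cd(1)] Comp_hom[OF uv(2) cd(1)]])
        (use uv(3) comp_eq[OF cd(2) s12(1) cd(1)] comp_eq[OF cd(3) s12(2) cd(1)] uv in simp_all)
  qed
  have sd: "s1 \<cdot> d' = Id C X" "s2 \<cdot> d' = Id C X"
    by (rule regular_epi_epi[OF z(1,2) Comp_hom[OF d'(1)] Id_hom[OF X]],
        use s12 Comp_assoc[OF z(2) d'(1)] d'(2) cd Id_Comp[OF z(2)] in simp_all)+
  obtain Q e where e: "regular_epi C e" "e \<in> hom C X Q" "e \<cdot> s1 = e \<cdot> s2"
    "\<And>Z x y. \<lbrakk>x \<in> hom C Z X; y \<in> hom C Z X; e \<cdot> x = e \<cdot> y\<rbrakk> \<Longrightarrow> \<exists>t\<in>hom C Z J. s1 \<cdot> t = x \<and> s2 \<cdot> t = y"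
  proof (rule reflexive_relation_quotient[OF s12 _ d'(1) sd])
    show "a = b" if "a \<in> hom C Z J" "b \<in> hom C Z J" "s1 \<cdot> a = s1 \<cdot> b" "s2 \<cdot> a = s2 \<cdot> b" for Z a b
      using jm[OF that] .
  qed blast
  show thesis
  proof (rule that[OF e(1,2)])
    show "e \<cdot> r1 = e \<cdot> r2"
      using comp_eq[OF e(3,2) s12(1) J(2)] Comp_assoc[OF J(2) s12(2) e(2)] sc by simp
    fix Z x y assume xy: "x \<in> hom C Z X" "y \<in> hom C Z X" "e \<cdot> x = e \<cdot> y"
    obtain t where t: "t \<in> hom C Z J" "s1 \<cdot> t = x" "s2 \<cdot> t = y" using e(4)[OF xy] by blast
    obtain Z' w k where k: "regular_epi C w" "w \<in> hom C Z' Z" "k \<in> hom C Z' R" "c \<cdot> k = t \<cdot> w"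
      using cover_lift[OF J(1,2) t(1)] .
    have "r1 \<cdot> k = x \<cdot> w" "r2 \<cdot> k = y \<cdot> w"
      using scx[OF k(3)] k(4) comp_eq[OF t(2) s12(1) t(1) k(2)] comp_eq[OF t(3) s12(2) t(1) k(2)]
      by simp_all
    with k show "\<exists>Z' z t. regular_epi C z \<and> z \<in> hom C Z' Z \<and> t \<in> hom C Z' R \<and> r1 \<cdot> t = x \<cdot> z \<and> r2 \<cdot> t = y \<cdot> z"
      by blast
  qed
qed

section \<open>Abelian objects\<close>

text \<open>An operation with \<open>x + 0 = x = 0 + x\<close>, stated on generalized elements of the product.  In a
  protomodular category this much of an abelian group structure implies the rest, and it
  passes easily to subobjects and quotients.\<close>
definition unital_multiplication :: "'o \<Rightarrow> 'o \<Rightarrow> 'm \<Rightarrow> 'm \<Rightarrow> 'm \<Rightarrow> bool" where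
  "unital_multiplication A P p q m \<longleftrightarrow> is_product C A A P p q \<and> m \<in> hom C P A \<and>
     (\<forall>Z. \<forall>h\<in>hom C Z P. (q \<cdot> h = zero Z A \<longrightarrow> m \<cdot> h = p \<cdot> h) \<and> (p \<cdot> h = zero Z A \<longrightarrow> m \<cdot> h = q \<cdot> h))"

lemma pairing:
  assumes "is_product C X Y P p q" "x \<in> hom C Z X" "y \<in> hom C Z Y"
  shows "pairing C p q x y \<in> hom C Z P" "p \<cdot> pairing C p q x y = x" "q \<cdot> pairing C p q x y = y"
proof -
  have D: "Dom C x = Z" "Dom C p = P"
    using assms(2) product_homs(1)[OF assms(1)] by (simp_all add: hom_def)
  have "\<exists>!h. h \<in> hom C Z P \<and> p \<cdot> h = x \<and> q \<cdot> h = y" using assms unfolding is_product_def by blast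
  from theI'[OF this]
  show "pairing C p q x y \<in> hom C Z P" "p \<cdot> pairing C p q x y = x" "q \<cdot> pairing C p q x y = y"
    unfolding pairing_def D by auto
qed

text \<open>Commutativity and associativity are equations between arrows out of a product, and a product is a
  point over its first factor.  It therefore suffices to put the last variable, or all the others, equal to
  zero, where both sides reduce by unitality.  Inverses come from the invertibility of a shear.\<close>
lemma unital_multiplication_imp_Ab:
  assumes "unital_multiplication A P p q m"
  shows "A \<in> Ab C"
proof -
  have P: "is_product C A A P p q" and m: "m \<in> hom C P A"
    and u1: "\<And>Z h. \<lbrakk>h \<in> hom C Z P; q \<cdot> h = zero Z A\<rbrakk> \<Longrightarrow> m \<cdot> h = p \<cdot> h"
    and u2: "\<And>Z h. \<lbrakk>h \<in> hom C Z P; p \<cdot> h = zero Z A\<rbrakk> \<Longrightarrow> m \<cdot> h = q \<cdot> h"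
    using assms unfolding unital_multiplication_def by blast+
  note pq = product_homs[OF P]
  note A = hom_Cod_Obj[OF m] and PO = hom_Dom_Obj[OF m]
  note I = Id_hom[OF A]
  define pr where "pr = pairing C p q"
  have pr: "pr x y \<in> hom C Z P" "p \<cdot> pr x y = x" "q \<cdot> pr x y = y"
    if "x \<in> hom C Z A" "y \<in> hom C Z A" for x y Z
    using pairing[OF P that] by (simp_all add: pr_def)
  have pr_eq: "h = pr x y" if "h \<in> hom C Z P" "p \<cdot> h = x" "q \<cdot> h = y" for h x y Z
  proof -
    have xy: "x \<in> hom C Z A" "y \<in> hom C Z A"
      using that Comp_hom[OF that(1) pq(1)] Comp_hom[OF that(1) pq(2)] by auto
    show ?thesis by (rule product_eq[OF P that(1) pr(1)[OF xy]]) (simp_all add: that(2,3) pr[OF xy])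
  qed
  have pr_comp: "pr x y \<cdot> w = pr (x \<cdot> w) (y \<cdot> w)"
    if xy: "x \<in> hom C Z A" "y \<in> hom C Z A" and w: "w \<in> hom C V Z" for x y w Z V
    by (rule pr_eq[OF Comp_hom[OF w pr(1)[OF xy]]])
      (rule comp_eq[OF pr(2)[OF xy] pq(1) pr(1)[OF xy] w] comp_eq[OF pr(3)[OF xy] pq(2) pr(1)[OF xy] w])+
  have unit: "m \<cdot> pr x (zero Z A) = x" "m \<cdot> pr (zero Z A) x = x" if x: "x \<in> hom C Z A" for x Z
  proof -
    note z = zero_hom[OF hom_Dom_Obj[OF x] A]
    show "m \<cdot> pr x (zero Z A) = x" "m \<cdot> pr (zero Z A) x = x"
      using u1[OF pr(1)[OF x z]] u2[OF pr(1)[OF z x]] pr(2,3)[OF x z] pr(2,3)[OF z x] by simp_all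
  qed
  have mul_comp: "(m \<cdot> pr x y) \<cdot> w = m \<cdot> pr (x \<cdot> w) (y \<cdot> w)"
    if xy: "x \<in> hom C Z A" "y \<in> hom C Z A" and w: "w \<in> hom C V Z" for x y w Z V
    using Comp_assoc[OF w pr(1)[OF xy] m] pr_comp[OF xy w] by simp
  have mul: "m \<cdot> pr x y \<in> hom C Z A" if "x \<in> hom C Z A" "y \<in> hom C Z A" for x y Z
    using Comp_hom[OF pr(1)[OF that] m] .
  note zA = zero_hom[OF A A]
  define s where "s = pr (Id C A) (zero A A)"
  have s: "s \<in> hom C A P" "p \<cdot> s = Id C A" "q \<cdot> s = zero A A"
    using pr[OF I zA] by (simp_all add: s_def)
  have commutative: "m \<cdot> pr q p = m"
  proof (rule kernel_and_section_jointly_epic[OF pq(1) s(1,2) mul[OF pq(2,1)] m])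
    show "(m \<cdot> pr q p) \<cdot> s = m \<cdot> s"
      using mul_comp[OF pq(2,1) s(1)] s(2,3) unit[OF I] by (simp add: s_def)
    fix Z h assume h: "h \<in> hom C Z P" "p \<cdot> h = zero Z A"
    show "(m \<cdot> pr q p) \<cdot> h = m \<cdot> h"
      using mul_comp[OF pq(2,1) h(1)] h(2) unit(1)[OF Comp_hom[OF h(1) pq(2)]] u2[OF h] by simp
  qed
  obtain Q r w where Q: "is_product C P A Q r w" using product_exists[OF PO A] .
  note rw = product_homs[OF Q]
  have prr: "p \<cdot> r \<in> hom C Q A" "q \<cdot> r \<in> hom C Q A" "m \<cdot> r \<in> hom C Q A"
    using Comp_hom[OF rw(1) pq(1)] Comp_hom[OF rw(1) pq(2)] Comp_hom[OF rw(1) m] by auto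
  obtain s' where s': "s' \<in> hom C P Q" "r \<cdot> s' = Id C P" "w \<cdot> s' = zero P A"
    using product_lift[OF Q Id_hom[OF PO] zero_hom[OF PO A]] .
  have associative: "m \<cdot> pr (m \<cdot> r) w = m \<cdot> pr (p \<cdot> r) (m \<cdot> pr (q \<cdot> r) w)"
  proof (rule kernel_and_section_jointly_epic[OF rw(1) s'(1,2) mul[OF prr(3) rw(2)]
        mul[OF prr(1) mul[OF prr(2) rw(2)]]])
    have "m = m \<cdot> pr p q" using pr_eq[OF Id_hom[OF PO] Comp_Id[OF pq(1)] Comp_Id[OF pq(2)]] Comp_Id[OF m] by simp
    then show "(m \<cdot> pr (m \<cdot> r) w) \<cdot> s' = (m \<cdot> pr (p \<cdot> r) (m \<cdot> pr (q \<cdot> r) w)) \<cdot> s'"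
      unfolding mul_comp[OF prr(3) rw(2) s'(1)] mul_comp[OF prr(1) mul[OF prr(2) rw(2)] s'(1)]
        mul_comp[OF prr(2) rw(2) s'(1)] Comp_assoc[OF s'(1) rw(1) m] Comp_assoc[OF s'(1) rw(1) pq(1)]
        Comp_assoc[OF s'(1) rw(1) pq(2)] s'(2,3) Comp_Id[OF m] Comp_Id[OF pq(1)] Comp_Id[OF pq(2)]
        unit(1)[OF m] unit(1)[OF pq(2)] .
    fix Z h assume h: "h \<in> hom C Z Q" "r \<cdot> h = zero Z P"
    note Z = hom_Dom_Obj[OF h(1)] and wh = Comp_hom[OF h(1) rw(2)]
    show "(m \<cdot> pr (m \<cdot> r) w) \<cdot> h = (m \<cdot> pr (p \<cdot> r) (m \<cdot> pr (q \<cdot> r) w)) \<cdot> h"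
      unfolding mul_comp[OF prr(3) rw(2) h(1)] mul_comp[OF prr(1) mul[OF prr(2) rw(2)] h(1)]
        mul_comp[OF prr(2) rw(2) h(1)] Comp_assoc[OF h(1) rw(1) m] Comp_assoc[OF h(1) rw(1) pq(1)]
        Comp_assoc[OF h(1) rw(1) pq(2)] h(2) comp_zero[OF m Z] comp_zero[OF pq(1) Z] comp_zero[OF pq(2) Z]
        unit(2)[OF wh] ..
  qed
  \<comment> \<open>The shear \<open>(x, y) \<mapsto> (x, x + y)\<close> is invertible; inverting it at \<open>(x, 0)\<close> gives \<open>-x\<close>.\<close>
  have "iso C (pr p m)"
  proof (rule split_short_five[OF pq(1) s(1,2) pq(1) pr(1,2)[OF I I] pr(1,2)[OF pq(1) m]])
    show "pr p m \<cdot> s = pr (Id C A) (Id C A)"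
      using pr_comp[OF pq(1) m s(1)] s(2) unit(1)[OF I] by (simp add: s_def)
    fix Z h assume h: "h \<in> hom C Z P" "p \<cdot> h = zero Z A"
    have fixes_kernel: "pr p m \<cdot> k = k" if k: "k \<in> hom C Z P" "p \<cdot> k = zero Z A" for k
      using pr_comp[OF pq(1) m k(1)] u2[OF k] pr_eq[OF k(1) refl refl] by simp
    show "\<exists>!k. k \<in> hom C Z P \<and> p \<cdot> k = zero Z A \<and> pr p m \<cdot> k = h"
      by (rule ex1I[of _ h]) (use h fixes_kernel in auto)
  qed
  then obtain k where k: "k \<in> hom C A P" "pr p m \<cdot> k = s"
    using iso_surjective[OF _ pr(1)[OF pq(1) m] s(1)] by blast
  have pk: "p \<cdot> k = Id C A"
    using comp_eq[OF pr(2)[OF pq(1) m] pq(1) pr(1)[OF pq(1) m] k(1)] k(2) s(2) by simp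
  have mk: "m \<cdot> k = zero A A"
    using comp_eq[OF pr(3)[OF pq(1) m] pq(2) pr(1)[OF pq(1) m] k(1)] k(2) s(3) by simp
  define i where "i = q \<cdot> k"
  have i: "i \<in> hom C A A" using Comp_hom[OF k(1) pq(2)] by (simp add: i_def)
  have inverse1: "m \<cdot> pr (Id C A) i = zero A A"
    using pr_eq[OF k(1) pk] mk by (simp add: i_def)
  have inverse2: "m \<cdot> pr i (Id C A) = zero A A"
    using mul_comp[OF pq(2,1) k(1)] commutative mk pk by (simp add: i_def)
  obtain T where T: "zero_object C T" using zero_object_exists by blast
  then have TO: "T \<in> Obj C" and Tt: "terminal C T" by (simp_all add: zero_object_def initial_def)
  have et: "zero T A \<cdot> zero A T = zero A A" using comp_zero[OF zero_hom[OF TO A] A] .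
  have "internal_abelian_group C A m (zero T A) i"
    unfolding internal_abelian_group_def
    apply (rule exI[of _ P], rule exI[of _ p], rule exI[of _ q], rule exI[of _ Q], rule exI[of _ r],
        rule exI[of _ w], rule exI[of _ T], rule exI[of _ "zero A T"])
    unfolding et pr_def[symmetric]
    using P Q Tt zero_hom[OF A TO] m zero_hom[OF TO A] i associative unit[OF I]
      inverse1 inverse2 commutative by simp
  then show ?thesis using A unfolding Ab_def by blast
qed

lemma Ab_imp_unital_multiplication:
  assumes "A \<in> Ab C"
  obtains P p q m where "unital_multiplication A P p q m"
proof -
  have A: "A \<in> Obj C" using assms by (simp add: Ab_def)
  obtain m e i where "internal_abelian_group C A m e i" using assms unfolding Ab_def by blast
  then obtain P p q T t where P: "is_product C A A P p q" and T: "terminal C T"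
    and t: "t \<in> hom C A T" and m: "m \<in> hom C P A" and e: "e \<in> hom C T A"
    and unit: "m \<cdot> pairing C p q (e \<cdot> t) (Id C A) = Id C A" "m \<cdot> pairing C p q (Id C A) (e \<cdot> t) = Id C A"
    unfolding internal_abelian_group_def by blast
  note pq = product_homs[OF P]
  have TO: "T \<in> Obj C" using T by (simp add: terminal_def)
  have "t = zero A T" using T A t zero_hom[OF A TO] unfolding terminal_def by blast
  then have et: "e \<cdot> t = zero A A" using comp_zero[OF e A] by simp
  note I = Id_hom[OF A] and zA = zero_hom[OF A A]
  have "unital_multiplication A P p q m"
    unfolding unital_multiplication_def
  proof (intro conjI allI ballI impI)
    fix Z h assume h: "h \<in> hom C Z P"
    have ph: "p \<cdot> h \<in> hom C Z A" and qh: "q \<cdot> h \<in> hom C Z A"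
      using Comp_hom[OF h pq(1)] Comp_hom[OF h pq(2)] by auto
    {
      assume z: "q \<cdot> h = zero Z A"
      let ?s = "pairing C p q (Id C A) (zero A A)"
      note s = pairing[OF P I zA]
      have "h = ?s \<cdot> (p \<cdot> h)"
      proof (rule product_eq[OF P h Comp_hom[OF ph s(1)]])
        show "p \<cdot> h = p \<cdot> (?s \<cdot> (p \<cdot> h))" using comp_Id_eq[OF s(2) pq(1) s(1) ph] by simp
        show "q \<cdot> h = q \<cdot> (?s \<cdot> (p \<cdot> h))"
          using comp_eq[OF s(3) pq(2) s(1) ph] zero_comp[OF ph A] z by simp
      qed
      then show "m \<cdot> h = p \<cdot> h" using comp_Id_eq[OF unit(2)[unfolded et] m s(1) ph] by simp
    next
      assume z: "p \<cdot> h = zero Z A"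
      let ?s = "pairing C p q (zero A A) (Id C A)"
      note s = pairing[OF P zA I]
      have "h = ?s \<cdot> (q \<cdot> h)"
      proof (rule product_eq[OF P h Comp_hom[OF qh s(1)]])
        show "q \<cdot> h = q \<cdot> (?s \<cdot> (q \<cdot> h))" using comp_Id_eq[OF s(3) pq(2) s(1) qh] by simp
        show "p \<cdot> h = p \<cdot> (?s \<cdot> (q \<cdot> h))"
          using comp_eq[OF s(2) pq(1) s(1) qh] zero_comp[OF qh A] z by simp
      qed
      then show "m \<cdot> h = q \<cdot> h" using comp_Id_eq[OF unit(1)[unfolded et] m s(1) qh] by simp
    }
  qed (rule P m)+
  with that show thesis by blast
qed

text \<open>A subobject \<open>X\<close> is closed under the operation: the condition \<open>x + y \<in> X\<close> holds for \<open>(x, 0)\<close> and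
  for \<open>(0, y)\<close>, and these generate \<open>X \<times> X\<close>.\<close>
lemma Ab_mono:
  assumes j: "mono C j" "j \<in> hom C X A" and "A \<in> Ab C"
  shows "X \<in> Ab C"
proof -
  obtain P p q m where "unital_multiplication A P p q m" using Ab_imp_unital_multiplication assms(3) .
  then have P: "is_product C A A P p q" and m: "m \<in> hom C P A"
    and u1: "\<And>Z h. \<lbrakk>h \<in> hom C Z P; q \<cdot> h = zero Z A\<rbrakk> \<Longrightarrow> m \<cdot> h = p \<cdot> h"
    and u2: "\<And>Z h. \<lbrakk>h \<in> hom C Z P; p \<cdot> h = zero Z A\<rbrakk> \<Longrightarrow> m \<cdot> h = q \<cdot> h"
    unfolding unital_multiplication_def by blast+
  note pq = product_homs[OF P]
  note X = hom_Dom_Obj[OF j(2)]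
  obtain P' p' q' where P': "is_product C X X P' p' q'" using product_exists[OF X X] .
  note pq' = product_homs[OF P']
  note PO' = hom_Dom_Obj[OF pq'(1)]
  obtain k where k: "k \<in> hom C P' P" "p \<cdot> k = j \<cdot> p'" "q \<cdot> k = j \<cdot> q'"
    using product_lift[OF P Comp_hom[OF pq'(1) j(2)] Comp_hom[OF pq'(2) j(2)]] .
  have mk: "m \<cdot> k \<in> hom C P' A" using Comp_hom[OF k(1) m] .
  have kh: "p \<cdot> (k \<cdot> h) = j \<cdot> (p' \<cdot> h)" "q \<cdot> (k \<cdot> h) = j \<cdot> (q' \<cdot> h)" if h: "h \<in> hom C Z P'" for h Z
    using comp_eq[OF k(2) pq(1) k(1) h] comp_eq[OF k(3) pq(2) k(1) h]
      Comp_assoc[OF h pq'(1) j(2)] Comp_assoc[OF h pq'(2) j(2)] by auto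
  have v1: "(m \<cdot> k) \<cdot> h = j \<cdot> (p' \<cdot> h)" if h: "h \<in> hom C Z P'" "q' \<cdot> h = zero Z X" for h Z
    using u1[OF Comp_hom[OF h(1) k(1)]] kh[OF h(1)] h(2) comp_zero[OF j(2) hom_Dom_Obj[OF h(1)]]
      Comp_assoc[OF h(1) k(1) m] by simp
  have v2: "(m \<cdot> k) \<cdot> h = j \<cdot> (q' \<cdot> h)" if h: "h \<in> hom C Z P'" "p' \<cdot> h = zero Z X" for h Z
    using u2[OF Comp_hom[OF h(1) k(1)]] kh[OF h(1)] h(2) comp_zero[OF j(2) hom_Dom_Obj[OF h(1)]]
      Comp_assoc[OF h(1) k(1) m] by simp
  obtain E n f where E: "is_pullback C (m \<cdot> k) j n f" "n \<in> hom C E P'" "f \<in> hom C E X"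
    "(m \<cdot> k) \<cdot> n = j \<cdot> f"
    using pullback_exists[OF mk j(2)] .
  have n: "mono C n"
  proof (rule mono_intro[OF E(2)])
    fix Z a b assume ab: "a \<in> hom C Z E" "b \<in> hom C Z E" "n \<cdot> a = n \<cdot> b"
    have "j \<cdot> (f \<cdot> a) = j \<cdot> (f \<cdot> b)"
      using comp_eq[OF E(4) mk E(2) ab(1)] comp_eq[OF E(4) mk E(2) ab(2)] ab(3)
        Comp_assoc[OF ab(1) E(3) j(2)] Comp_assoc[OF ab(2) E(3) j(2)] by simp
    then have "f \<cdot> a = f \<cdot> b"
      using mono_eq[OF j Comp_hom[OF ab(1) E(3)] Comp_hom[OF ab(2) E(3)]] by blast
    with pullback_eq[OF E(1,2) ab] show "a = b" by blast
  qed
  obtain s where s: "s \<in> hom C X P'" "p' \<cdot> s = Id C X" "q' \<cdot> s = zero X X"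
    using product_lift[OF P' Id_hom[OF X] zero_hom[OF X X]] .
  have "(m \<cdot> k) \<cdot> s = j \<cdot> Id C X" using v1[OF s(1,3)] s(2) by simp
  then obtain s' where s': "s' \<in> hom C X E" "n \<cdot> s' = s"
    using pullback_lift[OF E(1-3) s(1) Id_hom[OF X]] by blast
  have "iso C n"
  proof (rule kernel_and_section_generate[OF pq'(1) s(1,2) E(2) n s'])
    fix Z x assume x: "x \<in> hom C Z P'" "p' \<cdot> x = zero Z X"
    show "\<exists>y\<in>hom C Z E. n \<cdot> y = x"
      using pullback_lift[OF E(1-3) x(1) Comp_hom[OF x(1) pq'(2)] v2[OF x]] by blast
  qed
  then obtain g where g: "g \<in> hom C P' E" "n \<cdot> g = Id C P'"
    using iso_surjective[OF _ E(2) Id_hom[OF PO']] by blast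
  define m' where "m' = f \<cdot> g"
  have m': "m' \<in> hom C P' X" using Comp_hom[OF g(1) E(3)] by (simp add: m'_def)
  have jm': "j \<cdot> m' = m \<cdot> k"
    using comp_eq[OF E(4) mk E(2) g(1)] Comp_assoc[OF g(1) E(3) j(2)] g(2) Comp_Id[OF mk] by (simp add: m'_def)
  have "unital_multiplication X P' p' q' m'"
    unfolding unital_multiplication_def
  proof (intro conjI allI ballI impI)
    fix Z h assume h: "h \<in> hom C Z P'"
    note m'h = comp_eq[OF jm' j(2) m' h] and hm' = Comp_hom[OF h m']
    show "m' \<cdot> h = p' \<cdot> h" if "q' \<cdot> h = zero Z X"
      using mono_eq[OF j hm' Comp_hom[OF h pq'(1)]] m'h v1[OF h that] by simp
    show "m' \<cdot> h = q' \<cdot> h" if "p' \<cdot> h = zero Z X"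
      using mono_eq[OF j hm' Comp_hom[OF h pq'(2)]] m'h v2[OF h that] by simp
  qed (rule P' m')+
  then show ?thesis by (rule unital_multiplication_imp_Ab)
qed

text \<open>The operation descends along \<open>e \<times> e\<close> if \<open>x + y\<close> is annihilated by \<open>e\<close> whenever \<open>x\<close> and \<open>y\<close> are;
  on \<open>K \<times> K\<close>, with \<open>K\<close> the kernel of \<open>e\<close>, this is again checked on the pairs \<open>(x, 0)\<close> and \<open>(0, y)\<close>.\<close>
lemma Ab_regular_epi:
  assumes e: "regular_epi C e" "e \<in> hom C A Q" and "A \<in> Ab C"
  shows "Q \<in> Ab C"
proof -
  obtain P p q m where "unital_multiplication A P p q m" using Ab_imp_unital_multiplication assms(3) .
  then have P: "is_product C A A P p q" and m: "m \<in> hom C P A"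
    and u1: "\<And>Z h. \<lbrakk>h \<in> hom C Z P; q \<cdot> h = zero Z A\<rbrakk> \<Longrightarrow> m \<cdot> h = p \<cdot> h"
    and u2: "\<And>Z h. \<lbrakk>h \<in> hom C Z P; p \<cdot> h = zero Z A\<rbrakk> \<Longrightarrow> m \<cdot> h = q \<cdot> h"
    unfolding unital_multiplication_def by blast+
  note pq = product_homs[OF P]
  note A = hom_Dom_Obj[OF e(2)] and QO = hom_Cod_Obj[OF e(2)]
  have em: "e \<cdot> m \<in> hom C P Q" using Comp_hom[OF m e(2)] .
  obtain P' p' q' where P': "is_product C Q Q P' p' q'" using product_exists[OF QO QO] .
  note pq' = product_homs[OF P']
  note PO' = hom_Dom_Obj[OF pq'(1)]
  obtain c where c: "c \<in> hom C P P'" "p' \<cdot> c = e \<cdot> p" "q' \<cdot> c = e \<cdot> q"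
    using product_lift[OF P' Comp_hom[OF pq(1) e(2)] Comp_hom[OF pq(2) e(2)]] .
  have ch: "p' \<cdot> (c \<cdot> h) = e \<cdot> (p \<cdot> h)" "q' \<cdot> (c \<cdot> h) = e \<cdot> (q \<cdot> h)" if h: "h \<in> hom C Z P" for h Z
    using comp_eq[OF c(2) pq'(1) c(1) h] comp_eq[OF c(3) pq'(2) c(1) h]
      Comp_assoc[OF h pq(1) e(2)] Comp_assoc[OF h pq(2) e(2)] by auto
  have rc: "regular_epi C c"
  proof -
    obtain Z1 z1 x where 1: "regular_epi C z1" "z1 \<in> hom C Z1 P'" "x \<in> hom C Z1 A" "e \<cdot> x = p' \<cdot> z1"
      using cover_lift[OF e pq'(1)] .
    obtain Z2 z2 y where 2: "regular_epi C z2" "z2 \<in> hom C Z2 Z1" "y \<in> hom C Z2 A" "e \<cdot> y = (q' \<cdot> z1) \<cdot> z2"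
      using cover_lift[OF e Comp_hom[OF 1(2) pq'(2)]] .
    obtain h where h: "h \<in> hom C Z2 P" "p \<cdot> h = x \<cdot> z2" "q \<cdot> h = y"
      using product_lift[OF P Comp_hom[OF 2(2) 1(3)] 2(3)] .
    have "c \<cdot> h = z1 \<cdot> z2"
    proof (rule product_eq[OF P' Comp_hom[OF h(1) c(1)] Comp_hom[OF 2(2) 1(2)]])
      show "p' \<cdot> (c \<cdot> h) = p' \<cdot> (z1 \<cdot> z2)"
        using ch(1)[OF h(1)] h(2) comp_eq[OF 1(4) e(2) 1(3) 2(2)] Comp_assoc[OF 2(2) 1(2) pq'(1)] by simp
      show "q' \<cdot> (c \<cdot> h) = q' \<cdot> (z1 \<cdot> z2)"
        using ch(2)[OF h(1)] h(3) 2(4) Comp_assoc[OF 2(2) 1(2) pq'(2)] by simp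
    qed
    then show ?thesis
      using regular_epi_cancel[OF _ h(1) c(1)] regular_epi_comp[OF 2(1,2) 1(1,2)] by simp
  qed
  \<comment> \<open>The kernel of \<open>e\<close> is closed under the multiplication.\<close>
  obtain K k where K: "k \<in> hom C K A" "mono C k" "e \<cdot> k = zero A Q \<cdot> k"
    "\<And>Z x. \<lbrakk>x \<in> hom C Z A; e \<cdot> x = zero A Q \<cdot> x\<rbrakk> \<Longrightarrow> \<exists>y\<in>hom C Z K. k \<cdot> y = x"
    by (rule equalizer_exists[OF e(2) zero_hom[OF A QO]]) blast
  note KO = hom_Dom_Obj[OF K(1)]
  have ek: "e \<cdot> (k \<cdot> x) = zero Z Q" if x: "x \<in> hom C Z K" for x Z
    using comp_eq[OF K(3) e(2) K(1) x] zero_comp[OF K(1) QO] zero_comp[OF x QO] by simp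
  have k_lift: "\<exists>y\<in>hom C Z K. k \<cdot> y = x" if "x \<in> hom C Z A" "e \<cdot> x = zero Z Q" for x Z
    using K(4)[OF that(1)] that zero_comp[OF that(1) QO] by simp
  obtain PK pK qK where PK: "is_product C K K PK pK qK" using product_exists[OF KO KO] .
  note pqK = product_homs[OF PK]
  note PKO = hom_Dom_Obj[OF pqK(1)]
  obtain kk where kk: "kk \<in> hom C PK P" "p \<cdot> kk = k \<cdot> pK" "q \<cdot> kk = k \<cdot> qK"
    using product_lift[OF P Comp_hom[OF pqK(1) K(1)] Comp_hom[OF pqK(2) K(1)]] .
  have kkh: "p \<cdot> (kk \<cdot> h) = k \<cdot> (pK \<cdot> h)" "q \<cdot> (kk \<cdot> h) = k \<cdot> (qK \<cdot> h)" if h: "h \<in> hom C Z PK" for h Z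
    using comp_eq[OF kk(2) pq(1) kk(1) h] comp_eq[OF kk(3) pq(2) kk(1) h]
      Comp_assoc[OF h pqK(1) K(1)] Comp_assoc[OF h pqK(2) K(1)] by auto
  obtain s where s: "s \<in> hom C K PK" "pK \<cdot> s = Id C K" "qK \<cdot> s = zero K K"
    using product_lift[OF PK Id_hom[OF KO] zero_hom[OF KO KO]] .
  have emk: "((e \<cdot> m) \<cdot> kk) \<cdot> h = e \<cdot> (m \<cdot> (kk \<cdot> h))" if h: "h \<in> hom C Z PK" for h Z
    using Comp_assoc[OF h kk(1) em] Comp_assoc[OF Comp_hom[OF h kk(1)] m e(2)] by simp
  have "(e \<cdot> m) \<cdot> kk = zero PK Q"
  proof (rule kernel_and_section_jointly_epic[OF pqK(1) s(1,2) Comp_hom[OF kk(1) em] zero_hom[OF PKO QO]])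
    have "m \<cdot> (kk \<cdot> s) = k \<cdot> Id C K"
      using u1[OF Comp_hom[OF s(1) kk(1)]] kkh[OF s(1)] s(2,3) comp_zero[OF K(1) KO] by simp
    then show "((e \<cdot> m) \<cdot> kk) \<cdot> s = zero PK Q \<cdot> s"
      using emk[OF s(1)] ek[OF Id_hom[OF KO]] zero_comp[OF s(1) QO] by simp
    fix Z h assume h: "h \<in> hom C Z PK" "pK \<cdot> h = zero Z K"
    have "m \<cdot> (kk \<cdot> h) = k \<cdot> (qK \<cdot> h)"
      using u2[OF Comp_hom[OF h(1) kk(1)]] kkh[OF h(1)] h(2) comp_zero[OF K(1) hom_Dom_Obj[OF h(1)]] by simp
    then show "((e \<cdot> m) \<cdot> kk) \<cdot> h = zero PK Q \<cdot> h"
      using emk[OF h(1)] ek[OF Comp_hom[OF h(1) pqK(2)]] zero_comp[OF h(1) QO] by simp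
  qed
  then have emk0: "(e \<cdot> m) \<cdot> (kk \<cdot> h) = zero Z Q" if h: "h \<in> hom C Z PK" for h Z
    using comp_eq[OF _ em kk(1) h] zero_comp[OF h QO] by simp
  have kernel: "(e \<cdot> m) \<cdot> x = zero Z Q" if x: "x \<in> hom C Z P" "c \<cdot> x = zero Z P'" for x Z
  proof -
    note Z = hom_Dom_Obj[OF x(1)]
    have "e \<cdot> (p \<cdot> x) = zero Z Q" "e \<cdot> (q \<cdot> x) = zero Z Q"
      using ch[OF x(1)] x(2) comp_zero[OF pq'(1) Z] comp_zero[OF pq'(2) Z] by simp_all
    then obtain a b where ab: "a \<in> hom C Z K" "k \<cdot> a = p \<cdot> x" "b \<in> hom C Z K" "k \<cdot> b = q \<cdot> x"
      using k_lift[OF Comp_hom[OF x(1) pq(1)]] k_lift[OF Comp_hom[OF x(1) pq(2)]] by blast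
    obtain h where h: "h \<in> hom C Z PK" "pK \<cdot> h = a" "qK \<cdot> h = b" using product_lift[OF PK ab(1,3)] .
    have "x = kk \<cdot> h"
      by (rule product_eq[OF P x(1) Comp_hom[OF h(1) kk(1)]])
        (simp_all add: kkh[OF h(1)] h(2,3) ab(2,4))
    then show ?thesis using emk0[OF h(1)] by simp
  qed
  obtain m' where m': "m' \<in> hom C P' Q" "m' \<cdot> c = e \<cdot> m"
    by (rule regular_epi_factor[OF rc c(1) em kernel_le_imp_kernel_pair_le[OF c(1) em QO kernel]])
  have "unital_multiplication Q P' p' q' m'"
    unfolding unital_multiplication_def
  proof (intro conjI allI ballI impI)
    fix Z h assume h: "h \<in> hom C Z P'"
    note Z = hom_Dom_Obj[OF h]
    have ph: "p' \<cdot> h \<in> hom C Z Q" and qh: "q' \<cdot> h \<in> hom C Z Q" and mh: "m' \<cdot> h \<in> hom C Z Q"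
      using Comp_hom[OF h pq'(1)] Comp_hom[OF h pq'(2)] Comp_hom[OF h m'(1)] by auto
    {
      assume z: "q' \<cdot> h = zero Z Q"
      obtain Z1 z1 x where 1: "regular_epi C z1" "z1 \<in> hom C Z1 Z" "x \<in> hom C Z1 A" "e \<cdot> x = (p' \<cdot> h) \<cdot> z1"
        using cover_lift[OF e ph] .
      note Z1 = hom_Dom_Obj[OF 1(2)]
      obtain g where g: "g \<in> hom C Z1 P" "p \<cdot> g = x" "q \<cdot> g = zero Z1 A"
        using product_lift[OF P 1(3) zero_hom[OF Z1 A]] .
      have "c \<cdot> g = h \<cdot> z1"
      proof (rule product_eq[OF P' Comp_hom[OF g(1) c(1)] Comp_hom[OF 1(2) h]])
        show "p' \<cdot> (c \<cdot> g) = p' \<cdot> (h \<cdot> z1)"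
          using ch(1)[OF g(1)] g(2) 1(4) Comp_assoc[OF 1(2) h pq'(1)] by simp
        show "q' \<cdot> (c \<cdot> g) = q' \<cdot> (h \<cdot> z1)"
          using ch(2)[OF g(1)] g(3) comp_zero[OF e(2) Z1] comp_eq[OF z pq'(2) h 1(2)] zero_comp[OF 1(2) QO]
          by simp
      qed
      then have "(m' \<cdot> h) \<cdot> z1 = (p' \<cdot> h) \<cdot> z1"
        using comp_eq[OF m'(2,1) c(1) g(1)] Comp_assoc[OF g(1) m e(2)] u1[OF g(1,3)] g(2) 1(4)
          Comp_assoc[OF 1(2) h m'(1)] by simp
      then show "m' \<cdot> h = p' \<cdot> h" using regular_epi_epi[OF 1(1,2) mh ph] by blast
    next
      assume z: "p' \<cdot> h = zero Z Q"
      obtain Z1 z1 x where 1: "regular_epi C z1" "z1 \<in> hom C Z1 Z" "x \<in> hom C Z1 A" "e \<cdot> x = (q' \<cdot> h) \<cdot> z1"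
        using cover_lift[OF e qh] .
      note Z1 = hom_Dom_Obj[OF 1(2)]
      obtain g where g: "g \<in> hom C Z1 P" "p \<cdot> g = zero Z1 A" "q \<cdot> g = x"
        using product_lift[OF P zero_hom[OF Z1 A] 1(3)] .
      have "c \<cdot> g = h \<cdot> z1"
      proof (rule product_eq[OF P' Comp_hom[OF g(1) c(1)] Comp_hom[OF 1(2) h]])
        show "q' \<cdot> (c \<cdot> g) = q' \<cdot> (h \<cdot> z1)"
          using ch(2)[OF g(1)] g(3) 1(4) Comp_assoc[OF 1(2) h pq'(2)] by simp
        show "p' \<cdot> (c \<cdot> g) = p' \<cdot> (h \<cdot> z1)"
          using ch(1)[OF g(1)] g(2) comp_zero[OF e(2) Z1] comp_eq[OF z pq'(1) h 1(2)] zero_comp[OF 1(2) QO]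
          by simp
      qed
      then have "(m' \<cdot> h) \<cdot> z1 = (q' \<cdot> h) \<cdot> z1"
        using comp_eq[OF m'(2,1) c(1) g(1)] Comp_assoc[OF g(1) m e(2)] u2[OF g(1,2)] g(3) 1(4)
          Comp_assoc[OF 1(2) h m'(1)] by simp
      then show "m' \<cdot> h = q' \<cdot> h" using regular_epi_epi[OF 1(1,2) mh qh] by blast
    }
  qed (rule P' m'(1))+
  then show ?thesis by (rule unital_multiplication_imp_Ab)
qed

lemma Ab_Birkhoff:
  assumes "is_reflector C (Ab C) I \<eta>"
  shows "Birkhoff_subcategory C (Ab C) I \<eta>"
proof -
  have "Dom C f \<in> Ab C" if "mono C f" "Cod C f \<in> Ab C" for f
    using Ab_mono[OF that(1) _ that(2)] that(1) by (simp add: mono_def hom_def)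
  moreover have "Cod C f \<in> Ab C" if "regular_epi C f" "Dom C f \<in> Ab C" for f
    using Ab_regular_epi[OF that(1) regular_epi_hom[OF that(1)] that(2)] .
  ultimately show ?thesis using assms unfolding Birkhoff_subcategory_def by blast
qed

end

section \<open>Birkhoff subcategories\<close>

locale birkhoff_subcategory = semi_abelian_category C
  for C :: "('o, 'm) category" (structure) +
  fixes B :: "'o set" and I :: "('o, 'm) endo_map" and \<eta> :: "'o \<Rightarrow> 'm"
  assumes birkhoff: "Birkhoff_subcategory C B I \<eta>"
begin

lemma is_reflector: "is_reflector C B I \<eta>"
  using birkhoff by (simp only: Birkhoff_subcategory_def)

lemma B_mono: "\<lbrakk>mono C m; m \<in> hom C X Y; Y \<in> B\<rbrakk> \<Longrightarrow> X \<in> B"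
  and B_regular_epi: "\<lbrakk>regular_epi C e; e \<in> hom C X Y; X \<in> B\<rbrakk> \<Longrightarrow> Y \<in> B"
  using birkhoff unfolding Birkhoff_subcategory_def hom_def by blast+

lemma eta_hom: "X \<in> Obj C \<Longrightarrow> \<eta> X \<in> hom C X (obj_map I X)"
  using is_reflector unfolding is_reflector_def by blast

lemma I_in_B: "X \<in> Obj C \<Longrightarrow> obj_map I X \<in> B"
  using is_reflector by (simp add: is_reflector_def is_functor_def full_subcategory_def)

lemma B_Obj: "X \<in> B \<Longrightarrow> X \<in> Obj C"
  using is_reflector unfolding is_reflector_def by blast

lemma I_hom:
  assumes "f \<in> hom C X Y"
  shows "arr_map I f \<in> hom C (obj_map I X) (obj_map I Y)"
proof -
  have f: "f \<in> Arr C" "Dom C f = X" "Cod C f = Y" using assms by (simp_all add: hom_def)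
  have "\<forall>f\<in>Arr C. arr_map I f \<in> hom (full_subcategory C B) (obj_map I (Dom C f)) (obj_map I (Cod C f))"
    using is_reflector unfolding is_reflector_def is_functor_def by blast
  with f show ?thesis by (auto simp: hom_full_subcategory)
qed

lemma eta_natural:
  assumes "f \<in> hom C X Y"
  shows "\<eta> Y \<cdot> f = arr_map I f \<cdot> \<eta> X"
proof -
  have f: "f \<in> Arr C" "Dom C f = X" "Cod C f = Y" using assms by (simp_all add: hom_def)
  have "\<forall>f\<in>Arr C. \<eta> (Cod C f) \<cdot> f = arr_map I f \<cdot> \<eta> (Dom C f)"
    using is_reflector unfolding is_reflector_def by blast
  with f show ?thesis by auto
qed

lemma eta_universal:
  assumes "f \<in> hom C X W" "W \<in> B"
  shows "\<exists>!h. h \<in> hom C (obj_map I X) W \<and> h \<cdot> \<eta> X = f"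
  using is_reflector hom_Dom_Obj[OF assms(1)] assms unfolding is_reflector_def by blast

lemma eta_epi:
  assumes "h \<in> hom C (obj_map I X) W" "k \<in> hom C (obj_map I X) W" "h \<cdot> \<eta> X = k \<cdot> \<eta> X" "W \<in> B" "X \<in> Obj C"
  shows "h = k"
  using eta_universal[OF Comp_hom[OF eta_hom[OF assms(5)] assms(1)] assms(4)] assms by auto

text \<open>The image of \<open>\<eta> X\<close> is a subobject of an object of \<open>B\<close>, hence in \<open>B\<close>; by the universal property its
  inclusion is split, so the image is all of \<open>I X\<close>.\<close>
lemma eta_regular_epi:
  assumes X: "X \<in> Obj C"
  shows "regular_epi C (\<eta> X)"
proof -
  note e = eta_hom[OF X]
  obtain J c m where J: "regular_epi C c" "c \<in> hom C X J" "m \<in> hom C J (obj_map I X)" "mono C m"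
    "m \<cdot> c = \<eta> X"
    using image_factorization[OF e] .
  have "J \<in> B" using B_mono[OF J(4,3) I_in_B[OF X]] .
  then obtain h where h: "h \<in> hom C (obj_map I X) J" "h \<cdot> \<eta> X = c"
    using eta_universal[OF J(2)] by blast
  have IO: "obj_map I X \<in> Obj C" using e hom_Cod_Obj by blast
  have mh: "m \<cdot> h = Id C (obj_map I X)"
    by (rule eta_epi[OF Comp_hom[OF h(1) J(3)] Id_hom[OF IO] _ I_in_B[OF X] X])
      (simp add: Comp_assoc[OF e h(1) J(3)] h(2) J(5) Id_Comp[OF e])
  have "regular_epi C m" by (rule regular_epi_split[OF J(3) h(1) mh])
  from regular_epi_comp[OF J(1,2) this J(3)] show ?thesis unfolding J(5) .
qed

text \<open>The elements of the kernel of \<open>\<eta> X\<close>, a relative derived subobject: for groups and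
  abelianization they are the elements of \<open>[X, X]\<close>.\<close>
definition null :: "'o \<Rightarrow> 'o \<Rightarrow> 'm set" where
  "null Z X = {x \<in> hom C Z X. \<eta> X \<cdot> x = zero Z (obj_map I X)}"

lemma null_hom: "x \<in> null Z X \<Longrightarrow> x \<in> hom C Z X"
  by (simp add: null_def)

lemma null_comp:
  assumes "x \<in> null Z X" "w \<in> hom C V Z"
  shows "x \<cdot> w \<in> null V X"
proof -
  have x: "x \<in> hom C Z X" "\<eta> X \<cdot> x = zero Z (obj_map I X)" using assms(1) by (simp_all add: null_def)
  note X = hom_Cod_Obj[OF x(1)]
  note e = eta_hom[OF X]
  have "\<eta> X \<cdot> (x \<cdot> w) = zero V (obj_map I X)"
    using comp_eq[OF x(2) e x(1) assms(2)] zero_comp[OF assms(2) hom_Cod_Obj[OF e]] by simp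
  then show ?thesis using Comp_hom[OF assms(2) x(1)] by (simp add: null_def)
qed

lemma comp_null:
  assumes "x \<in> null Z X" "f \<in> hom C X Y"
  shows "f \<cdot> x \<in> null Z Y"
proof -
  have x: "x \<in> hom C Z X" "\<eta> X \<cdot> x = zero Z (obj_map I X)" using assms(1) by (simp_all add: null_def)
  note XY = hom_Dom_Obj[OF assms(2)] hom_Cod_Obj[OF assms(2)]
  note e = eta_hom[OF XY(1)] eta_hom[OF XY(2)]
  have "\<eta> Y \<cdot> (f \<cdot> x) = (arr_map I f \<cdot> \<eta> X) \<cdot> x"
    using comp_eq[OF eta_natural[OF assms(2)] e(2) assms(2) x(1)] .
  also have "\<dots> = zero Z (obj_map I Y)"
    using Comp_assoc[OF x(1) e(1) I_hom[OF assms(2)]] x(2)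
      comp_zero[OF I_hom[OF assms(2)] hom_Dom_Obj[OF x(1)]] by simp
  finally show ?thesis using Comp_hom[OF x(1) assms(2)] by (simp add: null_def)
qed

lemma null_into_B:
  assumes "x \<in> null Z X" "f \<in> hom C X W" "W \<in> B"
  shows "f \<cdot> x = zero Z W"
proof -
  have x: "x \<in> hom C Z X" "\<eta> X \<cdot> x = zero Z (obj_map I X)" using assms(1) by (simp_all add: null_def)
  note e = eta_hom[OF hom_Cod_Obj[OF x(1)]]
  obtain h where h: "h \<in> hom C (obj_map I X) W" "h \<cdot> \<eta> X = f" using eta_universal[OF assms(2,3)] by blast
  show ?thesis using comp_eq[OF h(2,1) e x(1)] x(2) comp_zero[OF h(1) hom_Dom_Obj[OF x(1)]] by simp
qed

text \<open>For groups: \<open>f\<close> maps \<open>[X, X]\<close> onto \<open>[Y, Y]\<close>.  Write \<open>y = f x\<close> over a cover.  The pushout \<open>W\<close> of \<open>f\<close> and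
  \<open>\<eta> X\<close> lies in \<open>B\<close>, so \<open>y\<close> vanishes in \<open>W\<close>; hence there are \<open>p, q\<close> with \<open>f p = f q\<close>,
  \<open>\<eta> p = \<eta> x\<close> and \<open>\<eta> q = 0\<close>.  Difunctionality of the span \<open>(f, \<eta>)\<close>, applied to \<open>x, p, q\<close>, gives an
  element over \<open>y\<close> that is killed by \<open>\<eta>\<close>.\<close>
lemma null_lift:
  assumes f: "regular_epi C f" "f \<in> hom C X Y" and y: "y \<in> null Z Y"
  obtains Z' z x where "regular_epi C z" "z \<in> hom C Z' Z" "x \<in> null Z' X" "f \<cdot> x = y \<cdot> z"
proof -
  note XY = hom_Dom_Obj[OF f(2)] hom_Cod_Obj[OF f(2)]
  define J where "J = obj_map I X"
  have e: "\<eta> X \<in> hom C X J" and JB: "J \<in> B" using eta_hom I_in_B XY(1) by (simp_all add: J_def)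
  note JO = B_Obj[OF JB]
  have yh: "y \<in> hom C Z Y" using null_hom[OF y] .
  obtain R p q where R: "is_pullback C f f p q" "p \<in> hom C R X" "q \<in> hom C R X" "f \<cdot> p = f \<cdot> q"
    using pullback_exists[OF f(2,2)] .
  obtain d where d: "d \<in> hom C X R" "p \<cdot> d = Id C X" "q \<cdot> d = Id C X"
    using pullback_lift[OF R(1-3) Id_hom[OF XY(1)] Id_hom[OF XY(1)] refl] .
  have r: "\<eta> X \<cdot> p \<in> hom C R J" "\<eta> X \<cdot> q \<in> hom C R J"
    using Comp_hom[OF R(2) e] Comp_hom[OF R(3) e] by auto
  \<comment> \<open>\<open>W\<close> is the pushout of \<open>f\<close> and \<open>\<eta> X\<close>; being a quotient of \<open>J\<close>, it lies in \<open>B\<close>.\<close>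
  obtain W c where W: "regular_epi C c" "c \<in> hom C J W" "c \<cdot> (\<eta> X \<cdot> p) = c \<cdot> (\<eta> X \<cdot> q)"
    "\<And>Z x y. \<lbrakk>x \<in> hom C Z J; y \<in> hom C Z J; c \<cdot> x = c \<cdot> y\<rbrakk>
      \<Longrightarrow> \<exists>Z' z t. regular_epi C z \<and> z \<in> hom C Z' Z \<and> t \<in> hom C Z' R \<and>
            (\<eta> X \<cdot> p) \<cdot> t = x \<cdot> z \<and> (\<eta> X \<cdot> q) \<cdot> t = y \<cdot> z"
  proof (rule reflexive_span_quotient[OF r eta_regular_epi[OF XY(1)] e d(1)])
    show "(\<eta> X \<cdot> p) \<cdot> d = \<eta> X" "(\<eta> X \<cdot> q) \<cdot> d = \<eta> X"
      using Comp_assoc[OF d(1) R(2) e] Comp_assoc[OF d(1) R(3) e] d(2,3) Comp_Id[OF e] by simp_all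
  qed blast
  have WB: "W \<in> B" using B_regular_epi[OF W(1,2) JB] .
  have ce: "c \<cdot> \<eta> X \<in> hom C X W" using Comp_hom[OF e W(2)] .
  obtain g where g: "g \<in> hom C Y W" "g \<cdot> f = c \<cdot> \<eta> X"
  proof (rule regular_epi_factor[OF f ce])
    fix V s t assume st: "s \<in> hom C V X" "t \<in> hom C V X" "f \<cdot> s = f \<cdot> t"
    obtain n where n: "n \<in> hom C V R" "p \<cdot> n = s" "q \<cdot> n = t" using pullback_lift[OF R(1-3) st] .
    have "c \<cdot> ((\<eta> X \<cdot> p) \<cdot> n) = c \<cdot> ((\<eta> X \<cdot> q) \<cdot> n)"
      using comp_eq[OF W(3,2) r(1) n(1)] Comp_assoc[OF n(1) r(2) W(2)] by simp
    then show "(c \<cdot> \<eta> X) \<cdot> s = (c \<cdot> \<eta> X) \<cdot> t"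
      using Comp_assoc[OF n(1) R(2) e] Comp_assoc[OF n(1) R(3) e] n(2,3)
        Comp_assoc[OF st(1) e W(2)] Comp_assoc[OF st(2) e W(2)] by simp
  qed
  obtain Z1 z1 x where 1: "regular_epi C z1" "z1 \<in> hom C Z1 Z" "x \<in> hom C Z1 X" "f \<cdot> x = y \<cdot> z1"
    using cover_lift[OF f yh] .
  note Z1 = hom_Dom_Obj[OF 1(2)]
  have ex: "\<eta> X \<cdot> x \<in> hom C Z1 J" using Comp_hom[OF 1(3) e] .
  have "c \<cdot> (\<eta> X \<cdot> x) = g \<cdot> (f \<cdot> x)"
    using Comp_assoc[OF 1(3) f(2) g(1)] Comp_assoc[OF 1(3) e W(2)] g(2) by simp
  also have "\<dots> = zero Z1 W"
    unfolding 1(4) by (rule null_into_B[OF null_comp[OF y 1(2)] g(1) WB])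
  also have "\<dots> = c \<cdot> zero Z1 J" using comp_zero[OF W(2) Z1] by simp
  finally obtain Z2 z2 t where 2: "regular_epi C z2" "z2 \<in> hom C Z2 Z1" "t \<in> hom C Z2 R"
    "(\<eta> X \<cdot> p) \<cdot> t = (\<eta> X \<cdot> x) \<cdot> z2" "(\<eta> X \<cdot> q) \<cdot> t = zero Z1 J \<cdot> z2"
    using W(4)[OF ex zero_hom[OF Z1 JO]] by blast
  have pq: "p \<cdot> t \<in> hom C Z2 X" "q \<cdot> t \<in> hom C Z2 X" "x \<cdot> z2 \<in> hom C Z2 X"
    using Comp_hom[OF 2(3) R(2)] Comp_hom[OF 2(3) R(3)] Comp_hom[OF 2(2) 1(3)] by auto
  have ep: "\<eta> X \<cdot> (x \<cdot> z2) = \<eta> X \<cdot> (p \<cdot> t)"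
    using 2(4) Comp_assoc[OF 2(3) R(2) e] Comp_assoc[OF 2(2) 1(3) e] by simp
  have eq: "\<eta> X \<cdot> (q \<cdot> t) = zero Z2 J"
    using 2(5) Comp_assoc[OF 2(3) R(3) e] zero_comp[OF 2(2) JO] by simp
  have fpq: "f \<cdot> (p \<cdot> t) = f \<cdot> (q \<cdot> t)"
    using comp_eq[OF R(4) f(2) R(2) 2(3)] Comp_assoc[OF 2(3) R(3) f(2)] by simp
  obtain Z3 z3 u where 3: "regular_epi C z3" "z3 \<in> hom C Z3 Z2" "u \<in> hom C Z3 X"
    "f \<cdot> u = f \<cdot> ((x \<cdot> z2) \<cdot> z3)" "\<eta> X \<cdot> u = \<eta> X \<cdot> ((q \<cdot> t) \<cdot> z3)"
    using span_difunctional[OF f(2) e pq(3,1,2) ep fpq] .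
  have z23: "regular_epi C (z2 \<cdot> z3)" "z2 \<cdot> z3 \<in> hom C Z3 Z1"
    using regular_epi_comp[OF 3(1,2) 2(1,2)] Comp_hom[OF 3(2) 2(2)] by auto
  show thesis
  proof (rule that)
    show "regular_epi C (z1 \<cdot> (z2 \<cdot> z3))" using regular_epi_comp[OF z23 1(1,2)] .
    show "z1 \<cdot> (z2 \<cdot> z3) \<in> hom C Z3 Z" using Comp_hom[OF z23(2) 1(2)] .
    have "\<eta> X \<cdot> u = zero Z3 J"
      using 3(5) comp_eq[OF eq e pq(2) 3(2)] zero_comp[OF 3(2) JO] by simp
    then show "u \<in> null Z3 X" using 3(3) by (simp add: null_def J_def)
    have "f \<cdot> u = (y \<cdot> z1) \<cdot> (z2 \<cdot> z3)"
      using 3(4) Comp_assoc[OF 3(2) 2(2) 1(3)] comp_eq[OF 1(4) f(2) 1(3) z23(2)] by simp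
    then show "f \<cdot> u = y \<cdot> (z1 \<cdot> (z2 \<cdot> z3))" using Comp_assoc[OF z23(2) 1(2) yh] by simp
  qed
qed

text \<open>Equality of two arrows on null elements may be tested after a cover, since null elements
  lift to null elements.\<close>
lemma null_eq_descent:
  assumes z: "regular_epi C z" "z \<in> hom C V W" and ab: "a \<in> hom C W D" "b \<in> hom C W D"
    and eq: "\<And>Z w. w \<in> null Z V \<Longrightarrow> (a \<cdot> z) \<cdot> w = (b \<cdot> z) \<cdot> w"
    and w: "w \<in> null Z W"
  shows "a \<cdot> w = b \<cdot> w"
proof -
  obtain Z' v w' where v: "regular_epi C v" "v \<in> hom C Z' Z" "w' \<in> null Z' V" "z \<cdot> w' = w \<cdot> v"
    using null_lift[OF z w] .
  have wh: "w \<in> hom C Z W" "w' \<in> hom C Z' V" using w v(3) null_hom by auto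
  have "(a \<cdot> w) \<cdot> v = (b \<cdot> w) \<cdot> v"
    using eq[OF v(3)] Comp_assoc[OF wh(2) z(2) ab(1)] Comp_assoc[OF wh(2) z(2) ab(2)] v(4)
      Comp_assoc[OF v(2) wh(1) ab(1)] Comp_assoc[OF v(2) wh(1) ab(2)] by simp
  then show ?thesis
    using regular_epi_epi[OF v(1,2) Comp_hom[OF wh(1) ab(1)] Comp_hom[OF wh(1) ab(2)]] by blast
qed

lemma perfect_iff: "perfect C I X \<longleftrightarrow> Id C X \<in> null X X"
proof (cases "X \<in> Obj C")
  case X: True
  note e = eta_hom[OF X]
  note IO = hom_Cod_Obj[OF e]
  show ?thesis
  proof
    assume "perfect C I X"
    then have "\<eta> X = zero X (obj_map I X)"
      using into_zero_object[OF _ e] by (simp add: perfect_def)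
    then show "Id C X \<in> null X X" using Comp_Id[OF e] Id_hom[OF X] by (simp add: null_def)
  next
    assume "Id C X \<in> null X X"
    then have "\<eta> X = zero X (obj_map I X)" using Comp_Id[OF e] by (simp add: null_def)
    then have "Id C (obj_map I X) = zero (obj_map I X) (obj_map I X)"
      using eta_epi[OF Id_hom[OF IO] zero_hom[OF IO IO] _ I_in_B[OF X] X]
        Id_Comp[OF e] zero_comp[OF e IO] by simp
    then show "perfect C I X" using zero_object_intro[OF IO] X by (simp add: perfect_def)
  qed
next
  case False
  then show ?thesis using hom_Dom_Obj null_hom unfolding perfect_def by blast
qed

section \<open>Central extensions and null elements\<close>

text \<open>With \<open>a, b\<close> the projections of the kernel pair \<open>R\<close> of \<open>f\<close>, this says that the null part of \<open>R\<close> is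
  contained in the diagonal; quantifying over all parallel pairs avoids choosing a kernel pair.  For groups
  and abelianization it is the condition \<open>[Ker f, X] = 1\<close>: \<open>R\<close> is generated by the diagonal and the
  pairs \<open>(1, k)\<close> with \<open>k\<close> in the kernel, and the commutator of \<open>(1, k)\<close> and \<open>(x, x)\<close> is \<open>(1, [k, x])\<close>.\<close>
definition identifies_null :: "'m \<Rightarrow> bool" where
  "identifies_null f \<longleftrightarrow> (\<forall>W Z a b w. a \<in> hom C W (Dom C f) \<and> b \<in> hom C W (Dom C f) \<and>
     f \<cdot> a = f \<cdot> b \<and> w \<in> null Z W \<longrightarrow> a \<cdot> w = b \<cdot> w)"

lemma identifies_nullI:
  assumes "f \<in> hom C X Y"
    and "\<And>W Z a b w. \<lbrakk>a \<in> hom C W X; b \<in> hom C W X; f \<cdot> a = f \<cdot> b; w \<in> null Z W\<rbrakk> \<Longrightarrow> a \<cdot> w = b \<cdot> w"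
  shows "identifies_null f"
proof -
  have "Dom C f = X" using assms(1) by (simp add: hom_def)
  then show ?thesis unfolding identifies_null_def using assms(2) by blast
qed

lemma identifies_nullD:
  assumes "identifies_null f" "f \<in> hom C X Y"
    "a \<in> hom C W X" "b \<in> hom C W X" "f \<cdot> a = f \<cdot> b" "w \<in> null Z W"
  shows "a \<cdot> w = b \<cdot> w"
proof -
  have "Dom C f = X" using assms(2) by (simp add: hom_def)
  then show ?thesis using assms unfolding identifies_null_def by blast
qed

lemma identifies_null_mono:
  assumes "identifies_null f" "f \<in> hom C X Y" "mono C m" "m \<in> hom C V X"
  shows "identifies_null (f \<cdot> m)"
proof (rule identifies_nullI[OF Comp_hom[OF assms(4,2)]])
  fix W Z a b w
  assume ab: "a \<in> hom C W V" "b \<in> hom C W V" "(f \<cdot> m) \<cdot> a = (f \<cdot> m) \<cdot> b" "w \<in> null Z W"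
  note wh = null_hom[OF ab(4)]
  have "f \<cdot> (m \<cdot> a) = f \<cdot> (m \<cdot> b)"
    using ab(3) Comp_assoc[OF ab(1) assms(4,2)] Comp_assoc[OF ab(2) assms(4,2)] by simp
  then have "(m \<cdot> a) \<cdot> w = (m \<cdot> b) \<cdot> w"
    using identifies_nullD[OF assms(1,2) Comp_hom[OF ab(1) assms(4)] Comp_hom[OF ab(2) assms(4)] _ ab(4)]
    by blast
  then show "a \<cdot> w = b \<cdot> w"
    using Comp_assoc[OF wh ab(1) assms(4)] Comp_assoc[OF wh ab(2) assms(4)]
      mono_eq[OF assms(3,4) Comp_hom[OF wh ab(1)] Comp_hom[OF wh ab(2)]] by simp
qed

text \<open>Not only null elements but elements with the same image in \<open>I W\<close> are controlled: the kernel of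
  \<open>(b, \<eta>)\<close> is annihilated by \<open>a\<close>, so the kernel pair of \<open>(b, \<eta>)\<close> is identified by \<open>a\<close>.\<close>
lemma identifies_null_coset:
  assumes f: "identifies_null f" "f \<in> hom C X Y"
    and ab: "a \<in> hom C W X" "b \<in> hom C W X" "f \<cdot> a = f \<cdot> b"
    and xy: "x \<in> hom C Z W" "y \<in> hom C Z W" "\<eta> W \<cdot> x = \<eta> W \<cdot> y" "b \<cdot> x = b \<cdot> y"
  shows "a \<cdot> x = a \<cdot> y"
proof -
  note W = hom_Dom_Obj[OF ab(1)] and X = hom_Cod_Obj[OF ab(1)]
  note e = eta_hom[OF W]
  note IO = hom_Cod_Obj[OF e]
  obtain P p q where P: "is_product C X (obj_map I W) P p q" using product_exists[OF X IO] .
  note pq = product_homs[OF P]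
  obtain h where h: "h \<in> hom C W P" "p \<cdot> h = b" "q \<cdot> h = \<eta> W" using product_lift[OF P ab(2) e] .
  note hx = comp_eq[OF h(2) pq(1) h(1)] comp_eq[OF h(3) pq(2) h(1)]
  show ?thesis
  proof (rule kernel_le_imp_kernel_pair_le[OF h(1) ab(1) X _ xy(1,2)])
    show "h \<cdot> x = h \<cdot> y"
      by (rule product_eq[OF P Comp_hom[OF xy(1) h(1)] Comp_hom[OF xy(2) h(1)]])
        (simp_all add: hx[OF xy(1)] hx[OF xy(2)] xy(3,4))
  next
    fix V n assume n: "n \<in> hom C V W" "h \<cdot> n = zero V P"
    note V = hom_Dom_Obj[OF n(1)]
    have "b \<cdot> n = zero V X" "\<eta> W \<cdot> n = zero V (obj_map I W)"
      using hx[OF n(1)] n(2) comp_zero[OF pq(1) V] comp_zero[OF pq(2) V] by simp_all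
    moreover from this have "n \<in> null V W" using n(1) by (simp add: null_def)
    ultimately show "a \<cdot> n = zero V X" using identifies_nullD[OF f ab] by simp
  qed
qed

text \<open>Pull \<open>f\<close> back to a trivial extension \<open>q : Q \<rightarrow> G\<close>.  Elements of \<open>Q\<close> are determined by their images
  in \<open>G\<close> and \<open>I Q\<close>, so a null element of \<open>Q\<close> is determined by its image in \<open>G\<close>.  Over a cover, \<open>a\<close> and
  \<open>b\<close> lift to arrows into \<open>Q\<close> with the same component in \<open>G\<close>.\<close>
lemma central_imp_identifies_null:
  assumes cent: "central_extension C I \<eta> f" and f: "f \<in> hom C D E"
  shows "identifies_null f"
proof (rule identifies_nullI[OF f])
  obtain g p q where g: "regular_epi C g" "is_pullback C f g p q" "trivial_extension C I \<eta> q"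
    using cent unfolding central_extension_def by blast
  define Q G where "Q = Dom C p" and "G = Dom C g"
  have Dq: "Dom C q = Q" "Dom C f = D" "Cod C q = G" "Cod C g = E"
    using g(2) f unfolding is_pullback_def hom_def by (simp_all add: Q_def G_def)
  have pq: "p \<in> hom C Q D" "q \<in> hom C Q G" "g \<in> hom C G E"
    using pullback_homs[OF g(2)] Dq by (simp_all add: Q_def G_def)
  note fpgq = pullback_homs(5)[OF g(2)]
  have triv: "is_pullback C (\<eta> G) (arr_map I q) q (\<eta> Q)"
    using g(3) Dq by (simp add: trivial_extension_def)
  note QO = hom_Dom_Obj[OF pq(2)]
  fix W Z a b w
  assume ab: "a \<in> hom C W D" "b \<in> hom C W D" "f \<cdot> a = f \<cdot> b" and w: "w \<in> null Z W"
  obtain S s1 s2 where S: "is_pullback C g (f \<cdot> a) s2 s1" "s2 \<in> hom C S G" "s1 \<in> hom C S W"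
    "g \<cdot> s2 = (f \<cdot> a) \<cdot> s1"
    using pullback_exists[OF pq(3) Comp_hom[OF ab(1) f]] .
  have s1: "regular_epi C s1" using pullback_regular_epi[OF S(1) g(1)] .
  have as: "f \<cdot> (a \<cdot> s1) = g \<cdot> s2" using S(4) Comp_assoc[OF S(3) ab(1) f] by simp
  have bs: "f \<cdot> (b \<cdot> s1) = g \<cdot> s2" using S(4) Comp_assoc[OF S(3) ab(2) f] ab(3) by simp
  obtain a' where a': "a' \<in> hom C S Q" "p \<cdot> a' = a \<cdot> s1" "q \<cdot> a' = s2"
    using pullback_lift[OF g(2) pq(1,2) Comp_hom[OF S(3) ab(1)] S(2) as] .
  obtain b' where b': "b' \<in> hom C S Q" "p \<cdot> b' = b \<cdot> s1" "q \<cdot> b' = s2"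
    using pullback_lift[OF g(2) pq(1,2) Comp_hom[OF S(3) ab(2)] S(2) bs] .
  show "a \<cdot> w = b \<cdot> w"
  proof (rule null_eq_descent[OF s1 S(3) ab(1,2) _ w])
    fix Z' v assume v: "v \<in> null Z' S"
    note vh = null_hom[OF v]
    have n: "a' \<cdot> v \<in> null Z' Q" "b' \<cdot> v \<in> null Z' Q"
      using comp_null[OF v a'(1)] comp_null[OF v b'(1)] by auto
    have "a' \<cdot> v = b' \<cdot> v"
    proof (rule pullback_eq[OF triv pq(2)])
      show "a' \<cdot> v \<in> hom C Z' Q" "b' \<cdot> v \<in> hom C Z' Q" using n null_hom by auto
      show "q \<cdot> (a' \<cdot> v) = q \<cdot> (b' \<cdot> v)"
        using comp_eq[OF a'(3) pq(2) a'(1) vh] comp_eq[OF b'(3) pq(2) b'(1) vh] by simp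
      show "\<eta> Q \<cdot> (a' \<cdot> v) = \<eta> Q \<cdot> (b' \<cdot> v)" using n by (simp add: null_def)
    qed
    then show "(a \<cdot> s1) \<cdot> v = (b \<cdot> s1) \<cdot> v"
      using comp_eq[OF a'(2) pq(1) a'(1) vh] comp_eq[OF b'(2) pq(1) b'(1) vh] by simp
  qed
qed

text \<open>The extension \<open>f\<close> is split by itself: the projection \<open>q : R \<rightarrow> D\<close> of its kernel pair is trivial.
  An element of \<open>R\<close> is determined by its images in \<open>D\<close> and \<open>I R\<close> by the coset lemma above.
  Conversely, a compatible pair in \<open>D\<close> and \<open>I R\<close> comes from \<open>R\<close> over a cover by difunctionality, and by
  uniqueness the element descends along the cover.\<close>
lemma identifies_null_imp_central:
  assumes f: "regular_epi C f" "f \<in> hom C D E" and idn: "identifies_null f"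
  shows "central_extension C I \<eta> f"
proof -
  obtain R p q where R: "is_pullback C f f p q" "p \<in> hom C R D" "q \<in> hom C R D" "f \<cdot> p = f \<cdot> q"
    using pullback_exists[OF f(2,2)] .
  have q: "regular_epi C q" using pullback_regular_epi[OF R(1) f(1)] .
  note DR = hom_Dom_Obj[OF f(2)] hom_Dom_Obj[OF R(2)]
  note e = eta_hom[OF DR(1)] eta_hom[OF DR(2)]
  note Iq = I_hom[OF R(3)]
  have uniq: "r = r'" if r: "r \<in> hom C Z R" "r' \<in> hom C Z R" "q \<cdot> r = q \<cdot> r'" "\<eta> R \<cdot> r = \<eta> R \<cdot> r'"
    for Z r r'
    by (rule pullback_eq[OF R(1,2) r(1,2) _ r(3)])
      (rule identifies_null_coset[OF idn f(2) R(2,3,4) r(1,2,4,3)])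
  obtain d where d: "d \<in> hom C D R" "p \<cdot> d = Id C D" "q \<cdot> d = Id C D"
    using pullback_lift[OF R(1-3) Id_hom[OF DR(1)] Id_hom[OF DR(1)] refl] .
  have "is_pullback C (\<eta> D) (arr_map I q) q (\<eta> R)"
    unfolding is_pullback_iff[OF e(1) Iq R(3) e(2)]
  proof (intro conjI allI ballI impI)
    show "\<eta> D \<cdot> q = arr_map I q \<cdot> \<eta> R" using eta_natural[OF R(3)] .
    fix Z x w
    assume x: "x \<in> hom C Z D" and w: "w \<in> hom C Z (obj_map I R)" and xw: "\<eta> D \<cdot> x = arr_map I q \<cdot> w"
    obtain Z1 z1 r where 1: "regular_epi C z1" "z1 \<in> hom C Z1 Z" "r \<in> hom C Z1 R" "\<eta> R \<cdot> r = w \<cdot> z1"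
      using cover_lift[OF eta_regular_epi[OF DR(2)] e(2) w] .
    have qr: "q \<cdot> r \<in> hom C Z1 D" and xz: "x \<cdot> z1 \<in> hom C Z1 D"
      using Comp_hom[OF 1(3) R(3)] Comp_hom[OF 1(2) x] by auto
    have dd: "d \<cdot> (q \<cdot> r) \<in> hom C Z1 R" "d \<cdot> (x \<cdot> z1) \<in> hom C Z1 R"
      using Comp_hom[OF qr d(1)] Comp_hom[OF xz d(1)] by auto
    have qd: "q \<cdot> (d \<cdot> y) = y" if "y \<in> hom C V D" for y V
      using comp_Id_eq[OF d(3) R(3) d(1) that] .
    have "\<eta> D \<cdot> (q \<cdot> r) = arr_map I q \<cdot> (\<eta> R \<cdot> r)"
      using comp_eq[OF eta_natural[OF R(3)] e(1) R(3) 1(3)] Comp_assoc[OF 1(3) e(2) Iq] by simp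
    also have "\<dots> = \<eta> D \<cdot> (x \<cdot> z1)"
      unfolding 1(4) using comp_eq[OF xw e(1) x 1(2)] Comp_assoc[OF 1(2) w Iq] by simp
    finally have ee: "\<eta> D \<cdot> (q \<cdot> r) = \<eta> D \<cdot> (x \<cdot> z1)" .
    have ed: "\<eta> R \<cdot> (d \<cdot> y) = arr_map I d \<cdot> (\<eta> D \<cdot> y)" if "y \<in> hom C V D" for y V
      using comp_eq[OF eta_natural[OF d(1)] e(2) d(1) that] Comp_assoc[OF that e(1) I_hom[OF d(1)]] by simp
    have edd: "\<eta> R \<cdot> (d \<cdot> (x \<cdot> z1)) = \<eta> R \<cdot> (d \<cdot> (q \<cdot> r))"
      unfolding ed[OF qr] ed[OF xz] ee ..
    \<comment> \<open>In \<open>R\<close>, the pairs \<open>r\<close>, \<open>d q r\<close> agree over \<open>D\<close> and \<open>d q r\<close>, \<open>d x\<close> agree in \<open>I R\<close>.\<close>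
    obtain Z2 z2 t where 2: "regular_epi C z2" "z2 \<in> hom C Z2 Z1" "t \<in> hom C Z2 R"
      "q \<cdot> t = q \<cdot> ((d \<cdot> (x \<cdot> z1)) \<cdot> z2)" "\<eta> R \<cdot> t = \<eta> R \<cdot> (r \<cdot> z2)"
      using span_difunctional[OF R(3) e(2) dd(2,1) 1(3) edd qd[OF qr]] .
    define z where "z = z1 \<cdot> z2"
    have z: "regular_epi C z" "z \<in> hom C Z2 Z"
      using regular_epi_comp[OF 2(1,2) 1(1,2)] Comp_hom[OF 2(2) 1(2)] by (simp_all add: z_def)
    have qt: "q \<cdot> t = x \<cdot> z"
    proof -
      have "(d \<cdot> (x \<cdot> z1)) \<cdot> z2 = d \<cdot> (x \<cdot> z)"
        using Comp_assoc[OF 2(2) xz d(1)] Comp_assoc[OF 2(2) 1(2) x] by (simp add: z_def)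
      then show ?thesis using 2(4) qd[OF Comp_hom[OF z(2) x]] by simp
    qed
    have et: "\<eta> R \<cdot> t = w \<cdot> z"
      using 2(5) comp_eq[OF 1(4) e(2) 1(3) 2(2)] Comp_assoc[OF 2(2) 1(2) w] by (simp add: z_def)
    obtain k where k: "k \<in> hom C Z R" "k \<cdot> z = t"
    proof (rule regular_epi_factor[OF z 2(3)])
      fix V s s' assume s: "s \<in> hom C V Z2" "s' \<in> hom C V Z2" "z \<cdot> s = z \<cdot> s'"
      show "t \<cdot> s = t \<cdot> s'"
      proof (rule uniq[OF Comp_hom[OF s(1) 2(3)] Comp_hom[OF s(2) 2(3)]])
        show "q \<cdot> (t \<cdot> s) = q \<cdot> (t \<cdot> s')"
          using comp_eq[OF qt R(3) 2(3) s(1)] comp_eq[OF qt R(3) 2(3) s(2)] s(3)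
            Comp_assoc[OF s(1) z(2) x] Comp_assoc[OF s(2) z(2) x] by simp
        show "\<eta> R \<cdot> (t \<cdot> s) = \<eta> R \<cdot> (t \<cdot> s')"
          using comp_eq[OF et e(2) 2(3) s(1)] comp_eq[OF et e(2) 2(3) s(2)] s(3)
            Comp_assoc[OF s(1) z(2) w] Comp_assoc[OF s(2) z(2) w] by simp
      qed
    qed
    have "q \<cdot> k = x"
      by (rule regular_epi_epi[OF z Comp_hom[OF k(1) R(3)] x])
        (simp add: Comp_assoc[OF z(2) k(1) R(3)] k(2) qt)
    moreover have "\<eta> R \<cdot> k = w"
      by (rule regular_epi_epi[OF z Comp_hom[OF k(1) e(2)] w])
        (simp add: Comp_assoc[OF z(2) k(1) e(2)] k(2) et)
    ultimately show "\<exists>!h. h \<in> hom C Z R \<and> q \<cdot> h = x \<and> \<eta> R \<cdot> h = w"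
      using k(1) by (intro ex1I[of _ k]) (auto intro: uniq)
  qed
  moreover have "Cod C q = D" "Dom C q = R" using R(3) by (simp_all add: hom_def)
  ultimately have "trivial_extension C I \<eta> q" using q by (simp add: trivial_extension_def)
  then show ?thesis using f(1) R(1) unfolding central_extension_def by blast
qed

lemma central_iff:
  "f \<in> hom C D E \<Longrightarrow> central_extension C I \<eta> f \<longleftrightarrow> regular_epi C f \<and> identifies_null f"
  using central_imp_identifies_null identifies_null_imp_central
  unfolding central_extension_def by blast

section \<open>Universal central extensions of perfect objects\<close>

lemma perfect_quotient:
  assumes "perfect C I X" "regular_epi C f" "f \<in> hom C X Y"
  shows "perfect C I Y"
proof -
  note XY = hom_Dom_Obj[OF assms(3)] hom_Cod_Obj[OF assms(3)]
  note e = eta_hom[OF XY(2)]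
  note IO = hom_Cod_Obj[OF e]
  have "f \<cdot> Id C X \<in> null X Y"
    using comp_null[OF _ assms(3)] assms(1) unfolding perfect_iff by blast
  then have "\<eta> Y \<cdot> f = zero Y (obj_map I Y) \<cdot> f"
    using Comp_Id[OF assms(3)] zero_comp[OF assms(3) IO] by (simp add: null_def)
  then have "\<eta> Y = zero Y (obj_map I Y)"
    using regular_epi_epi[OF assms(2,3) e zero_hom[OF XY(2) IO]] by blast
  then show ?thesis using Comp_Id[OF e] Id_hom[OF XY(2)] by (simp add: perfect_iff null_def)
qed

text \<open>Let \<open>\<pi> : P \<rightarrow> A\<close> be a projective cover with kernel pair \<open>R\<close>.  The largest central quotient of \<open>\<pi>\<close>
  identifies \<open>x\<close> and \<open>y\<close> when \<open>(x, y)\<close> and \<open>(x, x)\<close> have the same image in \<open>I R\<close>; for groups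
  this says that \<open>(1, x\<^sup>-\<^sup>1 y) \<in> [R, R]\<close>, and the quotient is \<open>P / [Ker \<pi>, P]\<close>.  This relation
  is visibly reflexive, hence an equivalence relation.  An arrow from
  \<open>P\<close> into a central extension of \<open>A\<close> respects it by the coset lemma, and such arrows exist as \<open>P\<close> is
  projective.\<close>
lemma weakly_universal_exists:
  assumes proj: "enough_projectives C" and A: "A \<in> Obj C"
  obtains E u where "u \<in> hom C E A" "central_extension C I \<eta> u"
    "\<And>F k. \<lbrakk>k \<in> hom C F A; central_extension C I \<eta> k\<rbrakk> \<Longrightarrow> \<exists>l\<in>hom C E F. k \<cdot> l = u"
proof -
  obtain \<pi> where \<pi>: "regular_epi C \<pi>" "Cod C \<pi> = A" "projective C (Dom C \<pi>)"
    using proj A unfolding enough_projectives_def by blast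
  define P where "P = Dom C \<pi>"
  have \<pi>h: "\<pi> \<in> hom C P A" using regular_epi_hom[OF \<pi>(1)] \<pi>(2) by (simp add: P_def)
  note PO = hom_Dom_Obj[OF \<pi>h]
  obtain R p q where R: "is_pullback C \<pi> \<pi> p q" "p \<in> hom C R P" "q \<in> hom C R P" "\<pi> \<cdot> p = \<pi> \<cdot> q"
    using pullback_exists[OF \<pi>h \<pi>h] .
  note RO = hom_Dom_Obj[OF R(2)]
  note e = eta_hom[OF RO]
  obtain d where d: "d \<in> hom C P R" "p \<cdot> d = Id C P" "q \<cdot> d = Id C P"
    using pullback_lift[OF R(1-3) Id_hom[OF PO] Id_hom[OF PO] refl] .
  have dp: "d \<cdot> p \<in> hom C R R" using Comp_hom[OF R(2) d(1)] .
  have pd: "p \<cdot> (d \<cdot> x) = x" "q \<cdot> (d \<cdot> x) = x" if "x \<in> hom C V P" for x V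
    using comp_Id_eq[OF d(2) R(2) d(1) that] comp_Id_eq[OF d(3) R(3) d(1) that] by auto
  \<comment> \<open>A pair \<open>(x, y)\<close> lies in \<open>M\<close> when it is congruent to \<open>(x, x)\<close> in \<open>I R\<close>.\<close>
  obtain M i where M: "i \<in> hom C M R" "mono C i" "\<eta> R \<cdot> i = (\<eta> R \<cdot> (d \<cdot> p)) \<cdot> i"
    "\<And>Z x. \<lbrakk>x \<in> hom C Z R; \<eta> R \<cdot> x = (\<eta> R \<cdot> (d \<cdot> p)) \<cdot> x\<rbrakk> \<Longrightarrow> \<exists>y\<in>hom C Z M. i \<cdot> y = x"
    by (rule equalizer_exists[OF e Comp_hom[OF dp e]]) blast
  have edp: "(\<eta> R \<cdot> (d \<cdot> p)) \<cdot> x = \<eta> R \<cdot> (d \<cdot> (p \<cdot> x))" if "x \<in> hom C V R" for x V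
    using Comp_assoc[OF that dp e] Comp_assoc[OF that R(2) d(1)] by simp
  have r: "p \<cdot> i \<in> hom C M P" "q \<cdot> i \<in> hom C M P"
    using Comp_hom[OF M(1) R(2)] Comp_hom[OF M(1) R(3)] by auto
  have "d \<cdot> (p \<cdot> d) = d" using d Comp_Id by simp
  then obtain d' where d': "d' \<in> hom C P M" "i \<cdot> d' = d"
    using M(4)[OF d(1)] edp[OF d(1)] by auto
  obtain E c where E: "regular_epi C c" "c \<in> hom C P E" "c \<cdot> (p \<cdot> i) = c \<cdot> (q \<cdot> i)"
    "\<And>Z x y. \<lbrakk>x \<in> hom C Z P; y \<in> hom C Z P; c \<cdot> x = c \<cdot> y\<rbrakk>
      \<Longrightarrow> \<exists>t\<in>hom C Z M. (p \<cdot> i) \<cdot> t = x \<and> (q \<cdot> i) \<cdot> t = y"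
  proof (rule reflexive_relation_quotient[OF r _ d'(1)])
    show "(p \<cdot> i) \<cdot> d' = Id C P" "(q \<cdot> i) \<cdot> d' = Id C P"
      using Comp_assoc[OF d'(1) M(1) R(2)] Comp_assoc[OF d'(1) M(1) R(3)] d' d by simp_all
    show "a = b" if ab: "a \<in> hom C Z M" "b \<in> hom C Z M" "(p \<cdot> i) \<cdot> a = (p \<cdot> i) \<cdot> b"
      "(q \<cdot> i) \<cdot> a = (q \<cdot> i) \<cdot> b" for Z a b
    proof (rule mono_eq[OF M(2,1) ab(1,2)])
      show "i \<cdot> a = i \<cdot> b"
        by (rule pullback_eq[OF R(1,2) Comp_hom[OF ab(1) M(1)] Comp_hom[OF ab(2) M(1)]])
          (use ab(3,4) in \<open>simp_all add: Comp_assoc[OF ab(1) M(1) R(2)] Comp_assoc[OF ab(2) M(1) R(2)]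
             Comp_assoc[OF ab(1) M(1) R(3)] Comp_assoc[OF ab(2) M(1) R(3)]\<close>)
    qed
  qed blast
  have c_eqD: "\<exists>t\<in>hom C Z M. p \<cdot> (i \<cdot> t) = x \<and> q \<cdot> (i \<cdot> t) = y"
    if xy: "x \<in> hom C Z P" "y \<in> hom C Z P" "c \<cdot> x = c \<cdot> y" for Z x y
    using E(4)[OF xy] Comp_assoc[OF _ M(1) R(2)] Comp_assoc[OF _ M(1) R(3)] by auto
  obtain u where u: "u \<in> hom C E A" "u \<cdot> c = \<pi>"
  proof (rule regular_epi_factor[OF E(1,2) \<pi>h])
    fix W s t assume st: "s \<in> hom C W P" "t \<in> hom C W P" "c \<cdot> s = c \<cdot> t"
    obtain m where m: "m \<in> hom C W M" "p \<cdot> (i \<cdot> m) = s" "q \<cdot> (i \<cdot> m) = t" using c_eqD[OF st] by blast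
    have im: "i \<cdot> m \<in> hom C W R" using Comp_hom[OF m(1) M(1)] .
    show "\<pi> \<cdot> s = \<pi> \<cdot> t"
      using comp_eq[OF R(4) \<pi>h R(2) im] Comp_assoc[OF im R(3) \<pi>h] m(2,3) by simp
  qed
  have ru: "regular_epi C u" using regular_epi_cancel[OF _ E(2) u(1)] \<pi>(1) u(2) by simp
  have idn: "identifies_null u"
  proof (rule identifies_nullI[OF u(1)])
    fix W Z a b w assume ab: "a \<in> hom C W E" "b \<in> hom C W E" "u \<cdot> a = u \<cdot> b" and w: "w \<in> null Z W"
    obtain V z a' b' where z: "regular_epi C z" "z \<in> hom C V W" "a' \<in> hom C V P" "b' \<in> hom C V P"
      "c \<cdot> a' = a \<cdot> z" "c \<cdot> b' = b \<cdot> z"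
      using cover_lift_pair[OF E(1,2) ab(1,2)] .
    have "\<pi> \<cdot> a' = \<pi> \<cdot> b'"
      using comp_eq[OF u(2,1) E(2) z(3)] comp_eq[OF u(2,1) E(2) z(4)] z(5,6)
        comp_eq[OF ab(3) u(1) ab(1) z(2)] Comp_assoc[OF z(2) ab(2) u(1)] by simp
    then obtain g where g: "g \<in> hom C V R" "p \<cdot> g = a'" "q \<cdot> g = b'"
      using pullback_lift[OF R(1-3) z(3,4)] by blast
    show "a \<cdot> w = b \<cdot> w"
    proof (rule null_eq_descent[OF z(1,2) ab(1,2) _ w])
      fix Z w assume w: "w \<in> null Z V"
      note wh = null_hom[OF w]
      have gw: "g \<cdot> w \<in> null Z R" using comp_null[OF w g(1)] .
      have "\<eta> R \<cdot> (g \<cdot> w) = (\<eta> R \<cdot> (d \<cdot> p)) \<cdot> (g \<cdot> w)"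
        using gw comp_null[OF gw dp] Comp_assoc[OF null_hom[OF gw] dp e] by (simp add: null_def)
      then obtain t where t: "t \<in> hom C Z M" "i \<cdot> t = g \<cdot> w" using M(4)[OF null_hom[OF gw]] by blast
      have "(p \<cdot> i) \<cdot> t = a' \<cdot> w" "(q \<cdot> i) \<cdot> t = b' \<cdot> w"
        using Comp_assoc[OF t(1) M(1) R(2)] Comp_assoc[OF t(1) M(1) R(3)] t(2)
          comp_eq[OF g(2) R(2) g(1) wh] comp_eq[OF g(3) R(3) g(1) wh] by simp_all
      then have "c \<cdot> (a' \<cdot> w) = c \<cdot> (b' \<cdot> w)"
        using comp_eq[OF E(3,2) r(1) t(1)] Comp_assoc[OF t(1) r(2) E(2)] by simp
      then show "(a \<cdot> z) \<cdot> w = (b \<cdot> z) \<cdot> w"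
        using comp_eq[OF z(5) E(2) z(3) wh] comp_eq[OF z(6) E(2) z(4) wh] by simp
    qed
  qed
  show thesis
  proof (rule that[OF u(1)])
    show "central_extension C I \<eta> u" using central_iff[OF u(1)] ru idn by blast
    fix F k assume k: "k \<in> hom C F A" and ck: "central_extension C I \<eta> k"
    then have rk: "regular_epi C k" and ik: "identifies_null k" using central_iff[OF k] by auto
    have "Dom C k = F" "Cod C k = A" using k by (simp_all add: hom_def)
    then obtain \<kappa> where \<kappa>: "\<kappa> \<in> hom C P F" "k \<cdot> \<kappa> = \<pi>"
      using \<pi>(3) \<pi>h rk unfolding projective_def P_def by auto
    obtain l where l: "l \<in> hom C E F" "l \<cdot> c = \<kappa>"
    proof (rule regular_epi_factor[OF E(1,2) \<kappa>(1)])
      fix W s t assume st: "s \<in> hom C W P" "t \<in> hom C W P" "c \<cdot> s = c \<cdot> t"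
      obtain m where m: "m \<in> hom C W M" "p \<cdot> (i \<cdot> m) = s" "q \<cdot> (i \<cdot> m) = t" using c_eqD[OF st] by blast
      have im: "i \<cdot> m \<in> hom C W R" "d \<cdot> s \<in> hom C W R"
        using Comp_hom[OF m(1) M(1)] Comp_hom[OF st(1) d(1)] by auto
      have \<kappa>pq: "\<kappa> \<cdot> q \<in> hom C R F" "\<kappa> \<cdot> p \<in> hom C R F"
        using Comp_hom[OF R(2) \<kappa>(1)] Comp_hom[OF R(3) \<kappa>(1)] by auto
      have "k \<cdot> (\<kappa> \<cdot> q) = k \<cdot> (\<kappa> \<cdot> p)"
        using comp_eq[OF \<kappa>(2) k \<kappa>(1) R(2)] comp_eq[OF \<kappa>(2) k \<kappa>(1) R(3)] R(4) by simp
      moreover have "\<eta> R \<cdot> (d \<cdot> s) = \<eta> R \<cdot> (i \<cdot> m)"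
        using comp_eq[OF M(3) e M(1) m(1)] Comp_assoc[OF m(1) M(1) Comp_hom[OF dp e]] edp[OF im(1)] m(2)
        by simp
      moreover have "(\<kappa> \<cdot> p) \<cdot> (d \<cdot> s) = (\<kappa> \<cdot> p) \<cdot> (i \<cdot> m)"
        using Comp_assoc[OF im(1) R(2) \<kappa>(1)] Comp_assoc[OF im(2) R(2) \<kappa>(1)] pd[OF st(1)] m by simp
      ultimately have "(\<kappa> \<cdot> q) \<cdot> (d \<cdot> s) = (\<kappa> \<cdot> q) \<cdot> (i \<cdot> m)"
        using identifies_null_coset[OF ik k \<kappa>pq _ im(2,1)] by blast
      then show "\<kappa> \<cdot> s = \<kappa> \<cdot> t"
        using Comp_assoc[OF im(1) R(3) \<kappa>(1)] Comp_assoc[OF im(2) R(3) \<kappa>(1)] pd[OF st(1)] m by simp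
    qed
    have "k \<cdot> l = u"
      by (rule regular_epi_epi[OF E(1,2) Comp_hom[OF l(1) k] u(1)])
        (use Comp_assoc[OF E(2) l(1) k] l(2) \<kappa>(2) u(2) in simp)
    with l(1) show "\<exists>l\<in>hom C E F. k \<cdot> l = u" by blast
  qed
qed

text \<open>For groups, \<open>U\<close> is the commutator subgroup of a weakly universal central extension \<open>E\<close>.
  It still covers \<open>A\<close>, because all elements of \<open>A\<close> are null and null elements lift.
  Perfection follows from weak universality of \<open>E\<close>: an arrow \<open>t : E \<rightarrow> U\<close> over
  \<open>A\<close> restricts to the identity on \<open>U\<close>, and it maps the null inclusion \<open>U \<rightarrow> E\<close> to a null arrow.\<close>
lemma perfect_weakly_universal_exists:
  assumes proj: "enough_projectives C" and A: "perfect C I A"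
  obtains U u where "u \<in> hom C U A" "central_extension C I \<eta> u" "perfect C I U"
    "\<And>F k. \<lbrakk>k \<in> hom C F A; central_extension C I \<eta> k\<rbrakk> \<Longrightarrow> \<exists>l\<in>hom C U F. k \<cdot> l = u"
proof -
  have AO: "A \<in> Obj C" using A by (simp add: perfect_def)
  obtain E v where E: "v \<in> hom C E A" "central_extension C I \<eta> v"
    "\<And>F k. \<lbrakk>k \<in> hom C F A; central_extension C I \<eta> k\<rbrakk> \<Longrightarrow> \<exists>l\<in>hom C E F. k \<cdot> l = v"
    by (rule weakly_universal_exists[OF proj AO]) blast
  have v: "regular_epi C v" "identifies_null v" using central_iff[OF E(1)] E(2) by auto
  note EO = hom_Dom_Obj[OF E(1)]
  note e = eta_hom[OF EO]
  note IO = hom_Cod_Obj[OF e]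
  obtain U j where j: "j \<in> hom C U E" "mono C j" "\<eta> E \<cdot> j = zero E (obj_map I E) \<cdot> j"
    "\<And>Z x. \<lbrakk>x \<in> hom C Z E; \<eta> E \<cdot> x = zero E (obj_map I E) \<cdot> x\<rbrakk> \<Longrightarrow> \<exists>y\<in>hom C Z U. j \<cdot> y = x"
    by (rule equalizer_exists[OF e zero_hom[OF EO IO]]) blast
  have j_null: "j \<in> null U E" using j(1,3) zero_comp[OF j(1) IO] by (simp add: null_def)
  have j_lift: "\<exists>y\<in>hom C Z U. j \<cdot> y = x" if "x \<in> null Z E" for x Z
    using j(4)[OF null_hom[OF that]] that zero_comp[OF null_hom[OF that] IO] by (simp add: null_def)
  note UO = hom_Dom_Obj[OF j(1)]
  define u where "u = v \<cdot> j"
  have u: "u \<in> hom C U A" using Comp_hom[OF j(1) E(1)] by (simp add: u_def)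
  have ru: "regular_epi C u"
  proof -
    obtain Z' z x where x: "regular_epi C z" "z \<in> hom C Z' A" "x \<in> null Z' E" "v \<cdot> x = Id C A \<cdot> z"
      using null_lift[OF v(1) E(1)] A unfolding perfect_iff by blast
    obtain y where y: "y \<in> hom C Z' U" "j \<cdot> y = x" using j_lift[OF x(3)] by blast
    have "u \<cdot> y = z" using Comp_assoc[OF y(1) j(1) E(1)] y(2) x(4) Id_Comp[OF x(2)] by (simp add: u_def)
    then show ?thesis using regular_epi_cancel[OF _ y(1) u] x(1) by simp
  qed
  have cu: "central_extension C I \<eta> u"
    using central_iff[OF u] ru identifies_null_mono[OF v(2) E(1) j(2,1)] by (simp add: u_def)
  obtain t where t: "t \<in> hom C E U" "u \<cdot> t = v" using E(3)[OF u cu] by blast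
  have jt: "j \<cdot> t \<in> hom C E E" using Comp_hom[OF t(1) j(1)] .
  \<comment> \<open>\<open>j t\<close> and the identity of \<open>E\<close> agree over \<open>A\<close>, hence agree on the null arrow \<open>j\<close>.\<close>
  have "v \<cdot> Id C E = v \<cdot> (j \<cdot> t)"
    using Comp_Id[OF E(1)] t(2) Comp_assoc[OF t(1) j(1) E(1)] by (simp add: u_def)
  then have "Id C E \<cdot> j = (j \<cdot> t) \<cdot> j"
    using identifies_nullD[OF v(2) E(1) Id_hom[OF EO] jt _ j_null] by blast
  then have jj: "j \<cdot> Id C U = j \<cdot> (t \<cdot> j)"
    using Id_Comp[OF j(1)] Comp_Id[OF j(1)] Comp_assoc[OF j(1) t(1) j(1)] by simp
  have tj: "Id C U = t \<cdot> j" using mono_eq[OF j(2,1) Id_hom[OF UO] Comp_hom[OF j(1) t(1)] jj] .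
  have perf: "perfect C I U"
    unfolding perfect_iff tj by (rule comp_null[OF j_null t(1)])
  show thesis
  proof (rule that[OF u cu perf])
    fix F k assume k: "k \<in> hom C F A" "central_extension C I \<eta> k"
    then obtain l where l: "l \<in> hom C E F" "k \<cdot> l = v" using E(3) by blast
    have "k \<cdot> (l \<cdot> j) = u" using comp_eq[OF l(2) k(1) l(1) j(1)] by (simp add: u_def)
    then show "\<exists>l\<in>hom C U F. k \<cdot> l = u" using Comp_hom[OF j(1) l(1)] by blast
  qed
qed

lemma weakly_universalI:
  assumes u: "u \<in> hom C U A" "central_extension C I \<eta> u"
    and lift: "\<And>F k. \<lbrakk>k \<in> hom C F A; central_extension C I \<eta> k\<rbrakk> \<Longrightarrow> \<exists>l\<in>hom C U F. k \<cdot> l = u"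
  shows "weakly_universal_central_extension C I \<eta> u"
proof -
  have A: "Cod C u = A" "Dom C u = U" "u \<in> Arr C" using u(1) by (simp_all add: hom_def)
  have "\<exists>f. f \<in> hom (central_extensions_of C I \<eta> A) u k"
    if k: "central_extension C I \<eta> k" "Cod C k = A" for k
  proof -
    have kh: "k \<in> hom C (Dom C k) A"
      using regular_epi_hom[of k] k unfolding central_extension_def by simp
    then obtain l where l: "l \<in> hom C U (Dom C k)" "k \<cdot> l = u" using lift k(1) by blast
    have "k \<in> Arr C" using kh by (simp add: hom_def)
    then have "(u, l, k) \<in> hom (central_extensions_of C I \<eta> A) u k"
      unfolding central_extensions_of_def hom_full_subcategory hom_slice using A k u(2) l by simp
    then show ?thesis by blast
  qed
  moreover have "Obj (central_extensions_of C I \<eta> A) = {k. central_extension C I \<eta> k \<and> Cod C k = A}"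
    by (simp add: central_extensions_of_def full_subcategory_def)
  ultimately show ?thesis
    unfolding weakly_universal_central_extension_def weakly_initial_def A(1) using A(1) u(2) by blast
qed

text \<open>Condition (4) holds for the extension constructed above, so condition (2) does.\<close>
lemma universal_of_perfect:
  assumes proj: "enough_projectives C" and five: "five_conditions_equivalent C I \<eta>" and A: "perfect C I A"
  obtains U u where "u \<in> hom C U A" "central_extension C I \<eta> u" "perfect C I U"
    "\<And>D E f g. \<lbrakk>f \<in> hom C D E; central_extension C I \<eta> f; g \<in> hom C U E\<rbrakk> \<Longrightarrow> \<exists>h\<in>hom C U D. f \<cdot> h = g"
proof -
  obtain U u where U: "u \<in> hom C U A" "central_extension C I \<eta> u" "perfect C I U"
    "\<And>F k. \<lbrakk>k \<in> hom C F A; central_extension C I \<eta> k\<rbrakk> \<Longrightarrow> \<exists>l\<in>hom C U F. k \<cdot> l = u"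
    by (rule perfect_weakly_universal_exists[OF proj A]) blast
  have "weakly_universal_central_extension C I \<eta> u" using weakly_universalI[OF U(1,2,4)] .
  moreover have "Dom C u = U" using U(1) by (simp add: hom_def)
  ultimately have "projective_wrt_central C I \<eta> U"
    using five U(2,3) unfolding five_conditions_equivalent_def Let_def by blast
  then have pr: "\<And>f g. central_extension C I \<eta> f \<Longrightarrow> g \<in> hom C U (Cod C f) \<Longrightarrow> \<exists>h\<in>hom C U (Dom C f). f \<cdot> h = g"
    unfolding projective_wrt_central_def by blast
  show thesis
  proof (rule that[OF U(1-3)])
    fix D E f g assume f: "f \<in> hom C D E" "central_extension C I \<eta> f" "g \<in> hom C U E"
    then have "Dom C f = D" "Cod C f = E" by (simp_all add: hom_def)
    with pr[OF f(2)] f(3) show "\<exists>h\<in>hom C U D. f \<cdot> h = g" by simp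
  qed
qed

section \<open>Composing central extensions\<close>

text \<open>The substitute for the three subgroups lemma.  The arrow \<open>b\<close> makes it possible to compare elements of
  \<open>D\<close> with the same image in \<open>A\<close> by elements of \<open>U\<close>: centrality of \<open>f b\<close> equates these on null elements, and
  centrality of \<open>g\<close> relates them to the original ones through the lifting \<open>c\<close>.\<close>
lemma identifies_null_comp:
  assumes g: "identifies_null g" "g \<in> hom C D B'" and f: "f \<in> hom C B' A"
    and b: "regular_epi C b" "b \<in> hom C U B'" and u: "identifies_null (f \<cdot> b)"
    and c: "c \<in> hom C U D" "g \<cdot> c = b"
  shows "identifies_null (f \<cdot> g)"
proof (rule identifies_nullI[OF Comp_hom[OF g(2) f]])
  fix W Z x y w
  assume xy: "x \<in> hom C W D" "y \<in> hom C W D" "(f \<cdot> g) \<cdot> x = (f \<cdot> g) \<cdot> y" and w: "w \<in> null Z W"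
  have gxy: "g \<cdot> x \<in> hom C W B'" "g \<cdot> y \<in> hom C W B'"
    using Comp_hom[OF xy(1) g(2)] Comp_hom[OF xy(2) g(2)] by auto
  obtain V z x' y' where z: "regular_epi C z" "z \<in> hom C V W" "x' \<in> hom C V U" "y' \<in> hom C V U"
    "b \<cdot> x' = (g \<cdot> x) \<cdot> z" "b \<cdot> y' = (g \<cdot> y) \<cdot> z"
    using cover_lift_pair[OF b gxy] .
  have xyz: "x \<cdot> z \<in> hom C V D" "y \<cdot> z \<in> hom C V D"
    using Comp_hom[OF z(2) xy(1)] Comp_hom[OF z(2) xy(2)] by auto
  have bxy: "b \<cdot> x' = g \<cdot> (x \<cdot> z)" "b \<cdot> y' = g \<cdot> (y \<cdot> z)"
    using z(5,6) Comp_assoc[OF z(2) xy(1) g(2)] Comp_assoc[OF z(2) xy(2) g(2)] by simp_all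
  have fb: "(f \<cdot> b) \<cdot> x' = (f \<cdot> b) \<cdot> y'"
    using Comp_assoc[OF z(3) b(2) f] Comp_assoc[OF z(4) b(2) f] bxy
      Comp_assoc[OF xyz(1) g(2) f] Comp_assoc[OF xyz(2) g(2) f]
      comp_eq[OF xy(3) Comp_hom[OF g(2) f] xy(1) z(2)] Comp_assoc[OF z(2) xy(2) Comp_hom[OF g(2) f]]
    by simp
  show "x \<cdot> w = y \<cdot> w"
  proof (rule null_eq_descent[OF z(1,2) xy(1,2) _ w])
    fix Z w assume w: "w \<in> null Z V"
    note wh = null_hom[OF w]
    \<comment> \<open>\<open>g\<close> cannot distinguish \<open>a z\<close> from \<open>c a'\<close>, so their restrictions to \<open>w\<close> coincide.\<close>
    have transfer: "(a \<cdot> z) \<cdot> w = c \<cdot> (a' \<cdot> w)"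
      if a: "a \<in> hom C W D" "a' \<in> hom C V U" "b \<cdot> a' = g \<cdot> (a \<cdot> z)" for a a'
    proof -
      have "g \<cdot> (a \<cdot> z) = g \<cdot> (c \<cdot> a')" using comp_eq[OF c(2) g(2) c(1) a(2)] a(3) by simp
      then have "(a \<cdot> z) \<cdot> w = (c \<cdot> a') \<cdot> w"
        using identifies_nullD[OF g Comp_hom[OF z(2) a(1)] Comp_hom[OF a(2) c(1)] _ w] by blast
      then show ?thesis using Comp_assoc[OF wh a(2) c(1)] by simp
    qed
    have "x' \<cdot> w = y' \<cdot> w"
      by (rule identifies_nullD[OF u Comp_hom[OF b(2) f] z(3,4) fb w])
    then show "(x \<cdot> z) \<cdot> w = (y \<cdot> z) \<cdot> w"
      using transfer[OF xy(1) z(3) bxy(1)] transfer[OF xy(2) z(4) bxy(2)] by simp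
  qed
qed

text \<open>The arrows \<open>b\<close> and \<open>c\<close> of the previous lemma are liftings of a central extension \<open>u : U \<rightarrow> A\<close> of the perfect
  object \<open>A\<close>; that \<open>b\<close> is a regular epimorphism is read off from the analogous extension of \<open>B'\<close>.\<close>
lemma central_comp:
  assumes proj: "enough_projectives C" and five: "five_conditions_equivalent C I \<eta>"
    and B': "perfect C I B'"
    and f: "f \<in> hom C B' A" "central_extension C I \<eta> f"
    and g: "g \<in> hom C D B'" "central_extension C I \<eta> g"
  shows "central_extension C I \<eta> (f \<cdot> g)"
proof -
  have fr: "regular_epi C f" "identifies_null f" using central_iff[OF f(1)] f(2) by auto
  have gr: "regular_epi C g" "identifies_null g" using central_iff[OF g(1)] g(2) by auto
  obtain U u where U: "u \<in> hom C U A" "central_extension C I \<eta> u" "perfect C I U"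
    "\<And>D E f g. \<lbrakk>f \<in> hom C D E; central_extension C I \<eta> f; g \<in> hom C U E\<rbrakk> \<Longrightarrow> \<exists>h\<in>hom C U D. f \<cdot> h = g"
    by (rule universal_of_perfect[OF proj five perfect_quotient[OF B' fr(1) f(1)]]) blast
  obtain W w where W: "w \<in> hom C W B'" "central_extension C I \<eta> w" "perfect C I W"
    "\<And>D E f g. \<lbrakk>f \<in> hom C D E; central_extension C I \<eta> f; g \<in> hom C W E\<rbrakk> \<Longrightarrow> \<exists>h\<in>hom C W D. f \<cdot> h = g"
    by (rule universal_of_perfect[OF proj five B']) blast
  obtain b where b: "b \<in> hom C U B'" "f \<cdot> b = u" using U(4)[OF f U(1)] by blast
  obtain c where c: "c \<in> hom C U D" "g \<cdot> c = b" using U(4)[OF g b(1)] by blast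
  obtain l where l: "l \<in> hom C W U" "u \<cdot> l = f \<cdot> w"
    using W(4)[OF U(1,2) Comp_hom[OF W(1) f(1)]] by blast
  have bl: "b \<cdot> l \<in> hom C W B'" using Comp_hom[OF l(1) b(1)] .
  \<comment> \<open>Two liftings along \<open>f\<close> out of the perfect object \<open>W\<close> coincide.\<close>
  have "f \<cdot> (b \<cdot> l) = f \<cdot> w" using comp_eq[OF b(2) f(1) b(1) l(1)] l(2) by simp
  then have "(b \<cdot> l) \<cdot> Id C W = w \<cdot> Id C W"
    using identifies_nullD[OF fr(2) f(1) bl W(1)] W(3) unfolding perfect_iff by blast
  then have "b \<cdot> l = w" using Comp_Id[OF bl] Comp_Id[OF W(1)] by simp
  moreover have "regular_epi C w" using central_iff[OF W(1)] W(2) by blast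
  ultimately have rb: "regular_epi C b" using regular_epi_cancel[OF _ l(1) b(1)] by simp
  have "identifies_null (f \<cdot> b)" using central_iff[OF U(1)] U(2) b(2) by simp
  then have "identifies_null (f \<cdot> g)"
    using identifies_null_comp[OF gr(2) g(1) f(1) rb b(1) _ c] by blast
  then show ?thesis
    using central_iff[OF Comp_hom[OF g(1) f(1)]] regular_epi_comp[OF gr(1) g(1) fr(1) f(1)] by blast
qed

end

section \<open>Composites of central extensions with perfect middle object\<close>

theorem proposition4p6:
  fixes C :: "('o, 'm) category"
  assumes "semi_abelian C" and "enough_projectives C"
  shows "(\<forall>\<B> I \<eta>. Birkhoff_subcategory C \<B> I \<eta> \<and> Ab C \<subseteq> \<B> \<and> five_conditions_equivalent C I \<eta> \<longrightarrow>
            (\<forall>A B D f g. perfect C I B \<and>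
               f \<in> hom C B A \<and> central_extension C I \<eta> f \<and>
               g \<in> hom C D B \<and> central_extension C I \<eta> g \<longrightarrow>
               central_extension C I \<eta> (f \<cdot>\<^bsub>C\<^esub> g))) \<and>
         (\<forall>I \<eta>. is_reflector C (Ab C) I \<eta> \<and> five_conditions_equivalent C I \<eta> \<longrightarrow>
            (\<forall>A B D f g. perfect C I B \<and>
               f \<in> hom C B A \<and> central_extension C I \<eta> f \<and>
               g \<in> hom C D B \<and> central_extension C I \<eta> g \<longrightarrow>
               central_extension C I \<eta> (f \<cdot>\<^bsub>C\<^esub> g)))"
proof (intro conjI allI impI)
  interpret semi_abelian_category C by unfold_locales (rule assms(1))
  note comp = birkhoff_subcategory.central_comp[OF birkhoff_subcategory.intro[OF semi_abelian_category_axioms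
        birkhoff_subcategory_axioms.intro] assms(2)]
  show "central_extension C I \<eta> (f \<cdot>\<^bsub>C\<^esub> g)"
    if "Birkhoff_subcategory C \<B> I \<eta> \<and> Ab C \<subseteq> \<B> \<and> five_conditions_equivalent C I \<eta>"
      and "perfect C I B \<and> f \<in> hom C B A \<and> central_extension C I \<eta> f \<and>
        g \<in> hom C D B \<and> central_extension C I \<eta> g" for \<B> I \<eta> A B D f g
    using that comp[of \<B> I \<eta> B f A g D] by blast
  show "central_extension C I \<eta> (f \<cdot>\<^bsub>C\<^esub> g)"
    if "is_reflector C (Ab C) I \<eta> \<and> five_conditions_equivalent C I \<eta>"
      and "perfect C I B \<and> f \<in> hom C B A \<and> central_extension C I \<eta> f \<and>
        g \<in> hom C D B \<and> central_extension C I \<eta> g" for I \<eta> A B D f g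
    using that comp[OF Ab_Birkhoff, of I \<eta> B f A g D] by blast
qed

end
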